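(* Let $R$ be a commutative Noetherian complete local domain of Krull dimension $d$ with maximal ideal $\mathfrak m$, and let $\Lambda$ be an $R$-algebra which is a finitely generated torsion-free $R$-module. Let $e_1,\dots,e_l$ be a basic set of primitive idempotents of $\Lambda$, and let $s=\max\{s_I\mid \emptyset\ne I\subset\{1,\dots,l\}\}$ be the number defined in the context. Let $U$ be a finitely generated left $\Lambda$-module with minimal projective resolution $$P_\bullet:\ \cdots\to P_{j+1}\xrightarrow{\delta_{j+1}}P_j\xrightarrow{\delta_j}P_{j-1}\to\cdots\to P_0 .$$ Suppose that for every $j\le l(d+1)$, $\delta_{j+1}$ is zero modulo $\mathfrak m^{s}$, that is, $\mathrm{Im}\,\delta_{j+1}\subset\mathfrak m^{s}P_j$. Then $P_{l(d+1)}=0$. Equivalently, $\mathrm{proj.dim}\,U<l(d+1)$.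
   Context: $\Lambda$ is semiperfect, so finitely generated modules have minimal projective resolutions. A basic set of primitive idempotents $e_1,\dots,e_l$ is one such that $\Lambda e_1,\dots,\Lambda e_l$ is an irredundant complete list of the indecomposable projective left $\Lambda$-modules up to isomorphism. Definition of $s_I$: for a nonempty subset $I\subset\{1,\dots,l\}$ put $e_I:=\sum_{i\in I}e_i$ and $\Lambda_I:=e_I\Lambda e_I$, whose indecomposable projective left modules are the $\Lambda_I e_i$, $i\in I$. Let $x_1,\dots,x_r\in\mathfrak m$ be a maximal $\Lambda_I$-regular sequence (where $r$ is the depth of $\Lambda_I$ as an $R$-module), and let $V:=\Lambda_I/\sum_i x_i\Lambda_I$, a right $\Lambda_I$-module. Its socle $\mathrm{Soc}(V)$, the largest semisimple right $\Lambda_I$-submodule, equals $\{v\in V\mid v\,\mathfrak j_I=0\}$ where $\mathfrak j_I$ is the Jacobson radical of $\Lambda_I$, and it is nonzero. Hence one can choose an index $i_I\in I$ with $\mathrm{Soc}(V)\otimes_{\Lambda_I}\Lambda_I e_{i_I}\ne0$. With such choices fixed for each $I$, set $$s_I:=\inf\{t\ge1\mid \mathrm{Soc}(V)\otimes_{\Lambda_I}\Lambda_I e_{i_I}\not\subset V\mathfrak m^t\otimes_{\Lambda_I}\Lambda_I e_{i_I}\},$$ where both sides are regarded as submodules of $V\otimes_{\Lambda_I}\Lambda_Ie_{i_I}\cong Ve_{i_I}$. *)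

theory Defs
  imports "HOL-Algebra.Algebra" "HOL-Library.Extended_Nat" "HOL-Library.Extended_Real"
begin

section \<open>The base ring\<close>

primrec ideal_pow :: "('a, 'm) ring_scheme \<Rightarrow> 'a set \<Rightarrow> nat \<Rightarrow> 'a set" where
  "ideal_pow R I 0 = carrier R"
| "ideal_pow R I (Suc n) = ideal_prod R (ideal_pow R I n) I"

definition local_ring_with :: "('a, 'm) ring_scheme \<Rightarrow> 'a set \<Rightarrow> bool" where
  "local_ring_with R \<mm> \<longleftrightarrow> maximalideal \<mm> R \<and> (\<forall>J. maximalideal J R \<longrightarrow> J = \<mm>)"

text \<open>Uniqueness of the limit expresses that the topology is separated.\<close>

definition adic_complete :: "('a, 'm) ring_scheme \<Rightarrow> 'a set \<Rightarrow> bool" where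
  "adic_complete R I \<longleftrightarrow>
     (\<forall>x :: nat \<Rightarrow> 'a.
        (\<forall>n. x n \<in> carrier R) \<and>
        (\<forall>k. \<exists>N. \<forall>i\<ge>N. \<forall>j\<ge>N. x i \<ominus>\<^bsub>R\<^esub> x j \<in> ideal_pow R I k) \<longrightarrow>
        (\<exists>!y. y \<in> carrier R \<and> (\<forall>k. \<exists>N. \<forall>i\<ge>N. x i \<ominus>\<^bsub>R\<^esub> y \<in> ideal_pow R I k)))"

definition krull_dim :: "('a, 'm) ring_scheme \<Rightarrow> enat" where
  "krull_dim R =
     Sup {enat n | n. \<exists>p :: nat \<Rightarrow> 'a set.
            (\<forall>i\<le>n. primeideal (p i) R) \<and> (\<forall>i<n. p i \<subset> p (Suc i))}"


section \<open>Modules over a not necessarily commutative ring\<close>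

text \<open>
  The library locale \<open>module\<close> requires a commutative ring of scalars. The library predicate
  \<open>submodule\<close> does not, and it only refers to the scalar action; it is therefore
  used below for left and for right modules. Right modules are records in which
  \<open>a \<odot> x\<close> stands for \<open>x a\<close>. The fields \<open>mult\<close> and \<open>one\<close> of a
  record used as a module carry no meaning.
\<close>

locale left_module = A?: ring A + M?: abelian_group M
  for A :: "('a, 'k) ring_scheme" (structure) and M :: "('a, 'b, 'm) module_scheme" (structure) +
  assumes smult_closed: "\<lbrakk>a \<in> carrier A; x \<in> carrier M\<rbrakk> \<Longrightarrow> a \<odot>\<^bsub>M\<^esub> x \<in> carrier M"
    and smult_l_distr: "\<lbrakk>a \<in> carrier A; b \<in> carrier A; x \<in> carrier M\<rbrakk> \<Longrightarrow>
      (a \<oplus> b) \<odot>\<^bsub>M\<^esub> x = a \<odot>\<^bsub>M\<^esub> x \<oplus>\<^bsub>M\<^esub> b \<odot>\<^bsub>M\<^esub> x"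
    and smult_r_distr: "\<lbrakk>a \<in> carrier A; x \<in> carrier M; y \<in> carrier M\<rbrakk> \<Longrightarrow>
      a \<odot>\<^bsub>M\<^esub> (x \<oplus>\<^bsub>M\<^esub> y) = a \<odot>\<^bsub>M\<^esub> x \<oplus>\<^bsub>M\<^esub> a \<odot>\<^bsub>M\<^esub> y"
    and smult_assoc: "\<lbrakk>a \<in> carrier A; b \<in> carrier A; x \<in> carrier M\<rbrakk> \<Longrightarrow>
      (a \<otimes> b) \<odot>\<^bsub>M\<^esub> x = a \<odot>\<^bsub>M\<^esub> (b \<odot>\<^bsub>M\<^esub> x)"
    and smult_one: "x \<in> carrier M \<Longrightarrow> \<one> \<odot>\<^bsub>M\<^esub> x = x"

definition mod_span :: "('a, 'k) ring_scheme \<Rightarrow> ('a, 'b, 'm) module_scheme \<Rightarrow> 'b set \<Rightarrow> 'b set" where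
  "mod_span A M Z = \<Inter>{N. submodule N A M \<and> Z \<subseteq> N}"

definition fin_gen :: "('a, 'k) ring_scheme \<Rightarrow> ('a, 'b, 'm) module_scheme \<Rightarrow> bool" where
  "fin_gen A M \<longleftrightarrow> (\<exists>Z. finite Z \<and> Z \<subseteq> carrier M \<and> mod_span A M Z = carrier M)"

text \<open>The submodule \<open>S M\<close> generated by all products \<open>s x\<close> with \<open>s \<in> S\<close> and \<open>x \<in> M\<close>.\<close>

definition smult_span :: "('a, 'k) ring_scheme \<Rightarrow> 'a set \<Rightarrow> ('a, 'b, 'm) module_scheme \<Rightarrow> 'b set" where
  "smult_span A S M = mod_span A M {s \<odot>\<^bsub>M\<^esub> x | s x. s \<in> S \<and> x \<in> carrier M}"

definition lin_maps ::
  "('a, 'k) ring_scheme \<Rightarrow> ('a, 'b, 'm) module_scheme \<Rightarrow> ('a, 'c, 'n) module_scheme \<Rightarrow> ('b \<Rightarrow> 'c) set" where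
  "lin_maps A M N =
     {f \<in> hom (add_monoid M) (add_monoid N).
        \<forall>a\<in>carrier A. \<forall>x\<in>carrier M. f (a \<odot>\<^bsub>M\<^esub> x) = a \<odot>\<^bsub>N\<^esub> f x}"

definition lin_isomorphic ::
  "('a, 'k) ring_scheme \<Rightarrow> ('a, 'b, 'm) module_scheme \<Rightarrow> ('a, 'c, 'n) module_scheme \<Rightarrow> bool" where
  "lin_isomorphic A M N \<longleftrightarrow> (\<exists>f\<in>lin_maps A M N. bij_betw f (carrier M) (carrier N))"

text \<open>
  The lifting property is required for all epimorphisms \<open>M \<rightarrow> N\<close> whose modules live on the
  types \<open>'b \<Rightarrow> 'a\<close> and \<open>'b\<close>. This loses nothing: the free module
  with basis \<open>carrier P\<close> lives on \<open>'b \<Rightarrow> 'a\<close>, so the case \<open>N = P\<close> makes \<open>P\<close> a direct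
  summand of a free module.
\<close>

definition projective :: "('a, 'k) ring_scheme \<Rightarrow> ('a, 'b) module \<Rightarrow> bool" where
  "projective A P \<longleftrightarrow>
     left_module A P \<and>
     (\<forall>(M :: ('a, 'b \<Rightarrow> 'a) module) (N :: ('a, 'b) module) g f.
        left_module A M \<and> left_module A N \<and>
        g \<in> lin_maps A M N \<and> g ` carrier M = carrier N \<and> f \<in> lin_maps A P N \<longrightarrow>
        (\<exists>h\<in>lin_maps A P M. \<forall>x\<in>carrier P. g (h x) = f x))"

definition indecomposable :: "('a, 'k) ring_scheme \<Rightarrow> ('a, 'b) module \<Rightarrow> bool" where
  "indecomposable A M \<longleftrightarrow>
     carrier M \<noteq> {\<zero>\<^bsub>M\<^esub>} \<and>
     (\<forall>N1 N2. submodule N1 A M \<and> submodule N2 A M \<and>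
        N1 <+>\<^bsub>M\<^esub> N2 = carrier M \<and> N1 \<inter> N2 = {\<zero>\<^bsub>M\<^esub>} \<longrightarrow>
        N1 = {\<zero>\<^bsub>M\<^esub>} \<or> N2 = {\<zero>\<^bsub>M\<^esub>})"

definition superfluous :: "('a, 'k) ring_scheme \<Rightarrow> ('a, 'b) module \<Rightarrow> 'b set \<Rightarrow> bool" where
  "superfluous A M K \<longleftrightarrow>
     submodule K A M \<and>
     (\<forall>N. submodule N A M \<and> K <+>\<^bsub>M\<^esub> N = carrier M \<longrightarrow> N = carrier M)"

definition simple_submodule :: "'b set \<Rightarrow> ('a, 'k) ring_scheme \<Rightarrow> ('a, 'b) module \<Rightarrow> bool" where
  "simple_submodule S A M \<longleftrightarrow>
     submodule S A M \<and> S \<noteq> {\<zero>\<^bsub>M\<^esub>} \<and>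
     (\<forall>T. submodule T A M \<and> T \<subseteq> S \<longrightarrow> T = {\<zero>\<^bsub>M\<^esub>} \<or> T = S)"

text \<open>The sum of all simple submodules, that is, the largest semisimple submodule.\<close>

definition socle :: "('a, 'k) ring_scheme \<Rightarrow> ('a, 'b) module \<Rightarrow> 'b set" where
  "socle A M = mod_span A M (\<Union>{S. simple_submodule S A M})"


section \<open>Tensor products over a ring\<close>

text \<open>
  The tensor product of a right \<open>A\<close>-module \<open>V\<close> and a left \<open>A\<close>-module \<open>P\<close> is an abelian
  group, written multiplicatively as in the library theory of free abelian groups.
\<close>

definition tensor_rels ::
  "('a, 'k) ring_scheme \<Rightarrow> ('a, 'v) module \<Rightarrow> ('a, 'p) module \<Rightarrow> ('v \<times> 'p \<Rightarrow>\<^sub>0 int) set" where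
  "tensor_rels A V P =
     {frag_of (v \<oplus>\<^bsub>V\<^esub> w, p) - frag_of (v, p) - frag_of (w, p) | v w p.
        v \<in> carrier V \<and> w \<in> carrier V \<and> p \<in> carrier P} \<union>
     {frag_of (v, p \<oplus>\<^bsub>P\<^esub> q) - frag_of (v, p) - frag_of (v, q) | v p q.
        v \<in> carrier V \<and> p \<in> carrier P \<and> q \<in> carrier P} \<union>
     {frag_of (a \<odot>\<^bsub>V\<^esub> v, p) - frag_of (v, a \<odot>\<^bsub>P\<^esub> p) | a v p.
        a \<in> carrier A \<and> v \<in> carrier V \<and> p \<in> carrier P}"

definition tensor_kernel ::
  "('a, 'k) ring_scheme \<Rightarrow> ('a, 'v) module \<Rightarrow> ('a, 'p) module \<Rightarrow> ('v \<times> 'p \<Rightarrow>\<^sub>0 int) set" where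
  "tensor_kernel A V P =
     generate (free_Abelian_group (carrier V \<times> carrier P)) (tensor_rels A V P)"

definition tensor ::
  "('a, 'k) ring_scheme \<Rightarrow> ('a, 'v) module \<Rightarrow> ('a, 'p) module \<Rightarrow> ('v \<times> 'p \<Rightarrow>\<^sub>0 int) set monoid" where
  "tensor A V P =
     free_Abelian_group (carrier V \<times> carrier P) Mod tensor_kernel A V P"

definition pure_tensor ::
  "('a, 'k) ring_scheme \<Rightarrow> ('a, 'v) module \<Rightarrow> ('a, 'p) module \<Rightarrow> 'v \<Rightarrow> 'p \<Rightarrow> ('v \<times> 'p \<Rightarrow>\<^sub>0 int) set" where
  "pure_tensor A V P v p =
     r_coset (free_Abelian_group (carrier V \<times> carrier P)) (tensor_kernel A V P) (frag_of (v, p))"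

text \<open>The image of \<open>W \<otimes> P\<close> in \<open>V \<otimes> P\<close>, for a submodule \<open>W\<close> of \<open>V\<close>.\<close>

definition tensor_image ::
  "('a, 'k) ring_scheme \<Rightarrow> ('a, 'v) module \<Rightarrow> ('a, 'p) module \<Rightarrow> 'v set \<Rightarrow> ('v \<times> 'p \<Rightarrow>\<^sub>0 int) set set" where
  "tensor_image A V P W =
     generate (tensor A V P) {pure_tensor A V P v p | v p. v \<in> W \<and> p \<in> carrier P}"


section \<open>Algebras and idempotents\<close>

locale assoc_algebra = Module.module R A + ring A
  for R :: "('r, 'k) ring_scheme" (structure) and A :: "('r, 'a, 'm) module_scheme" (structure) +
  assumes smult_mult_left: "\<lbrakk>r \<in> carrier R; a \<in> carrier A; b \<in> carrier A\<rbrakk> \<Longrightarrow>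
      (r \<odot>\<^bsub>A\<^esub> a) \<otimes>\<^bsub>A\<^esub> b = r \<odot>\<^bsub>A\<^esub> (a \<otimes>\<^bsub>A\<^esub> b)"
    and smult_mult_right: "\<lbrakk>r \<in> carrier R; a \<in> carrier A; b \<in> carrier A\<rbrakk> \<Longrightarrow>
      a \<otimes>\<^bsub>A\<^esub> (r \<odot>\<^bsub>A\<^esub> b) = r \<odot>\<^bsub>A\<^esub> (a \<otimes>\<^bsub>A\<^esub> b)"

definition torsion_free :: "('r, 'k) ring_scheme \<Rightarrow> ('r, 'b, 'm) module_scheme \<Rightarrow> bool" where
  "torsion_free R M \<longleftrightarrow>
     (\<forall>r\<in>carrier R. \<forall>x\<in>carrier M. r \<odot>\<^bsub>M\<^esub> x = \<zero>\<^bsub>M\<^esub> \<longrightarrow> r = \<zero>\<^bsub>R\<^esub> \<or> x = \<zero>\<^bsub>M\<^esub>)"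

text \<open>An \<open>A\<close>-module as a module over the base ring, via \<open>r \<mapsto> r \<cdot> 1\<close>.\<close>

definition restrict_scalars :: "('r, 'a) module \<Rightarrow> ('a, 'b) module \<Rightarrow> ('r, 'b) module" where
  "restrict_scalars A M =
     \<lparr>carrier = carrier M, monoid.mult = monoid.mult M, monoid.one = monoid.one M, ring.zero = ring.zero M, ring.add = ring.add M,
      smult = (\<lambda>r x. (r \<odot>\<^bsub>A\<^esub> \<one>\<^bsub>A\<^esub>) \<odot>\<^bsub>M\<^esub> x)\<rparr>"

text \<open>The left module \<open>A e\<close>.\<close>

definition left_ideal_module :: "('r, 'a) module \<Rightarrow> 'a \<Rightarrow> ('a, 'a) module" where
  "left_ideal_module A e =
     \<lparr>carrier = {a \<otimes>\<^bsub>A\<^esub> e | a. a \<in> carrier A}, monoid.mult = monoid.mult A, monoid.one = monoid.one A,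
      ring.zero = ring.zero A, ring.add = ring.add A, smult = monoid.mult A\<rparr>"

text \<open>The algebra \<open>e A e\<close>.\<close>

definition corner :: "('r, 'a) module \<Rightarrow> 'a \<Rightarrow> ('r, 'a) module" where
  "corner A e = A\<lparr>carrier := {e \<otimes>\<^bsub>A\<^esub> a \<otimes>\<^bsub>A\<^esub> e | a. a \<in> carrier A}, monoid.one := e\<rparr>"

definition primitive_idempotent :: "('a, 'm) ring_scheme \<Rightarrow> 'a \<Rightarrow> bool" where
  "primitive_idempotent A e \<longleftrightarrow>
     e \<in> carrier A \<and> e \<otimes>\<^bsub>A\<^esub> e = e \<and> e \<noteq> \<zero>\<^bsub>A\<^esub> \<and>
     (\<forall>f\<in>carrier A. \<forall>g\<in>carrier A.
        f \<otimes>\<^bsub>A\<^esub> f = f \<and> g \<otimes>\<^bsub>A\<^esub> g = g \<and> f \<otimes>\<^bsub>A\<^esub> g = \<zero>\<^bsub>A\<^esub> \<and> g \<otimes>\<^bsub>A\<^esub> f = \<zero>\<^bsub>A\<^esub> \<and>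
        e = f \<oplus>\<^bsub>A\<^esub> g \<longrightarrow> f = \<zero>\<^bsub>A\<^esub> \<or> g = \<zero>\<^bsub>A\<^esub>)"

text \<open>
  The idempotents are orthogonal, so that the partial sums \<open>e_I\<close> are idempotents. An indecomposable
  projective module over a semiperfect ring \<open>A\<close> is isomorphic to some \<open>A f\<close>, so it
  suffices to let \<open>Q\<close> range over modules on the type of \<open>A\<close>.
\<close>

definition basic_idempotents :: "('r, 'a) module \<Rightarrow> nat \<Rightarrow> (nat \<Rightarrow> 'a) \<Rightarrow> bool" where
  "basic_idempotents A l e \<longleftrightarrow>
     (\<forall>i\<in>{1..l}. primitive_idempotent A (e i)) \<and>
     (\<forall>i\<in>{1..l}. \<forall>j\<in>{1..l}. i \<noteq> j \<longrightarrow> e i \<otimes>\<^bsub>A\<^esub> e j = \<zero>\<^bsub>A\<^esub>) \<and>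
     (\<forall>i\<in>{1..l}. \<forall>j\<in>{1..l}.
        lin_isomorphic A (left_ideal_module A (e i)) (left_ideal_module A (e j)) \<longrightarrow> i = j) \<and>
     (\<forall>Q :: ('a, 'a) module. projective A Q \<and> indecomposable A Q \<longrightarrow>
        (\<exists>i\<in>{1..l}. lin_isomorphic A Q (left_ideal_module A (e i))))"

definition corner_at :: "('r, 'a) module \<Rightarrow> (nat \<Rightarrow> 'a) \<Rightarrow> nat set \<Rightarrow> ('r, 'a) module" where
  "corner_at A e I = corner A (finsum A e I)"


section \<open>The numbers \<open>s_I\<close>\<close>

definition regular_seq :: "('r, 'k) ring_scheme \<Rightarrow> ('r, 'b, 'm) module_scheme \<Rightarrow> 'r list \<Rightarrow> bool" where
  "regular_seq R M xs \<longleftrightarrow>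
     (\<forall>i<length xs. \<forall>a\<in>carrier M.
        (xs ! i) \<odot>\<^bsub>M\<^esub> a \<in> smult_span R (set (take i xs)) M \<longrightarrow>
        a \<in> smult_span R (set (take i xs)) M) \<and>
     smult_span R (set xs) M \<noteq> carrier M"

definition maximal_regular_seq ::
  "('r, 'k) ring_scheme \<Rightarrow> 'r set \<Rightarrow> ('r, 'b, 'm) module_scheme \<Rightarrow> 'r list \<Rightarrow> bool" where
  "maximal_regular_seq R \<mm> M xs \<longleftrightarrow>
     set xs \<subseteq> \<mm> \<and> regular_seq R M xs \<and> (\<forall>y\<in>\<mm>. \<not> regular_seq R M (xs @ [y]))"

text \<open>The right \<open>A\<close>-module \<open>A / (x_1 A + ... + x_r A)\<close>.\<close>

definition quot_right_module :: "('r, 'k) ring_scheme \<Rightarrow> ('r, 'a) module \<Rightarrow> 'r list \<Rightarrow> ('a, 'a set) module" where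
  "quot_right_module R A xs =
     (let J = smult_span R (set xs) A; B = A Quot J in
      \<lparr>carrier = carrier B, monoid.mult = monoid.mult B, monoid.one = monoid.one B, ring.zero = ring.zero B, ring.add = ring.add B,
       smult = (\<lambda>a Z. Z \<otimes>\<^bsub>B\<^esub> (J +>\<^bsub>A\<^esub> a))\<rparr>)"

definition admissible_index ::
  "('r, 'k) ring_scheme \<Rightarrow> ('r, 'a) module \<Rightarrow> (nat \<Rightarrow> 'a) \<Rightarrow> nat set \<Rightarrow> 'r list \<Rightarrow> nat \<Rightarrow> bool" where
  "admissible_index R A e I xs i \<longleftrightarrow>
     i \<in> I \<and>
     (let B = corner_at A e I; V = quot_right_module R B xs;
          T = tensor B (V\<lparr>carrier := socle B V\<rparr>) (left_ideal_module B (e i))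
      in carrier T \<noteq> {\<one>\<^bsub>T\<^esub>})"

text \<open>
  For admissible \<open>i\<close> the set below is nonempty by Krull's intersection theorem, so the
  infimum in \<open>nat\<close> is its least element.
\<close>

definition s_number ::
  "('r, 'k) ring_scheme \<Rightarrow> 'r set \<Rightarrow> ('r, 'a) module \<Rightarrow> (nat \<Rightarrow> 'a) \<Rightarrow> nat set \<Rightarrow> 'r list \<Rightarrow> nat \<Rightarrow> nat" where
  "s_number R \<mm> A e I xs i =
     (let B = corner_at A e I; V = quot_right_module R B xs; P = left_ideal_module B (e i) in
      Inf {t. t \<ge> 1 \<and>
             \<not> tensor_image B V P (socle B V)
               \<subseteq> tensor_image B V P (smult_span R (ideal_pow R \<mm> t) (restrict_scalars B V))})"


section \<open>Projective resolutions\<close>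

text \<open>
  \<open>\<delta> (Suc j)\<close> is the differential from \<open>P (Suc j)\<close> to \<open>P j\<close>; \<open>\<delta> 0\<close> is unused,
  and \<open>\<epsilon>\<close> is the augmentation from \<open>P 0\<close> to \<open>U\<close>.
\<close>

definition projective_resolution ::
  "('a, 'k) ring_scheme \<Rightarrow> ('a, 'u) module \<Rightarrow> (nat \<Rightarrow> ('a, 'p) module) \<Rightarrow>
   (nat \<Rightarrow> 'p \<Rightarrow> 'p) \<Rightarrow> ('p \<Rightarrow> 'u) \<Rightarrow> bool" where
  "projective_resolution A U P \<delta> \<epsilon> \<longleftrightarrow>
     (\<forall>j. projective A (P j)) \<and>
     (\<forall>j. \<delta> (Suc j) \<in> lin_maps A (P (Suc j)) (P j)) \<and>
     \<epsilon> \<in> lin_maps A (P 0) U \<and> \<epsilon> ` carrier (P 0) = carrier U \<and>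
     \<delta> 1 ` carrier (P 1) = a_kernel (P 0) U \<epsilon> \<and>
     (\<forall>j. \<delta> (Suc (Suc j)) ` carrier (P (Suc (Suc j))) = a_kernel (P (Suc j)) (P j) (\<delta> (Suc j)))"

text \<open>Minimality: every \<open>P j\<close> is a projective cover of its image under the next map.\<close>

definition minimal_projective_resolution ::
  "('a, 'k) ring_scheme \<Rightarrow> ('a, 'u) module \<Rightarrow> (nat \<Rightarrow> ('a, 'p) module) \<Rightarrow>
   (nat \<Rightarrow> 'p \<Rightarrow> 'p) \<Rightarrow> ('p \<Rightarrow> 'u) \<Rightarrow> bool" where
  "minimal_projective_resolution A U P \<delta> \<epsilon> \<longleftrightarrow>
     projective_resolution A U P \<delta> \<epsilon> \<and>
     superfluous A (P 0) (a_kernel (P 0) U \<epsilon>) \<and>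
     (\<forall>j. superfluous A (P (Suc j)) (a_kernel (P (Suc j)) (P j) (\<delta> (Suc j))))"

text \<open>
  The projective dimension, computed from resolutions by modules on the type \<open>'p\<close>; an
  upper bound obtained for one type \<open>'p\<close> is an upper bound for the projective dimension.
  The zero module has projective dimension \<open>-\<infinity>\<close>.
\<close>

definition proj_dim :: "'p itself \<Rightarrow> ('a, 'k) ring_scheme \<Rightarrow> ('a, 'u) module \<Rightarrow> ereal" where
  "proj_dim (_ :: 'p itself) A U =
     (if carrier U = {\<zero>\<^bsub>U\<^esub>} then -\<infinity>
      else Inf {ereal (real n) | n.
        \<exists>(P :: nat \<Rightarrow> ('a, 'p) module) \<delta> \<epsilon>.
          projective_resolution A U P \<delta> \<epsilon> \<and> (\<forall>j>n. carrier (P j) = {\<zero>\<^bsub>P j\<^esub>})})"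

end

theory Submission
  imports Defs
begin

text \<open>
  For a nonempty set \<open>I\<close> of indices put \<open>g = e\<^sub>I\<close>, \<open>B = g \<Lambda> g\<close> and \<open>V = B / (x) B\<close>, and suppose that
  \<open>P\<^sub>j = \<Lambda> g P\<^sub>j\<close> for all \<open>j\<close> from some degree \<open>a\<close> on. The sequence \<open>x\<close> is then regular on each
  \<open>g P\<^sub>j\<close>, so \<open>V \<otimes> g P = g P / (x) g P\<close> is exact beyond degree \<open>a + d\<close>, because the length of \<open>x\<close> is at
  most \<open>d\<close>. By minimality the differentials kill \<open>Soc(V) \<otimes> g P\<^sub>j\<close>, which therefore consists of
  boundaries and lies in \<open>V \<mm>\<^sup>s \<otimes> g P\<^sub>j\<close>. For \<open>i = \<iota> I\<close> the definition of \<open>s\<^sub>I\<close> shows that no linear form on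
  \<open>P\<^sub>j\<close> takes a value whose component in the local ring \<open>e\<^sub>i \<Lambda> e\<^sub>i\<close> is a unit, and Nakayama's lemma gives
  \<open>P\<^sub>j = \<Lambda> e\<^sub>J P\<^sub>j\<close> for \<open>J = I - {i}\<close>. Each such step costs \<open>d + 1\<close> degrees; after \<open>l\<close> steps \<open>J\<close> is empty.
\<close>


section \<open>Modules over a not necessarily commutative ring\<close>

text \<open>The complex V \<otimes> g P is never formed. A tensor w \<otimes> u p is represented by
  the element \<beta> u p of g P, where \<beta> is a lift of w to B, and it is tested with linear
  forms on P_j. By the dual basis property every p is a finite sum of terms f(p) z with z in g P_j,
  so regularity, the effect of minimality and the Nakayama step all become statements about the ring
  elements g f(p) g. Actual tensor products occur only where the definitions of admissibility and of
  s_I are unwound, through V \<otimes> B e = V e. Two facts about \<Lambda> have to be supplied.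
  That each e_i \<Lambda> e_i is local comes from completeness, by lifting idempotents modulo \<mm>.
  That P = \<Lambda> g P holds for the sum g of all e_i comes from a maximality argument on
  idempotents, since g need not be 1. The cost d + 1 of a step consists of one degree for each
  member of x and one more because minimality is exploited in P_(j-1) while the conclusion concerns
  P_j. Which sets I are met depends on the choices \<iota>, so the bound s has to serve all of
  them.\<close>

lemma submodule_subset: "submodule N A M \<Longrightarrow> N \<subseteq> carrier M"
  using subgroup.subset submodule.axioms(1) by fastforce

lemma submodule_in_carrier: "\<lbrakk>submodule N A M; x \<in> N\<rbrakk> \<Longrightarrow> x \<in> carrier M"
  using submodule_subset by blast

lemma submodule_zero: "submodule N A M \<Longrightarrow> \<zero>\<^bsub>M\<^esub> \<in> N"
  using subgroup.one_closed submodule.axioms(1) by fastforce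

lemma submodule_add: "\<lbrakk>submodule N A M; x \<in> N; y \<in> N\<rbrakk> \<Longrightarrow> x \<oplus>\<^bsub>M\<^esub> y \<in> N"
  using subgroup.m_closed submodule.axioms(1) by fastforce

lemma submodule_uminus: "\<lbrakk>submodule N A M; x \<in> N\<rbrakk> \<Longrightarrow> \<ominus>\<^bsub>M\<^esub> x \<in> N"
  using subgroup.m_inv_closed submodule.axioms(1) unfolding a_inv_def by fastforce

lemma submodule_minus: "\<lbrakk>submodule N A M; x \<in> N; y \<in> N\<rbrakk> \<Longrightarrow> x \<ominus>\<^bsub>M\<^esub> y \<in> N"
  unfolding a_minus_def by (intro submodule_add submodule_uminus)

lemma submodule_smult: "\<lbrakk>submodule N A M; a \<in> carrier A; x \<in> N\<rbrakk> \<Longrightarrow> a \<odot>\<^bsub>M\<^esub> x \<in> N"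
  by (rule submodule.smult_closed)

lemma mod_span_minimal: "\<lbrakk>submodule N A M; Z \<subseteq> N\<rbrakk> \<Longrightarrow> mod_span A M Z \<subseteq> N"
  unfolding mod_span_def by (rule Inter_lower) simp

lemma mod_span_superset: "Z \<subseteq> mod_span A M Z"
  unfolding mod_span_def by (rule Inter_greatest) simp

lemma mod_span_mono: "Z \<subseteq> Z' \<Longrightarrow> mod_span A M Z \<subseteq> mod_span A M Z'"
  unfolding mod_span_def by (rule Inter_anti_mono) auto

lemma smult_span_memI: "\<lbrakk>s \<in> S; x \<in> carrier M\<rbrakk> \<Longrightarrow> s \<odot>\<^bsub>M\<^esub> x \<in> smult_span A S M"
  unfolding smult_span_def by (rule subsetD[OF mod_span_superset]) auto

lemma smult_span_minimal:
  "\<lbrakk>submodule N A M; \<And>s x. \<lbrakk>s \<in> S; x \<in> carrier M\<rbrakk> \<Longrightarrow> s \<odot>\<^bsub>M\<^esub> x \<in> N\<rbrakk> \<Longrightarrow> smult_span A S M \<subseteq> N"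
  unfolding smult_span_def by (rule mod_span_minimal) auto

lemma smult_span_mono: "S \<subseteq> S' \<Longrightarrow> smult_span A S M \<subseteq> smult_span A S' M"
  unfolding smult_span_def by (rule mod_span_mono) blast

text \<open>Only the abelian group is assumed, so that the criterion serves left modules and the
  records encoding right modules alike.\<close>

lemma submodule_groupI:
  assumes "abelian_group M"
    and "N \<subseteq> carrier M" "\<zero>\<^bsub>M\<^esub> \<in> N" "\<And>x y. \<lbrakk>x \<in> N; y \<in> N\<rbrakk> \<Longrightarrow> x \<oplus>\<^bsub>M\<^esub> y \<in> N"
    and "\<And>x. x \<in> N \<Longrightarrow> \<ominus>\<^bsub>M\<^esub> x \<in> N"
    and "\<And>a x. \<lbrakk>a \<in> carrier A; x \<in> N\<rbrakk> \<Longrightarrow> a \<odot>\<^bsub>M\<^esub> x \<in> N"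
  shows "submodule N A M"
proof -
  interpret abelian_group M by fact
  have "subgroup N (add_monoid M)"
    using assms(2-5) by (intro subgroup.intro) (auto simp: a_inv_def)
  then show ?thesis
    by (intro submodule.intro submodule_axioms.intro assms(6)) auto
qed

lemma submodule_Inter:
  assumes "abelian_group M" and F: "\<And>N. N \<in> F \<Longrightarrow> submodule N A M" "F \<noteq> {}"
  shows "submodule (\<Inter>F) A M"
proof (rule submodule_groupI[OF assms(1)])
  show "\<Inter>F \<subseteq> carrier M" using F by (blast dest: submodule_subset)
qed (use F in \<open>auto intro: submodule_zero submodule_add submodule_uminus submodule_smult\<close>)

lemma (in abelian_group) add_add_minus_cancel:
  "\<lbrakk>x \<in> carrier G; y \<in> carrier G\<rbrakk> \<Longrightarrow> x \<oplus> (y \<oplus> \<ominus> x) = y"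
  by (simp add: a_lcomm[of x y] r_neg)

lemma (in abelian_group) eq_if_minus_eq_zero:
  assumes "x \<in> carrier G" "y \<in> carrier G" "x \<ominus> y = \<zero>"
  shows "x = y"
proof -
  have "(x \<ominus> y) \<oplus> y = x" using assms(1,2) by (simp add: minus_eq a_assoc l_neg)
  then show ?thesis using assms by simp
qed

context left_module
begin

declare smult_closed [simp, intro]
declare smult_one [simp]

lemma smult_l_null [simp]: "x \<in> carrier M \<Longrightarrow> \<zero> \<odot>\<^bsub>M\<^esub> x = \<zero>\<^bsub>M\<^esub>"
  by (metis A.add.r_cancel_one' A.zero_closed M.add.r_cancel_one' smult_closed smult_l_distr)

lemma smult_r_null [simp]: "a \<in> carrier A \<Longrightarrow> a \<odot>\<^bsub>M\<^esub> \<zero>\<^bsub>M\<^esub> = \<zero>\<^bsub>M\<^esub>"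
  by (metis M.add.r_cancel_one' M.zero_closed smult_closed smult_r_distr)

lemma smult_l_minus: "\<lbrakk>a \<in> carrier A; x \<in> carrier M\<rbrakk> \<Longrightarrow> (\<ominus> a) \<odot>\<^bsub>M\<^esub> x = \<ominus>\<^bsub>M\<^esub> (a \<odot>\<^bsub>M\<^esub> x)"
  by (metis A.add.inv_closed A.l_neg M.minus_equality smult_closed smult_l_distr smult_l_null)

lemma smult_r_minus: "\<lbrakk>a \<in> carrier A; x \<in> carrier M\<rbrakk> \<Longrightarrow> a \<odot>\<^bsub>M\<^esub> (\<ominus>\<^bsub>M\<^esub> x) = \<ominus>\<^bsub>M\<^esub> (a \<odot>\<^bsub>M\<^esub> x)"
  by (metis M.add.inv_closed M.l_neg M.minus_equality smult_closed smult_r_distr smult_r_null)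

lemma smult_l_diff:
  "\<lbrakk>a \<in> carrier A; b \<in> carrier A; x \<in> carrier M\<rbrakk> \<Longrightarrow> (a \<ominus> b) \<odot>\<^bsub>M\<^esub> x = a \<odot>\<^bsub>M\<^esub> x \<ominus>\<^bsub>M\<^esub> b \<odot>\<^bsub>M\<^esub> x"
  by (simp add: A.minus_eq M.minus_eq smult_l_distr smult_l_minus)

lemma smult_r_diff:
  "\<lbrakk>a \<in> carrier A; x \<in> carrier M; y \<in> carrier M\<rbrakk> \<Longrightarrow> a \<odot>\<^bsub>M\<^esub> (x \<ominus>\<^bsub>M\<^esub> y) = a \<odot>\<^bsub>M\<^esub> x \<ominus>\<^bsub>M\<^esub> a \<odot>\<^bsub>M\<^esub> y"
  by (simp add: M.minus_eq smult_r_distr smult_r_minus)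

lemma submoduleI:
  assumes "N \<subseteq> carrier M" "\<zero>\<^bsub>M\<^esub> \<in> N" "\<And>x y. \<lbrakk>x \<in> N; y \<in> N\<rbrakk> \<Longrightarrow> x \<oplus>\<^bsub>M\<^esub> y \<in> N"
    "\<And>a x. \<lbrakk>a \<in> carrier A; x \<in> N\<rbrakk> \<Longrightarrow> a \<odot>\<^bsub>M\<^esub> x \<in> N"
  shows "submodule N A M"
proof (rule submodule_groupI[OF M.abelian_group_axioms])
  fix x assume "x \<in> N"
  then have "(\<ominus> \<one>) \<odot>\<^bsub>M\<^esub> x \<in> N" "x \<in> carrier M" using assms by auto
  then show "\<ominus>\<^bsub>M\<^esub> x \<in> N" by (simp add: smult_l_minus)
qed (use assms in auto)

lemma submodule_carrier: "submodule (carrier M) A M"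
  by (rule submoduleI) auto

lemma submodule_trivial: "submodule {\<zero>\<^bsub>M\<^esub>} A M"
  by (rule submoduleI) auto

lemma submodule_Int: "\<lbrakk>submodule N A M; submodule N' A M\<rbrakk> \<Longrightarrow> submodule (N \<inter> N') A M"
  by (rule submoduleI)
    (auto intro: submodule_zero submodule_add submodule_smult dest: submodule_in_carrier)

lemma mod_span_submodule:
  assumes "Z \<subseteq> carrier M"
  shows "submodule (mod_span A M Z) A M"
  unfolding mod_span_def
  by (rule submodule_Inter[OF M.abelian_group_axioms]) (use assms submodule_carrier in auto)

lemma smult_span_submodule:
  assumes "S \<subseteq> carrier A"
  shows "submodule (smult_span A S M) A M"
  unfolding smult_span_def by (rule mod_span_submodule) (use assms in auto)

lemma submodule_set_add:
  assumes N: "submodule N A M" and N': "submodule N' A M"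
  shows "submodule (N <+>\<^bsub>M\<^esub> N') A M"
proof (rule submoduleI)
  have c: "\<And>x. x \<in> N \<Longrightarrow> x \<in> carrier M" "\<And>x. x \<in> N' \<Longrightarrow> x \<in> carrier M"
    using N N' by (auto intro: submodule_in_carrier)
  show "N <+>\<^bsub>M\<^esub> N' \<subseteq> carrier M"
    using c by (auto simp: set_add_def')
  show "\<zero>\<^bsub>M\<^esub> \<in> N <+>\<^bsub>M\<^esub> N'"
    unfolding set_add_def' using N N' by (auto intro!: bexI[of _ "\<zero>\<^bsub>M\<^esub>"] submodule_zero)
  fix x y assume "x \<in> N <+>\<^bsub>M\<^esub> N'" "y \<in> N <+>\<^bsub>M\<^esub> N'"
  then obtain a b a' b' where *: "a \<in> N" "b \<in> N'" "x = a \<oplus>\<^bsub>M\<^esub> b" "a' \<in> N" "b' \<in> N'" "y = a' \<oplus>\<^bsub>M\<^esub> b'"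
    by (auto simp: set_add_def')
  then have "x \<oplus>\<^bsub>M\<^esub> y = (a \<oplus>\<^bsub>M\<^esub> a') \<oplus>\<^bsub>M\<^esub> (b \<oplus>\<^bsub>M\<^esub> b')"
    using c by (simp add: M.a_ac)
  then show "x \<oplus>\<^bsub>M\<^esub> y \<in> N <+>\<^bsub>M\<^esub> N'"
    using * N N' unfolding set_add_def' by (blast intro: submodule_add)
next
  fix a x assume a: "a \<in> carrier A" and "x \<in> N <+>\<^bsub>M\<^esub> N'"
  then obtain u v where "u \<in> N" "v \<in> N'" "x = u \<oplus>\<^bsub>M\<^esub> v"
    by (auto simp: set_add_def')
  with a show "a \<odot>\<^bsub>M\<^esub> x \<in> N <+>\<^bsub>M\<^esub> N'"
    using N N' unfolding set_add_def'
    by (auto simp: smult_r_distr submodule_in_carrier intro: submodule_smult)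
qed

lemma set_add_memI:
  "\<lbrakk>x \<in> N; y \<in> N'\<rbrakk> \<Longrightarrow> x \<oplus>\<^bsub>M\<^esub> y \<in> N <+>\<^bsub>M\<^esub> N'"
  by (auto simp: set_add_def')

lemma set_add_memE:
  assumes "z \<in> N <+>\<^bsub>M\<^esub> N'"
  obtains x y where "x \<in> N" "y \<in> N'" "z = x \<oplus>\<^bsub>M\<^esub> y"
  using assms by (auto simp: set_add_def')

lemma subset_set_add:
  assumes "submodule N A M" "submodule N' A M"
  shows "N \<subseteq> N <+>\<^bsub>M\<^esub> N'" "N' \<subseteq> N <+>\<^bsub>M\<^esub> N'"
proof -
  show "N \<subseteq> N <+>\<^bsub>M\<^esub> N'"
  proof
    fix x assume x: "x \<in> N"
    have "x \<oplus>\<^bsub>M\<^esub> \<zero>\<^bsub>M\<^esub> \<in> N <+>\<^bsub>M\<^esub> N'"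
      by (rule set_add_memI[OF x submodule_zero[OF assms(2)]])
    then show "x \<in> N <+>\<^bsub>M\<^esub> N'"
      using submodule_in_carrier[OF assms(1) x] by simp
  qed
  show "N' \<subseteq> N <+>\<^bsub>M\<^esub> N'"
  proof
    fix x assume x: "x \<in> N'"
    have "\<zero>\<^bsub>M\<^esub> \<oplus>\<^bsub>M\<^esub> x \<in> N <+>\<^bsub>M\<^esub> N'"
      by (rule set_add_memI[OF submodule_zero[OF assms(1)] x])
    then show "x \<in> N <+>\<^bsub>M\<^esub> N'"
      using submodule_in_carrier[OF assms(2) x] by simp
  qed
qed

lemma cyclic_submodule:
  assumes "x \<in> carrier M"
  shows "submodule {a \<odot>\<^bsub>M\<^esub> x | a. a \<in> carrier A} A M"
proof (rule submoduleI)
  show "\<zero>\<^bsub>M\<^esub> \<in> {a \<odot>\<^bsub>M\<^esub> x | a. a \<in> carrier A}"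
    using assms by (auto intro!: exI[of _ \<zero>])
qed (use assms in \<open>auto simp flip: smult_l_distr smult_assoc\<close>)

lemma mod_span_insert:
  assumes "z \<in> carrier M" "Z \<subseteq> carrier M" "x \<in> mod_span A M (insert z Z)"
  obtains a y where "a \<in> carrier A" "y \<in> mod_span A M Z" "x = a \<odot>\<^bsub>M\<^esub> z \<oplus>\<^bsub>M\<^esub> y"
proof -
  let ?N = "{a \<odot>\<^bsub>M\<^esub> z | a. a \<in> carrier A}"
  note 1 = cyclic_submodule[OF assms(1)] mod_span_submodule[OF assms(2)]
  have "z \<in> ?N" using assms(1) by (auto intro!: exI[of _ \<one>])
  then have "insert z Z \<subseteq> ?N <+>\<^bsub>M\<^esub> mod_span A M Z"
    using subset_set_add[OF 1] mod_span_superset[of Z A M] by blast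
  then have "x \<in> ?N <+>\<^bsub>M\<^esub> mod_span A M Z"
    using mod_span_minimal[OF submodule_set_add[OF 1]] assms(3) by blast
  then show ?thesis using that by (auto elim!: set_add_memE)
qed

lemma mod_span_empty: "mod_span A M {} = {\<zero>\<^bsub>M\<^esub>}"
proof
  show "mod_span A M {} \<subseteq> {\<zero>\<^bsub>M\<^esub>}"
    by (rule mod_span_minimal[OF submodule_trivial]) simp
  show "{\<zero>\<^bsub>M\<^esub>} \<subseteq> mod_span A M {}"
    using submodule_zero[OF mod_span_submodule[of "{}"]] by simp
qed

end

section \<open>Linear maps\<close>

lemma lin_mapsD:
  assumes "f \<in> lin_maps A M N"
  shows lin_maps_closed: "x \<in> carrier M \<Longrightarrow> f x \<in> carrier N"
    and lin_maps_add: "\<lbrakk>x \<in> carrier M; y \<in> carrier M\<rbrakk> \<Longrightarrow> f (x \<oplus>\<^bsub>M\<^esub> y) = f x \<oplus>\<^bsub>N\<^esub> f y"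
    and lin_maps_smult: "\<lbrakk>a \<in> carrier A; x \<in> carrier M\<rbrakk> \<Longrightarrow> f (a \<odot>\<^bsub>M\<^esub> x) = a \<odot>\<^bsub>N\<^esub> f x"
  using assms by (auto simp: lin_maps_def hom_def)

lemma lin_mapsI:
  assumes "\<And>x. x \<in> carrier M \<Longrightarrow> f x \<in> carrier N"
    "\<And>x y. \<lbrakk>x \<in> carrier M; y \<in> carrier M\<rbrakk> \<Longrightarrow> f (x \<oplus>\<^bsub>M\<^esub> y) = f x \<oplus>\<^bsub>N\<^esub> f y"
    "\<And>a x. \<lbrakk>a \<in> carrier A; x \<in> carrier M\<rbrakk> \<Longrightarrow> f (a \<odot>\<^bsub>M\<^esub> x) = a \<odot>\<^bsub>N\<^esub> f x"
  shows "f \<in> lin_maps A M N"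
  using assms by (auto simp: lin_maps_def hom_def)

lemma lin_maps_zero:
  assumes "left_module A M" "left_module A N" "f \<in> lin_maps A M N"
  shows "f \<zero>\<^bsub>M\<^esub> = \<zero>\<^bsub>N\<^esub>"
proof -
  interpret M: left_module A M by fact
  interpret N: left_module A N by fact
  have "f (\<zero>\<^bsub>A\<^esub> \<odot>\<^bsub>M\<^esub> \<zero>\<^bsub>M\<^esub>) = \<zero>\<^bsub>A\<^esub> \<odot>\<^bsub>N\<^esub> f \<zero>\<^bsub>M\<^esub>"
    by (rule lin_maps_smult[OF assms(3)]) auto
  then show ?thesis using lin_maps_closed[OF assms(3)] by simp
qed

lemma lin_maps_uminus:
  assumes "left_module A M" "left_module A N" "f \<in> lin_maps A M N" "x \<in> carrier M"
  shows "f (\<ominus>\<^bsub>M\<^esub> x) = \<ominus>\<^bsub>N\<^esub> f x"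
proof -
  interpret M: left_module A M by fact
  interpret N: left_module A N by fact
  have "f ((\<ominus>\<^bsub>A\<^esub> \<one>\<^bsub>A\<^esub>) \<odot>\<^bsub>M\<^esub> x) = (\<ominus>\<^bsub>A\<^esub> \<one>\<^bsub>A\<^esub>) \<odot>\<^bsub>N\<^esub> f x"
    by (rule lin_maps_smult[OF assms(3)]) (use assms(4) in auto)
  then show ?thesis using lin_maps_closed[OF assms(3)] assms(4)
    by (simp add: M.smult_l_minus N.smult_l_minus)
qed

lemma lin_maps_minus:
  assumes "left_module A M" "left_module A N" "f \<in> lin_maps A M N" "x \<in> carrier M" "y \<in> carrier M"
  shows "f (x \<ominus>\<^bsub>M\<^esub> y) = f x \<ominus>\<^bsub>N\<^esub> f y"
proof -
  interpret M: left_module A M by fact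
  show ?thesis
    unfolding a_minus_def using assms
    by (simp add: lin_maps_add[OF assms(3)] lin_maps_uminus[OF assms(1-3)])
qed

lemma lin_maps_vimage_submodule:
  assumes "left_module A M" "left_module A N" "f \<in> lin_maps A M N" "submodule L A N"
  shows "submodule {x \<in> carrier M. f x \<in> L} A M"
proof -
  interpret M: left_module A M by fact
  show ?thesis
    by (rule M.submoduleI)
      (use assms(4) in \<open>auto simp: lin_maps_zero[OF assms(1-3)] lin_maps_add[OF assms(3)]
        lin_maps_smult[OF assms(3)] intro: submodule_zero submodule_add submodule_smult\<close>)
qed

lemma lin_maps_image_submodule:
  assumes "left_module A M" "left_module A N" "f \<in> lin_maps A M N"
  shows "submodule (f ` carrier M) A N"
proof -
  interpret M: left_module A M by fact
  interpret N: left_module A N by fact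
  show ?thesis
  proof (rule N.submoduleI)
    show "f ` carrier M \<subseteq> carrier N" using lin_maps_closed[OF assms(3)] by auto
    show "\<zero>\<^bsub>N\<^esub> \<in> f ` carrier M"
      using lin_maps_zero[OF assms] M.zero_closed by (metis imageI)
  qed (auto simp flip: lin_maps_add[OF assms(3)] lin_maps_smult[OF assms(3)])
qed

text \<open>Both reductions of the proof, modulo a regular sequence and modulo a power of \<mm>, are
  carried along linear maps by this fact.\<close>

lemma lin_maps_smult_span:
  assumes "left_module A M" "left_module A N" "f \<in> lin_maps A M N" "S \<subseteq> carrier A"
    and x: "x \<in> smult_span A S M"
  shows "f x \<in> smult_span A S N"
proof -
  interpret N: left_module A N by fact
  have "smult_span A S M \<subseteq> {x \<in> carrier M. f x \<in> smult_span A S N}"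
  proof (rule smult_span_minimal)
    show "submodule {x \<in> carrier M. f x \<in> smult_span A S N} A M"
      by (rule lin_maps_vimage_submodule[OF assms(1-3) N.smult_span_submodule[OF assms(4)]])
  qed (use assms(4) in \<open>auto simp: lin_maps_smult[OF assms(3)] left_module.smult_closed[OF assms(1)]
      intro!: smult_span_memI lin_maps_closed[OF assms(3)]\<close>)
  with x show ?thesis by blast
qed

lemma a_kernel_memI: "\<lbrakk>x \<in> carrier M; f x = \<zero>\<^bsub>N\<^esub>\<rbrakk> \<Longrightarrow> x \<in> a_kernel M N f"
  unfolding a_kernel_def kernel_def by simp

lemma a_kernel_memD: "x \<in> a_kernel M N f \<Longrightarrow> x \<in> carrier M \<and> f x = \<zero>\<^bsub>N\<^esub>"
  unfolding a_kernel_def kernel_def by simp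

section \<open>Noetherian modules and Nakayama's lemma\<close>

definition noetherian_module :: "('a, 'k) ring_scheme \<Rightarrow> ('a, 'b, 'm) module_scheme \<Rightarrow> bool" where
  "noetherian_module A M \<longleftrightarrow>
     left_module A M \<and>
     (\<forall>N. submodule N A M \<longrightarrow> (\<exists>Z. finite Z \<and> Z \<subseteq> N \<and> mod_span A M Z = N))"

text \<open>Its submodules are the left ideals, and linear maps into it are the linear forms of the
  dual basis argument.\<close>

definition reg_module :: "('a, 'k) ring_scheme \<Rightarrow> ('a, 'a) module" where
  "reg_module A = \<lparr>carrier = carrier A, monoid.mult = monoid.mult A, monoid.one = monoid.one A,
     ring.zero = ring.zero A, ring.add = ring.add A, smult = monoid.mult A\<rparr>"

lemma reg_module_simps [simp]:
  "carrier (reg_module A) = carrier A" "ring.zero (reg_module A) = ring.zero A"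
  "ring.add (reg_module A) = ring.add A" "smult (reg_module A) = monoid.mult A"
  by (simp_all add: reg_module_def)

text \<open>Negation is a definite description over the carrier, so for records built from the
  operations of another one its agreement has to be stated separately.\<close>

lemma a_inv_cong:
  "\<lbrakk>carrier M = carrier N; ring.add M = ring.add N; ring.zero M = ring.zero N\<rbrakk> \<Longrightarrow> a_inv M = a_inv N"
  by (rule ext) (simp add: a_inv_def m_inv_def)

lemma a_minus_cong:
  "\<lbrakk>carrier M = carrier N; ring.add M = ring.add N; ring.zero M = ring.zero N\<rbrakk> \<Longrightarrow> a_minus M = a_minus N"
  by (intro ext) (simp add: a_minus_def a_inv_cong[of M N])

lemma abelian_group_cong:
  assumes "abelian_group M" "carrier N = carrier M" "ring.add N = ring.add M" "ring.zero N = ring.zero M"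
  shows "abelian_group N"
proof -
  interpret abelian_group M by fact
  have "\<exists>y\<in>carrier M. y \<oplus>\<^bsub>M\<^esub> x = \<zero>\<^bsub>M\<^esub>" if "x \<in> carrier M" for x
    using that l_neg by blast
  then show ?thesis
    by (intro abelian_groupI) (simp_all add: assms a_assoc, simp add: a_comm)
qed

lemma (in ring) reg_left_module: "left_module R (reg_module R)"
  by (intro left_module.intro left_module_axioms.intro ring_axioms
      abelian_group_cong[OF abelian_group_axioms])
    (simp_all add: l_distr r_distr m_assoc)

text \<open>The union of a chain is a submodule, so it has finitely many generators, and these
  already lie in one member of the chain. Most finiteness arguments below take this form: a maximal
  counterexample is chosen and enlarged.\<close>

lemma noetherian_module_maximal:
  assumes M: "noetherian_module A M" and F: "F \<noteq> {}" "\<And>N. N \<in> F \<Longrightarrow> submodule N A M"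
  obtains K where "K \<in> F" "\<And>N. \<lbrakk>N \<in> F; K \<subseteq> N\<rbrakk> \<Longrightarrow> N = K"
proof -
  interpret left_module A M using M unfolding noetherian_module_def by blast
  have "\<exists>K\<in>F. \<forall>N\<in>F. K \<subseteq> N \<longrightarrow> N = K"
  proof (rule subset_Zorn_nonempty[OF F(1)])
    fix C assume C: "C \<noteq> {}" "subset.chain F C"
    then have sub: "submodule N A M" if "N \<in> C" for N
      using that F(2) by (auto simp: subset_chain_def)
    have comparable: "N \<subseteq> N' \<or> N' \<subseteq> N" if "N \<in> C" "N' \<in> C" for N N'
      using C(2) that by (auto simp: subset_chain_def)
    have "submodule (\<Union>C) A M"
    proof (rule submoduleI)
      show "\<Union>C \<subseteq> carrier M" using submodule_subset[OF sub] by (rule Union_least)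
      show "\<zero>\<^bsub>M\<^esub> \<in> \<Union>C" using C(1) submodule_zero[OF sub] by auto
      fix x y assume "x \<in> \<Union>C" "y \<in> \<Union>C"
      then obtain N N' where N: "N \<in> C" "N' \<in> C" "x \<in> N" "y \<in> N'" by blast
      then show "x \<oplus>\<^bsub>M\<^esub> y \<in> \<Union>C"
        using comparable[OF N(1,2)] submodule_add[OF sub[OF N(1)], of x y]
          submodule_add[OF sub[OF N(2)], of x y] by auto
    qed (use submodule_smult[OF sub] in auto)
    then obtain Z where Z: "finite Z" "Z \<subseteq> \<Union>C" "mod_span A M Z = \<Union>C"
      using M unfolding noetherian_module_def by blast
    obtain N where N: "N \<in> C" "Z \<subseteq> N"
      using finite_subset_Union_chain[OF Z(1,2) C(1,2)] by blast
    have "\<Union>C = N"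
      using mod_span_minimal[OF sub[OF N(1)] N(2)] Z(3) N(1) by blast
    then show "\<Union>C \<in> F"
      using N(1) C(2) by (auto simp: subset_chain_def)
  qed
  then show ?thesis using that by blast
qed

lemma noetherian_module_chain:
  assumes M: "noetherian_module A M" and L: "\<And>n. submodule (L n) A M" "\<And>n. L n \<subseteq> L (Suc n)"
  obtains n where "L (Suc n) = L n"
proof -
  obtain K where "K \<in> range L" "\<And>N. \<lbrakk>N \<in> range L; K \<subseteq> N\<rbrakk> \<Longrightarrow> N = K"
    by (rule noetherian_module_maximal[OF M, of "range L"]) (use L(1) in auto)
  then show ?thesis using that L(2) by (metis rangeE rangeI)
qed

text \<open>This is the left ideal of leading coefficients: those \<open>a\<close> that occur at
  \<open>z\<close> in an element of \<open>N\<close>, up to a remainder in \<open>L\<close>.\<close>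

lemma (in left_module) colon_submodule:
  assumes N: "submodule N A M" and L: "submodule L A M" and z: "z \<in> carrier M"
  shows "submodule {a \<in> carrier A. \<exists>y\<in>L. a \<odot>\<^bsub>M\<^esub> z \<oplus>\<^bsub>M\<^esub> y \<in> N} A (reg_module A)"
proof (rule left_module.submoduleI[OF A.reg_left_module], goal_cases)
  case 2
  then show ?case
    using z by (auto intro!: bexI[OF _ submodule_zero[OF L]] submodule_zero[OF N])
next
  case (3 a b)
  then obtain y y' where y: "a \<in> carrier A" "b \<in> carrier A" "y \<in> L" "a \<odot>\<^bsub>M\<^esub> z \<oplus>\<^bsub>M\<^esub> y \<in> N"
      "y' \<in> L" "b \<odot>\<^bsub>M\<^esub> z \<oplus>\<^bsub>M\<^esub> y' \<in> N"
    by auto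
  have "(a \<odot>\<^bsub>M\<^esub> z \<oplus>\<^bsub>M\<^esub> y) \<oplus>\<^bsub>M\<^esub> (b \<odot>\<^bsub>M\<^esub> z \<oplus>\<^bsub>M\<^esub> y') = (a \<oplus> b) \<odot>\<^bsub>M\<^esub> z \<oplus>\<^bsub>M\<^esub> (y \<oplus>\<^bsub>M\<^esub> y')"
    using y z submodule_in_carrier[OF L] by (simp add: smult_l_distr M.a_ac)
  then show ?case
    using y submodule_add[OF N y(4,6)] submodule_add[OF L y(3,5)] by auto
next
  case (4 b a)
  then obtain y where y: "b \<in> carrier A" "a \<in> carrier A" "y \<in> L" "a \<odot>\<^bsub>M\<^esub> z \<oplus>\<^bsub>M\<^esub> y \<in> N"
    by auto
  have "b \<odot>\<^bsub>M\<^esub> (a \<odot>\<^bsub>M\<^esub> z \<oplus>\<^bsub>M\<^esub> y) = (b \<otimes> a) \<odot>\<^bsub>M\<^esub> z \<oplus>\<^bsub>M\<^esub> b \<odot>\<^bsub>M\<^esub> y"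
    using y z submodule_in_carrier[OF L] by (simp add: smult_r_distr smult_assoc)
  then show ?case
    using y submodule_smult[OF N y(1,4)] submodule_smult[OF L y(1,3)] by auto
qed auto

text \<open>Induction on the generators. A submodule is recovered from the part that does not
  involve the new generator \<open>z\<close>, which is finitely generated by induction, together
  with its left ideal of coefficients at \<open>z\<close>, which is finitely generated by assumption
  on \<open>A\<close>.\<close>

theorem fin_gen_noetherian:
  assumes A: "noetherian_module A (reg_module A)" and M: "left_module A M" "fin_gen A M"
  shows "noetherian_module A M"
proof -
  interpret left_module A M by fact
  have *: "\<exists>G. finite G \<and> G \<subseteq> N \<and> mod_span A M G = N"
    if "finite Z" "Z \<subseteq> carrier M" "submodule N A M" "N \<subseteq> mod_span A M Z" for Z N
    using that
  proof (induction Z arbitrary: N)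
    case empty
    then show ?case
      by (intro exI[of _ "{}"]) (auto simp: mod_span_empty dest: submodule_zero)
  next
    case (insert z Z)
    let ?L = "mod_span A M Z"
    let ?I = "\<lambda>N. {a \<in> carrier A. \<exists>y\<in>?L. a \<odot>\<^bsub>M\<^esub> z \<oplus>\<^bsub>M\<^esub> y \<in> N}"
    have z: "z \<in> carrier M" "Z \<subseteq> carrier M" using insert.prems by auto
    have L: "submodule ?L A M" by (rule mod_span_submodule[OF z(2)])
    note N = insert.prems(2)
    obtain T where T: "finite T" "T \<subseteq> ?I N" "mod_span A (reg_module A) T = ?I N"
      using A colon_submodule[OF N L z(1)] unfolding noetherian_module_def by blast
    have "\<forall>a\<in>T. \<exists>y. y \<in> ?L \<and> a \<odot>\<^bsub>M\<^esub> z \<oplus>\<^bsub>M\<^esub> y \<in> N" using T(2) by auto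
    then obtain y where y: "\<And>a. a \<in> T \<Longrightarrow> y a \<in> ?L" "\<And>a. a \<in> T \<Longrightarrow> a \<odot>\<^bsub>M\<^esub> z \<oplus>\<^bsub>M\<^esub> y a \<in> N"
      using bchoice[of T "\<lambda>a y. y \<in> ?L \<and> a \<odot>\<^bsub>M\<^esub> z \<oplus>\<^bsub>M\<^esub> y \<in> N"] by blast
    obtain G where G: "finite G" "G \<subseteq> N \<inter> ?L" "mod_span A M G = N \<inter> ?L"
      using insert.IH[OF z(2) submodule_Int[OF N L]] by blast
    \<comment> \<open>Lifts to \<open>N\<close> of generators of the coefficient ideal, joined to
      generators of \<open>N \<inter> ?L\<close>.\<close>
    let ?G = "(\<lambda>a. a \<odot>\<^bsub>M\<^esub> z \<oplus>\<^bsub>M\<^esub> y a) ` T \<union> G"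
    have GN: "?G \<subseteq> N" using y(2) G(2) by auto
    have N1: "submodule (mod_span A M ?G) A M"
      by (rule mod_span_submodule) (use GN submodule_subset[OF N] in blast)
    have "T \<subseteq> ?I (mod_span A M ?G)"
    proof
      fix a assume a: "a \<in> T"
      then have "a \<odot>\<^bsub>M\<^esub> z \<oplus>\<^bsub>M\<^esub> y a \<in> mod_span A M ?G"
        by (intro subsetD[OF mod_span_superset]) auto
      then show "a \<in> ?I (mod_span A M ?G)" using a T(2) y(1) by auto
    qed
    then have I: "?I N \<subseteq> ?I (mod_span A M ?G)"
      using mod_span_minimal[OF colon_submodule[OF N1 L z(1)]] T(3) by blast
    have "N \<subseteq> mod_span A M ?G"
    proof
      fix n assume n: "n \<in> N"
      then have "n \<in> mod_span A M (insert z Z)" using insert.prems(3) by blast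
      then obtain a v where v: "a \<in> carrier A" "v \<in> ?L" "n = a \<odot>\<^bsub>M\<^esub> z \<oplus>\<^bsub>M\<^esub> v"
        using mod_span_insert[OF z] by blast
      then have "a \<in> ?I N" using n by auto
      then obtain w where w: "w \<in> ?L" "a \<odot>\<^bsub>M\<^esub> z \<oplus>\<^bsub>M\<^esub> w \<in> mod_span A M ?G"
        using I by blast
      have carr: "v \<in> carrier M" "w \<in> carrier M" "a \<odot>\<^bsub>M\<^esub> z \<in> carrier M"
        using v w z submodule_in_carrier[OF L] by auto
      have eq: "n \<ominus>\<^bsub>M\<^esub> (a \<odot>\<^bsub>M\<^esub> z \<oplus>\<^bsub>M\<^esub> w) = v \<ominus>\<^bsub>M\<^esub> w"
        unfolding v(3) using carr by (simp add: M.minus_eq M.minus_add M.a_ac M.r_neg1 M.r_neg)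
      have "a \<odot>\<^bsub>M\<^esub> z \<oplus>\<^bsub>M\<^esub> w \<in> N"
        using w(2) mod_span_minimal[OF N GN] by blast
      then have "v \<ominus>\<^bsub>M\<^esub> w \<in> N \<inter> ?L"
        using submodule_minus[OF N n, of "a \<odot>\<^bsub>M\<^esub> z \<oplus>\<^bsub>M\<^esub> w"] submodule_minus[OF L v(2) w(1)] eq by simp
      then have vw: "v \<ominus>\<^bsub>M\<^esub> w \<in> mod_span A M ?G"
        using G(3) mod_span_mono[of G ?G A M] by blast
      have "n = (a \<odot>\<^bsub>M\<^esub> z \<oplus>\<^bsub>M\<^esub> w) \<oplus>\<^bsub>M\<^esub> (v \<ominus>\<^bsub>M\<^esub> w)"
        unfolding v(3) using carr by (simp add: M.minus_eq M.a_ac M.r_neg2 M.r_neg1 M.r_neg)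
      then show "n \<in> mod_span A M ?G"
        using submodule_add[OF N1 w(2) vw] by simp
    qed
    then have "mod_span A M ?G = N"
      using mod_span_minimal[OF N GN] by blast
    then show ?case using GN T(1) G(1) by (intro exI[of _ ?G]) auto
  qed
  obtain Z where "finite Z" "Z \<subseteq> carrier M" "mod_span A M Z = carrier M"
    using M(2) unfolding fin_gen_def by blast
  then show ?thesis
    unfolding noetherian_module_def using M(1) * submodule_subset by metis
qed

text \<open>The assumption \<open>gen\<close> expresses D = N + J D without forming J D, and the one
  on \<open>J\<close> says that J lies in the radical. A proper submodule K between N and D is
  chosen maximal. If c x is outside K, then K + A c x = D, so x = k + a c x, and inverting 1 - a c
  puts x into K.\<close>

lemma nakayama:
  assumes M: "noetherian_module A M" and N: "submodule N A M" and D: "submodule D A M" "N \<subseteq> D"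
    and J: "J \<subseteq> carrier A"
      "\<And>a c. \<lbrakk>a \<in> carrier A; c \<in> J\<rbrakk> \<Longrightarrow> \<exists>t\<in>carrier A. t \<otimes>\<^bsub>A\<^esub> (\<one>\<^bsub>A\<^esub> \<ominus>\<^bsub>A\<^esub> a \<otimes>\<^bsub>A\<^esub> c) = \<one>\<^bsub>A\<^esub>"
    and gen: "\<And>L. \<lbrakk>submodule L A M; N \<subseteq> L; \<And>c x. \<lbrakk>c \<in> J; x \<in> D\<rbrakk> \<Longrightarrow> c \<odot>\<^bsub>M\<^esub> x \<in> L\<rbrakk> \<Longrightarrow> D \<subseteq> L"
  shows "N = D"
proof (rule ccontr)
  assume "N \<noteq> D"
  interpret left_module A M using M unfolding noetherian_module_def by blast
  let ?F = "{L. submodule L A M \<and> N \<subseteq> L \<and> L \<subset> D}"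
  have "N \<in> ?F" using N D \<open>N \<noteq> D\<close> by blast
  then obtain K where K: "K \<in> ?F" "\<And>L. \<lbrakk>L \<in> ?F; K \<subseteq> L\<rbrakk> \<Longrightarrow> L = K"
    using noetherian_module_maximal[OF M, of ?F] by blast
  then have subK: "submodule K A M" and ND: "N \<subseteq> K" "K \<subset> D" by auto
  have "c \<odot>\<^bsub>M\<^esub> x \<in> K" if c: "c \<in> J" and x: "x \<in> D" for c x
  proof (rule ccontr)
    assume not: "c \<odot>\<^bsub>M\<^esub> x \<notin> K"
    have cx: "c \<in> carrier A" "x \<in> carrier M" using c x J(1) submodule_in_carrier[OF D(1)] by auto
    let ?C = "{a \<odot>\<^bsub>M\<^esub> (c \<odot>\<^bsub>M\<^esub> x) | a. a \<in> carrier A}"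
    have C: "submodule ?C A M" by (rule cyclic_submodule) (use cx in auto)
    let ?L = "K <+>\<^bsub>M\<^esub> ?C"
    note L = submodule_set_add[OF subK C]
    have "c \<odot>\<^bsub>M\<^esub> x = \<one>\<^bsub>A\<^esub> \<odot>\<^bsub>M\<^esub> (c \<odot>\<^bsub>M\<^esub> x)" using cx by simp
    then have "c \<odot>\<^bsub>M\<^esub> x \<in> ?C" by blast
    then have inL: "c \<odot>\<^bsub>M\<^esub> x \<in> ?L" using subset_set_add[OF subK C] by blast
    have "?L \<subseteq> D"
    proof
      fix y assume "y \<in> ?L"
      then obtain k a where ka: "k \<in> K" "a \<in> carrier A" "y = k \<oplus>\<^bsub>M\<^esub> a \<odot>\<^bsub>M\<^esub> (c \<odot>\<^bsub>M\<^esub> x)"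
        by (auto elim!: set_add_memE)
      have "a \<odot>\<^bsub>M\<^esub> (c \<odot>\<^bsub>M\<^esub> x) \<in> D"
        using ka(2) cx(1) x by (intro submodule_smult[OF D(1)])
      then show "y \<in> D" using ka ND by (auto intro: submodule_add[OF D(1)])
    qed
    moreover have "?L \<noteq> K" using inL not by blast
    ultimately have "?L = D"
      using K(2)[of ?L] L subset_set_add[OF subK C] ND by blast
    then obtain k a where ka: "k \<in> K" "a \<in> carrier A" "x = k \<oplus>\<^bsub>M\<^esub> a \<odot>\<^bsub>M\<^esub> (c \<odot>\<^bsub>M\<^esub> x)"
      using x by (auto elim!: set_add_memE)
    have kc: "k \<in> carrier M" using ka(1) submodule_in_carrier[OF subK] by blast
    have "(\<one>\<^bsub>A\<^esub> \<ominus>\<^bsub>A\<^esub> a \<otimes>\<^bsub>A\<^esub> c) \<odot>\<^bsub>M\<^esub> x = x \<ominus>\<^bsub>M\<^esub> a \<odot>\<^bsub>M\<^esub> (c \<odot>\<^bsub>M\<^esub> x)"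
      using ka cx by (simp add: smult_l_diff smult_assoc)
    also have "\<dots> = (k \<oplus>\<^bsub>M\<^esub> a \<odot>\<^bsub>M\<^esub> (c \<odot>\<^bsub>M\<^esub> x)) \<ominus>\<^bsub>M\<^esub> a \<odot>\<^bsub>M\<^esub> (c \<odot>\<^bsub>M\<^esub> x)"
      using ka(3) by simp
    also have "\<dots> = k"
      using kc ka(2) cx by (simp add: M.minus_eq M.a_assoc M.r_neg)
    finally have eq: "(\<one>\<^bsub>A\<^esub> \<ominus>\<^bsub>A\<^esub> a \<otimes>\<^bsub>A\<^esub> c) \<odot>\<^bsub>M\<^esub> x = k" .
    obtain t where t: "t \<in> carrier A" "t \<otimes>\<^bsub>A\<^esub> (\<one>\<^bsub>A\<^esub> \<ominus>\<^bsub>A\<^esub> a \<otimes>\<^bsub>A\<^esub> c) = \<one>\<^bsub>A\<^esub>" using J(2)[OF ka(2) c] by blast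
    have "t \<odot>\<^bsub>M\<^esub> k = (t \<otimes>\<^bsub>A\<^esub> (\<one>\<^bsub>A\<^esub> \<ominus>\<^bsub>A\<^esub> a \<otimes>\<^bsub>A\<^esub> c)) \<odot>\<^bsub>M\<^esub> x"
      unfolding eq[symmetric] using t(1) cx ka(2) by (simp add: smult_assoc)
    then have "x \<in> K" using t cx submodule_smult[OF subK t(1) ka(1)] by simp
    then show False using not submodule_smult[OF subK cx(1)] by blast
  qed
  then have "D \<subseteq> K" using gen[OF subK ND(1)] by blast
  then show False using ND by blast
qed

section \<open>Noetherian local rings and Krull's intersection theorem\<close>

lemma (in cring) submodule_reg_iff_ideal: "submodule I R (reg_module R) \<longleftrightarrow> ideal I R"
proof
  assume I: "submodule I R (reg_module R)"
  have "a_inv (reg_module R) = a_inv R" by (rule a_inv_cong) simp_all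
  then have "subgroup I (add_monoid R)"
    using submodule_subset[OF I] submodule_zero[OF I] submodule_add[OF I] submodule_uminus[OF I]
    by (intro subgroup.intro) (auto simp flip: a_inv_def)
  moreover have l: "a \<otimes> x \<in> I" if "a \<in> carrier R" "x \<in> I" for a x
    using submodule_smult[OF I that] by simp
  moreover have "x \<otimes> a \<in> I" if "a \<in> carrier R" "x \<in> I" for a x
    using l[OF that] that submodule_in_carrier[OF I that(2)] by (simp add: m_comm)
  ultimately show "ideal I R"
    by (intro idealI ring_axioms) auto
next
  assume "ideal I R"
  then interpret ideal I R .
  show "submodule I R (reg_module R)"
    by (rule left_module.submoduleI[OF reg_left_module]) (auto intro: I_l_closed Icarr)
qed

locale noetherian_local = cring R for R (structure) and \<mm> +
  assumes noetherian: "noetherian_ring R" and local: "local_ring_with R \<mm>"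
begin

lemma noetherian_reg: "noetherian_module R (reg_module R)"
  unfolding noetherian_module_def
proof (intro conjI allI impI reg_left_module)
  fix I assume I: "submodule I R (reg_module R)"
  then have "ideal I R" by (simp add: submodule_reg_iff_ideal)
  then obtain Z where Z: "Z \<subseteq> carrier R" "finite Z" "I = Idl Z"
    using noetherian_ring.finetely_gen[OF noetherian] by blast
  have ZI: "Z \<subseteq> I" using genideal_self[OF Z(1)] Z(3) by simp
  have "ideal (mod_span R (reg_module R) Z) R"
    using left_module.mod_span_submodule[OF reg_left_module] Z(1) by (simp add: submodule_reg_iff_ideal)
  then have "I \<subseteq> mod_span R (reg_module R) Z"
    unfolding Z(3) by (rule genideal_minimal) (rule mod_span_superset)
  then show "\<exists>Z. finite Z \<and> Z \<subseteq> I \<and> mod_span R (reg_module R) Z = I"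
    using Z(2) ZI mod_span_minimal[OF I ZI] by blast
qed

lemma noetherian_if_fin_gen: "\<lbrakk>left_module R M; fin_gen R M\<rbrakk> \<Longrightarrow> noetherian_module R M"
  by (rule fin_gen_noetherian[OF noetherian_reg])

lemma maximal_ideal: "maximalideal \<mm> R"
  using local unfolding local_ring_with_def by blast

lemma ideal_mm: "ideal \<mm> R"
  using maximal_ideal maximalideal.axioms(1) by blast

lemma mm_subset: "\<mm> \<subseteq> carrier R"
  by (rule subsetI) (rule ideal.Icarr[OF ideal_mm])

lemma one_notin_mm: "\<one> \<notin> \<mm>"
  using maximalideal.I_notcarr[OF maximal_ideal] ideal.one_imp_carrier[OF ideal_mm] by auto

text \<open>If \<open>u\<close> is not a unit, an ideal maximal among the proper ones containing
  \<open>u\<close> is a maximal ideal, hence equal to \<mm>.\<close>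

lemma notin_mm_Units:
  assumes u: "u \<in> carrier R" "u \<notin> \<mm>"
  shows "u \<in> Units R"
proof (rule ccontr)
  assume nu: "u \<notin> Units R"
  let ?F = "{I. ideal I R \<and> u \<in> I \<and> I \<noteq> carrier R}"
  have "PIdl u \<noteq> carrier R"
  proof
    assume "PIdl u = carrier R"
    then have "\<one> \<in> PIdl u" by simp
    then obtain v where "v \<in> carrier R" "\<one> = v \<otimes> u" unfolding cgenideal_def by blast
    then show False using nu u unfolding Units_def by (auto simp: m_comm)
  qed
  then have "?F \<noteq> {}" using cgenideal_ideal[OF u(1)] cgenideal_self[OF u(1)] by blast
  then obtain K where K: "K \<in> ?F" "\<And>I. \<lbrakk>I \<in> ?F; K \<subseteq> I\<rbrakk> \<Longrightarrow> I = K"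
    using noetherian_module_maximal[OF noetherian_reg, of ?F] by (auto simp: submodule_reg_iff_ideal)
  then have "maximalideal K R"
    by (intro maximalidealI) (blast intro: K(2))+
  then have "K = \<mm>" using local unfolding local_ring_with_def by blast
  then show False using K(1) u(2) by blast
qed

lemma one_minus_mm_invertible:
  assumes "a \<in> carrier R" "c \<in> \<mm>"
  shows "\<exists>t\<in>carrier R. t \<otimes> (\<one> \<ominus> a \<otimes> c) = \<one>"
proof -
  have ac: "a \<otimes> c \<in> \<mm>" by (rule ideal.I_l_closed[OF ideal_mm assms(2,1)])
  then have acc: "a \<otimes> c \<in> carrier R" using mm_subset by blast
  have "\<one> \<ominus> a \<otimes> c \<notin> \<mm>"
  proof
    assume "\<one> \<ominus> a \<otimes> c \<in> \<mm>"
    then have "(\<one> \<ominus> a \<otimes> c) \<oplus> a \<otimes> c \<in> \<mm>"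
      using ac by (intro additive_subgroup.a_closed[OF ideal.axioms(1)[OF ideal_mm]])
    moreover have "(\<one> \<ominus> a \<otimes> c) \<oplus> a \<otimes> c = \<one>"
      using acc by (simp add: minus_eq a_assoc l_neg)
    ultimately show False using one_notin_mm by simp
  qed
  then have "\<one> \<ominus> a \<otimes> c \<in> Units R" using acc by (intro notin_mm_Units) auto
  then show ?thesis using Units_l_inv Units_inv_closed by blast
qed

lemma nakayama_mm:
  assumes "noetherian_module R M" "submodule N R M" "submodule D R M" "N \<subseteq> D"
    and "\<And>L. \<lbrakk>submodule L R M; N \<subseteq> L; \<And>c x. \<lbrakk>c \<in> \<mm>; x \<in> D\<rbrakk> \<Longrightarrow> c \<odot>\<^bsub>M\<^esub> x \<in> L\<rbrakk> \<Longrightarrow> D \<subseteq> L"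
  shows "N = D"
  by (rule nakayama[OF assms(1-4) mm_subset one_minus_mm_invertible assms(5)])

section \<open>Powers of the maximal ideal\<close>

lemma ideal_ideal_pow: "ideal (ideal_pow R \<mm> n) R"
  by (induction n) (auto intro: oneideal ideal_prod_is_ideal ideal_mm)

lemma ideal_pow_subset: "ideal_pow R \<mm> n \<subseteq> carrier R"
  by (rule subsetI) (rule ideal.Icarr[OF ideal_ideal_pow])

lemma ideal_pow_Suc_subset: "ideal_pow R \<mm> (Suc n) \<subseteq> ideal_pow R \<mm> n"
  using ideal_prod_inter[OF ideal_ideal_pow ideal_mm] by simp

lemma ideal_pow_mono: "n \<le> k \<Longrightarrow> ideal_pow R \<mm> k \<subseteq> ideal_pow R \<mm> n"
  by (rule lift_Suc_antimono_le[of "ideal_pow R \<mm>"]) (rule ideal_pow_Suc_subset)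

lemma ideal_prod_minimal:
  assumes "ideal L R" "\<And>i j. \<lbrakk>i \<in> I; j \<in> J\<rbrakk> \<Longrightarrow> i \<otimes> j \<in> L"
  shows "ideal_prod R I J \<subseteq> L"
proof
  fix x assume "x \<in> ideal_prod R I J"
  then show "x \<in> L"
    by induction (auto intro: assms(2) additive_subgroup.a_closed[OF ideal.axioms(1)[OF assms(1)]])
qed

lemma ideal_pow_1: "ideal_pow R \<mm> (Suc 0) \<subseteq> \<mm>"
  using ideal_prod_inter[OF oneideal ideal_mm] by simp

text \<open>The inclusion of \<mm>^(j+k) in \<mm>^j \<mm>^k, stated as a mapping property. In the
  induction on \<open>k\<close> the target \<open>L\<close> is replaced by the ideal of all u with u
  \<mm> inside \<open>L\<close>.\<close>

lemma ideal_pow_add_subset: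
  assumes "ideal L R" "\<And>u v. \<lbrakk>u \<in> ideal_pow R \<mm> j; v \<in> ideal_pow R \<mm> k\<rbrakk> \<Longrightarrow> u \<otimes> v \<in> L"
  shows "ideal_pow R \<mm> (j + k) \<subseteq> L"
  using assms
proof (induction k arbitrary: L)
  case 0
  show ?case
  proof
    fix u assume "u \<in> ideal_pow R \<mm> (j + 0)"
    then have "u \<in> ideal_pow R \<mm> j" "u \<in> carrier R" using ideal_pow_subset by auto
    then show "u \<in> L" using "0.prems"(2)[of u \<one>] by simp
  qed
next
  case (Suc k)
  interpret L: ideal L R by fact
  let ?L = "{u \<in> carrier R. \<forall>c\<in>\<mm>. u \<otimes> c \<in> L}"
  have c: "x \<in> carrier R" if "x \<in> \<mm>" for x using mm_subset that by blast
  have "submodule ?L R (reg_module R)"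
    by (rule left_module.submoduleI[OF reg_left_module])
      (auto simp: c l_distr m_assoc intro: L.I_l_closed)
  then have L': "ideal ?L R" by (simp add: submodule_reg_iff_ideal)
  have "ideal_pow R \<mm> (j + k) \<subseteq> ?L"
  proof (rule Suc.IH[OF L'])
    fix u v assume u: "u \<in> ideal_pow R \<mm> j" and v: "v \<in> ideal_pow R \<mm> k"
    then have uv: "u \<in> carrier R" "v \<in> carrier R" using ideal_pow_subset by auto
    have "(u \<otimes> v) \<otimes> c \<in> L" if "c \<in> \<mm>" for c
      using Suc.prems(2)[OF u, of "v \<otimes> c"] ideal_prod.prod[OF v that, of R] uv that
      by (simp add: m_assoc c)
    then show "u \<otimes> v \<in> ?L" using uv by simp
  qed
  then have "ideal_prod R (ideal_pow R \<mm> (j + k)) \<mm> \<subseteq> L"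
    by (intro ideal_prod_minimal[OF Suc.prems(1)]) auto
  then show ?case by simp
qed

text \<open>Noetherian induction instead of counting exponents of generators. Let K be maximal among
  the ideals above Q that contain no power of \<mm>, and take b in \<mm> outside K. The last power a
  of b outside K satisfies a^2 \<in> K. By maximality some \<mm>^N lies in K + (a), and then
  \<mm>^(2N) lies in K.\<close>

lemma ideal_pow_subset_if_radical:
  assumes Q: "ideal Q R" and nil: "\<And>a. a \<in> \<mm> \<Longrightarrow> \<exists>n. a [^] (n::nat) \<in> Q"
  shows "\<exists>N. ideal_pow R \<mm> N \<subseteq> Q"
proof (rule ccontr)
  assume neg: "\<nexists>N. ideal_pow R \<mm> N \<subseteq> Q"
  let ?F = "{I. ideal I R \<and> Q \<subseteq> I \<and> (\<nexists>N. ideal_pow R \<mm> N \<subseteq> I)}"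
  have "?F \<noteq> {}" using Q neg by blast
  then obtain K where K: "K \<in> ?F" "\<And>I. \<lbrakk>I \<in> ?F; K \<subseteq> I\<rbrakk> \<Longrightarrow> I = K"
    using noetherian_module_maximal[OF noetherian_reg, of ?F] by (auto simp: submodule_reg_iff_ideal)
  then interpret K: ideal K R by blast
  have "\<not> \<mm> \<subseteq> K" using K(1) ideal_pow_1 by blast
  then obtain b where b: "b \<in> \<mm>" "b \<notin> K" by blast
  then have bc: "b \<in> carrier R" using mm_subset by blast
  define n where "n = (LEAST n. b [^] (n::nat) \<in> K)"
  have bn: "b [^] n \<in> K"
    unfolding n_def by (rule LeastI_ex) (use nil[OF b(1)] K(1) in blast)
  have "n \<noteq> 0"
  proof
    assume "n = 0"
    then have "b \<otimes> \<one> \<in> K" using bn bc by (intro K.I_l_closed) auto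
    then show False using b(2) bc by simp
  qed
  then obtain k where k: "n = Suc k" using not0_implies_Suc by blast
  define a where "a = b [^] k"
  have "k \<noteq> 0" using bn k b(2) bc by (cases k) auto
  have aK: "a \<notin> K" unfolding a_def using not_less_Least[of k "\<lambda>n. b [^] n \<in> K"] k n_def by auto
  have ac: "a \<in> carrier R" unfolding a_def using bc by simp
  have aa: "a \<otimes> a \<in> K"
  proof -
    have "k + k = n + (k - 1)" using k \<open>k \<noteq> 0\<close> by simp
    then have "a \<otimes> a = b [^] n \<otimes> b [^] (k - 1)"
      unfolding a_def using bc by (simp add: nat_pow_mult)
    then show ?thesis using bn bc by (simp add: K.I_r_closed)
  qed
  let ?I = "K <+>\<^bsub>R\<^esub> PIdl a"
  have I: "ideal ?I R" by (rule add_ideals[OF K.is_ideal cgenideal_ideal[OF ac]])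
  have KI: "K \<subseteq> ?I"
  proof
    fix x assume x: "x \<in> K"
    have "\<zero> \<in> PIdl a" using additive_subgroup.zero_closed[OF ideal.axioms(1)[OF cgenideal_ideal[OF ac]]] .
    then have "x \<oplus> \<zero> \<in> ?I" using x unfolding set_add_def' by blast
    then show "x \<in> ?I" using x by simp
  qed
  have aI: "a \<in> ?I"
  proof -
    have "\<zero> \<oplus> a \<in> ?I" using cgenideal_self[OF ac] K.zero_closed unfolding set_add_def' by blast
    then show ?thesis using ac by simp
  qed
  then have "?I \<notin> ?F" using K(2)[OF _ KI] aK by blast
  then obtain N where N: "ideal_pow R \<mm> N \<subseteq> ?I" using I KI K(1) by blast
  have "ideal_pow R \<mm> (N + N) \<subseteq> K"
  proof (rule ideal_pow_add_subset[OF K.is_ideal])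
    fix u v assume "u \<in> ideal_pow R \<mm> N" "v \<in> ideal_pow R \<mm> N"
    then have "u \<in> ?I" "v \<in> ?I" using N by auto
    then obtain p q x y where *: "p \<in> K" "q \<in> K" "x \<in> carrier R" "y \<in> carrier R"
        "u = p \<oplus> x \<otimes> a" "v = q \<oplus> y \<otimes> a"
      unfolding set_add_def' cgenideal_def by blast
    then have c: "p \<in> carrier R" "q \<in> carrier R" by auto
    have "u \<otimes> v = (p \<otimes> q \<oplus> p \<otimes> (y \<otimes> a)) \<oplus> ((x \<otimes> a) \<otimes> q \<oplus> (x \<otimes> y) \<otimes> (a \<otimes> a))"
      unfolding * using * c ac by (simp add: l_distr r_distr m_ac a_ac)
    also have "\<dots> \<in> K"
      using * c ac aa
      by (intro K.a_closed K.I_l_closed[OF aa] K.I_r_closed[OF \<open>p \<in> K\<close>] K.I_l_closed[OF \<open>q \<in> K\<close>]) auto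
    finally show "u \<otimes> v \<in> K" .
  qed
  then show False using K(1) by blast
qed

text \<open>
  Let \<open>D\<close> be the intersection and \<open>K\<close> a submodule maximal subject to \<open>K \<inter> D = \<mm> D\<close>. Some power
  of \<open>\<mm>\<close> maps \<open>M\<close> into \<open>K\<close>, so \<open>D \<subseteq> K\<close> and \<open>D = \<mm> D\<close>.
\<close>

theorem krull_intersection:
  assumes M: "noetherian_module R M" and x: "\<And>t. x \<in> smult_span R (ideal_pow R \<mm> t) M"
  shows "x = \<zero>\<^bsub>M\<^esub>"
proof -
  interpret M: left_module R M using M unfolding noetherian_module_def by blast
  have sub: "submodule (smult_span R (ideal_pow R \<mm> t) M) R M" for t
    by (rule M.smult_span_submodule[OF ideal_pow_subset])
  define D where "D = \<Inter>(range (\<lambda>t. smult_span R (ideal_pow R \<mm> t) M))"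
  have D: "submodule D R M"
    unfolding D_def by (rule submodule_Inter[OF M.abelian_group_axioms]) (use sub in auto)
  have Dc: "y \<in> carrier M" if "y \<in> D" for y using submodule_in_carrier[OF D that] .
  define E where "E = mod_span R M {c \<odot>\<^bsub>M\<^esub> y | c y. c \<in> \<mm> \<and> y \<in> D}"
  have E: "submodule E R M"
    unfolding E_def by (rule M.mod_span_submodule) (use mm_subset Dc in auto)
  have memE: "c \<odot>\<^bsub>M\<^esub> y \<in> E" if "c \<in> \<mm>" "y \<in> D" for c y
    unfolding E_def by (rule subsetD[OF mod_span_superset]) (use that in blast)
  have ED: "E \<subseteq> D"
    unfolding E_def
    by (rule mod_span_minimal[OF D]) (use mm_subset in \<open>auto intro: submodule_smult[OF D]\<close>)
  let ?F = "{K. submodule K R M \<and> K \<inter> D = E}"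
  have "E \<in> ?F" using E ED by blast
  then obtain K where K: "K \<in> ?F" "\<And>N. \<lbrakk>N \<in> ?F; K \<subseteq> N\<rbrakk> \<Longrightarrow> N = K"
    using noetherian_module_maximal[OF M, of ?F] by blast
  then have subK: "submodule K R M" and KD: "K \<inter> D = E" by auto
  have Kc: "y \<in> carrier M" if "y \<in> K" for y using submodule_in_carrier[OF subK that] .
  \<comment> \<open>The annihilator of M / K. It contains a power of \<mm> as soon as it contains a
    power of every single element of \<mm>.\<close>
  let ?Q = "{r \<in> carrier R. \<forall>y\<in>carrier M. r \<odot>\<^bsub>M\<^esub> y \<in> K}"
  have "submodule ?Q R (reg_module R)"
    by (rule left_module.submoduleI[OF reg_left_module])
      (auto simp: M.smult_l_distr M.smult_assoc
        intro: submodule_zero[OF subK] submodule_add[OF subK] submodule_smult[OF subK])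
  then have Q: "ideal ?Q R" by (simp add: submodule_reg_iff_ideal)
  have "\<exists>n. a [^] (n::nat) \<in> ?Q" if a: "a \<in> \<mm>" for a
  proof -
    have ac: "a \<in> carrier R" using a mm_subset by blast
    have sub: "submodule {y \<in> carrier M. b \<odot>\<^bsub>M\<^esub> y \<in> K} R M" if "b \<in> carrier R" for b
    proof (rule M.submoduleI)
      fix r y assume "r \<in> carrier R" "y \<in> {y \<in> carrier M. b \<odot>\<^bsub>M\<^esub> y \<in> K}"
      moreover from this have "b \<odot>\<^bsub>M\<^esub> (r \<odot>\<^bsub>M\<^esub> y) = r \<odot>\<^bsub>M\<^esub> (b \<odot>\<^bsub>M\<^esub> y)"
        using that by (simp add: m_comm flip: M.smult_assoc)
      ultimately show "r \<odot>\<^bsub>M\<^esub> y \<in> {y \<in> carrier M. b \<odot>\<^bsub>M\<^esub> y \<in> K}"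
        by (auto intro: submodule_smult[OF subK])
    qed (use that in \<open>auto simp: M.smult_r_distr
      intro: submodule_zero[OF subK] submodule_add[OF subK]\<close>)
    let ?L = "\<lambda>n. {y \<in> carrier M. a [^] (n::nat) \<odot>\<^bsub>M\<^esub> y \<in> K}"
    have step: "a [^] Suc n \<odot>\<^bsub>M\<^esub> y = a \<odot>\<^bsub>M\<^esub> (a [^] n \<odot>\<^bsub>M\<^esub> y)" if "y \<in> carrier M" for n y
      using ac that by (simp add: m_comm flip: M.smult_assoc)
    \<comment> \<open>The kernels of the powers of a on M / K ascend, hence stabilise at some n. For
      this n the submodule K + a^n M still meets D in E, so the maximality of K forces a^n M into
      K.\<close>
    obtain n where n: "?L (Suc n) = ?L n"
    proof (rule noetherian_module_chain[OF M, of ?L])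
      show "submodule (?L n) R M" for n by (rule sub) (use ac in simp)
      show "?L n \<subseteq> ?L (Suc n)" for n
        using step submodule_smult[OF subK ac] by auto
    qed
    let ?P = "{y \<in> carrier M. \<exists>z\<in>carrier M. y = a [^] n \<odot>\<^bsub>M\<^esub> z}"
    have P: "submodule ?P R M"
    proof (rule M.submoduleI)
      show "\<zero>\<^bsub>M\<^esub> \<in> ?P" using ac by (auto intro!: bexI[of _ "\<zero>\<^bsub>M\<^esub>"])
      show "y \<oplus>\<^bsub>M\<^esub> y' \<in> ?P" if "y \<in> ?P" "y' \<in> ?P" for y y'
        using that ac by (auto simp flip: M.smult_r_distr)
      show "r \<odot>\<^bsub>M\<^esub> y \<in> ?P" if r: "r \<in> carrier R" and y: "y \<in> ?P" for r y
      proof -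
        obtain z where z: "z \<in> carrier M" "y = a [^] n \<odot>\<^bsub>M\<^esub> z" using y by blast
        have "r \<odot>\<^bsub>M\<^esub> y = a [^] n \<odot>\<^bsub>M\<^esub> (r \<odot>\<^bsub>M\<^esub> z)"
          unfolding z(2) using z(1) r ac by (simp add: m_comm flip: M.smult_assoc)
        then show ?thesis using z r ac by auto
      qed
    qed auto
    let ?K = "K <+>\<^bsub>M\<^esub> ?P"
    \<comment> \<open>For y = k + a^n z in D, the element a y lies in \<mm> D = E and so in K. Hence
      a^(n+1) z is in K, and by the choice of n so is a^n z.\<close>
    have "?K \<inter> D \<subseteq> E"
    proof
      fix y assume y: "y \<in> ?K \<inter> D"
      then obtain k z where kz: "k \<in> K" "z \<in> carrier M" "y = k \<oplus>\<^bsub>M\<^esub> a [^] n \<odot>\<^bsub>M\<^esub> z"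
        by (auto elim!: M.set_add_memE)
      let ?w = "a [^] n \<odot>\<^bsub>M\<^esub> z"
      have w: "?w \<in> carrier M" using ac kz by simp
      have "a \<odot>\<^bsub>M\<^esub> y \<in> E" using memE[OF a, of y] y by simp
      then have ay: "a \<odot>\<^bsub>M\<^esub> y \<in> K" using KD by auto
      then have "a \<odot>\<^bsub>M\<^esub> y \<ominus>\<^bsub>M\<^esub> a \<odot>\<^bsub>M\<^esub> k \<in> K"
        by (intro submodule_minus[OF subK ay] submodule_smult[OF subK ac kz(1)])
      moreover have "a \<odot>\<^bsub>M\<^esub> y \<ominus>\<^bsub>M\<^esub> a \<odot>\<^bsub>M\<^esub> k = a \<odot>\<^bsub>M\<^esub> ?w"
        unfolding kz(3) using ac w Kc[OF kz(1)]
        by (simp add: M.smult_r_distr M.minus_eq M.a_ac M.r_neg1 M.r_neg2 M.r_neg)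
      ultimately have "z \<in> ?L (Suc n)" using step kz(2) by simp
      then have "?w \<in> K" using n by blast
      then have "y \<in> K" using kz submodule_add[OF subK] by blast
      then show "y \<in> E" using y KD by blast
    qed
    moreover have "E \<subseteq> ?K" using KD M.subset_set_add(1)[OF subK P] by blast
    ultimately have "?K = K"
      using K(2)[of ?K] M.submodule_set_add[OF subK P] M.subset_set_add(1)[OF subK P] ED by blast
    then have "?P \<subseteq> K" using M.subset_set_add(2)[OF subK P] by blast
    then have "a [^] n \<in> ?Q" using ac by auto
    then show ?thesis ..
  qed
  then obtain N where "ideal_pow R \<mm> N \<subseteq> ?Q"
    using ideal_pow_subset_if_radical[OF Q] by blast
  then have "smult_span R (ideal_pow R \<mm> N) M \<subseteq> K"
    by (intro smult_span_minimal[OF subK]) auto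
  then have "D \<subseteq> E" using KD unfolding D_def by blast
  have "{\<zero>\<^bsub>M\<^esub>} = D"
  proof (rule nakayama_mm[OF M M.submodule_trivial D])
    fix L assume L: "submodule L R M" "\<And>c y. \<lbrakk>c \<in> \<mm>; y \<in> D\<rbrakk> \<Longrightarrow> c \<odot>\<^bsub>M\<^esub> y \<in> L"
    then have "E \<subseteq> L" unfolding E_def by (intro mod_span_minimal) auto
    then show "D \<subseteq> L" using \<open>D \<subseteq> E\<close> by blast
  qed (simp add: submodule_zero[OF D])
  then show ?thesis using x unfolding D_def by blast
qed

end

section \<open>Regular sequences and chains of primes\<close>

lemma (in noetherian_local) ideal_annihilator_mod:
  assumes "left_module R M" "submodule N R M"
  shows "ideal {r \<in> carrier R. \<forall>y\<in>carrier M. r \<odot>\<^bsub>M\<^esub> y \<in> N} R"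
proof -
  interpret M: left_module R M by fact
  have "submodule {r \<in> carrier R. \<forall>y\<in>carrier M. r \<odot>\<^bsub>M\<^esub> y \<in> N} R (reg_module R)"
    by (rule left_module.submoduleI[OF reg_left_module])
      (auto simp: M.smult_l_distr M.smult_assoc
        intro: submodule_zero[OF assms(2)] submodule_add[OF assms(2)] submodule_smult[OF assms(2)])
  then show ?thesis by (simp add: submodule_reg_iff_ideal)
qed

text \<open>An ideal p maximal among those that contain A and miss S is prime: for a and b outside p
  both p + (a) and p + (b) meet S, and the product of two such elements lies in p + (a b).\<close>

lemma (in noetherian_local) prime_ideal_avoiding:
  assumes A: "ideal A R" "A \<inter> S = {}"
    and S: "S \<subseteq> carrier R" "\<one> \<in> S" "\<And>s t. \<lbrakk>s \<in> S; t \<in> S\<rbrakk> \<Longrightarrow> s \<otimes> t \<in> S"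
  obtains p where "primeideal p R" "A \<subseteq> p" "p \<inter> S = {}"
proof -
  let ?F = "{I. ideal I R \<and> A \<subseteq> I \<and> I \<inter> S = {}}"
  have "?F \<noteq> {}" using A by blast
  then obtain p where p: "p \<in> ?F" "\<And>I. \<lbrakk>I \<in> ?F; p \<subseteq> I\<rbrakk> \<Longrightarrow> I = p"
    using noetherian_module_maximal[OF noetherian_reg, of ?F] by (auto simp: submodule_reg_iff_ideal)
  then interpret p: ideal p R by blast
  have meet: "\<exists>k\<in>p. \<exists>x\<in>carrier R. k \<oplus> x \<otimes> a \<in> S" if a: "a \<in> carrier R" "a \<notin> p" for a
  proof -
    let ?I = "p <+>\<^bsub>R\<^esub> PIdl a"
    have I: "ideal ?I R" by (rule add_ideals[OF p.is_ideal cgenideal_ideal[OF a(1)]])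
    have pI: "p \<subseteq> ?I"
    proof
      fix y assume y: "y \<in> p"
      have "\<zero> \<in> PIdl a"
        using additive_subgroup.zero_closed[OF ideal.axioms(1)[OF cgenideal_ideal[OF a(1)]]] .
      then have "y \<oplus> \<zero> \<in> ?I" using y unfolding set_add_def' by blast
      then show "y \<in> ?I" using y by simp
    qed
    have "\<zero> \<oplus> a \<in> ?I" using cgenideal_self[OF a(1)] p.zero_closed unfolding set_add_def' by blast
    then have "a \<in> ?I" using a by simp
    then have "?I \<inter> S \<noteq> {}" using p(2)[OF _ pI] I pI p(1) a(2) by blast
    then show ?thesis unfolding set_add_def' cgenideal_def by blast
  qed
  have "primeideal p R"
  proof (rule primeidealI)
    show "carrier R \<noteq> p" using S(1,2) p(1) by blast
    fix a b assume ab: "a \<in> carrier R" "b \<in> carrier R" "a \<otimes> b \<in> p"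
    show "a \<in> p \<or> b \<in> p"
    proof (rule ccontr)
      assume "\<not> (a \<in> p \<or> b \<in> p)"
      then obtain k x l y where *: "k \<in> p" "x \<in> carrier R" "k \<oplus> x \<otimes> a \<in> S"
          "l \<in> p" "y \<in> carrier R" "l \<oplus> y \<otimes> b \<in> S"
        using meet ab by meson
      have c: "k \<in> carrier R" "l \<in> carrier R" using * by auto
      have "(k \<oplus> x \<otimes> a) \<otimes> (l \<oplus> y \<otimes> b) =
          (k \<otimes> l \<oplus> k \<otimes> (y \<otimes> b)) \<oplus> ((x \<otimes> a) \<otimes> l \<oplus> (x \<otimes> y) \<otimes> (a \<otimes> b))"
        using * c ab by (simp add: l_distr r_distr m_ac a_ac)
      also have "\<dots> \<in> p"
        using * c ab
        by (intro p.a_closed p.I_l_closed[OF ab(3)] p.I_r_closed[OF *(1)] p.I_l_closed[OF *(4)]) auto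
      finally show False using S(3)[OF *(3,6)] p(1) by blast
    qed
  qed (use p.is_ideal is_cring in auto)
  then show ?thesis using that p(1) by blast
qed

text \<open>
  If \<open>x\<close> is regular on \<open>M\<close> and \<open>q\<close> is a prime containing the annihilator of \<open>M / x M\<close>, then the
  multiplicative set of all \<open>s x\<^sup>t\<close> with \<open>s \<notin> q\<close> misses the annihilator of \<open>M\<close>; this produces a
  prime strictly below \<open>q\<close> that contains the annihilator of \<open>M\<close>.
\<close>

lemma (in noetherian_local) length_regular_seq_le_krull_dim:
  assumes M: "left_module R M" and xs: "set xs \<subseteq> carrier R" "regular_seq R M xs"
  shows "enat (length xs) \<le> krull_dim R"
proof -
  interpret M: left_module R M by fact
  let ?n = "length xs"
  define N where "N i = smult_span R (set (take i xs)) M" for i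
  have N: "submodule (N i) R M" for i
    unfolding N_def by (rule M.smult_span_submodule) (use xs(1) set_take_subset[of i xs] in blast)
  define ann where "ann i = {r \<in> carrier R. \<forall>y\<in>carrier M. r \<odot>\<^bsub>M\<^esub> y \<in> N i}" for i
  have ann: "ideal (ann i) R" for i
    unfolding ann_def by (rule ideal_annihilator_mod[OF M N])
  have reg: "y \<in> N i" if "i < ?n" "y \<in> carrier M" "(xs ! i) \<odot>\<^bsub>M\<^esub> y \<in> N i" for i y
    using xs(2) that unfolding regular_seq_def N_def by blast
  have proper: "N ?n \<noteq> carrier M"
    using xs(2) unfolding regular_seq_def N_def by simp
  \<comment> \<open>The chain grows downwards. Its smallest prime \<open>p 0\<close> contains the
    annihilator of M modulo the leading n - k elements, and this invariant is what allows a further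
    prime to be placed below it.\<close>
  have chain: "\<exists>p :: nat \<Rightarrow> 'a set. (\<forall>i\<le>k. primeideal (p i) R) \<and> (\<forall>i<k. p i \<subset> p (Suc i)) \<and> ann (?n - k) \<subseteq> p 0"
    if "k \<le> ?n" for k
    using that
  proof (induction k)
    case 0
    have "ann ?n \<subseteq> \<mm>"
    proof
      fix r assume r: "r \<in> ann ?n"
      show "r \<in> \<mm>"
      proof (rule ccontr)
        assume "r \<notin> \<mm>"
        then have u: "r \<in> Units R" using r notin_mm_Units unfolding ann_def by blast
        have "y \<in> N ?n" if y: "y \<in> carrier M" for y
        proof -
          have "inv r \<odot>\<^bsub>M\<^esub> (r \<odot>\<^bsub>M\<^esub> y) \<in> N ?n"
            by (rule submodule_smult[OF N]) (use r y u in \<open>auto simp: ann_def\<close>)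
          moreover have "inv r \<odot>\<^bsub>M\<^esub> (r \<odot>\<^bsub>M\<^esub> y) = (inv r \<otimes> r) \<odot>\<^bsub>M\<^esub> y"
            using u y by (intro M.smult_assoc[symmetric]) auto
          ultimately show ?thesis using u y by simp
        qed
        then show False using proper submodule_subset[OF N] by blast
      qed
    qed
    then show ?case
      using maximalideal_prime[OF maximal_ideal] by (intro exI[of _ "\<lambda>_. \<mm>"]) auto
  next
    case (Suc k)
    then obtain p :: "nat \<Rightarrow> 'a set" where p: "\<forall>i\<le>k. primeideal (p i) R" "\<forall>i<k. p i \<subset> p (Suc i)"
        "ann (?n - k) \<subseteq> p 0"
      by auto
    interpret p0: primeideal "p 0" R using p(1) by blast
    define i where "i = ?n - Suc k"
    have i: "i < ?n" "?n - k = Suc i" using Suc.prems unfolding i_def by auto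
    let ?x = "xs ! i"
    have x: "?x \<in> carrier R" using xs(1) i(1) nth_mem by blast
    let ?S = "{s \<otimes> ?x [^] t | s t. s \<in> carrier R \<and> s \<notin> p 0 \<and> t \<in> (UNIV :: nat set)}"
    have mono: "N i \<subseteq> N (Suc i)"
      unfolding N_def by (rule smult_span_mono) (rule set_take_subset_set_take, simp)
    \<comment> \<open>Regularity of x_i modulo the earlier elements lets one factor x_i be cancelled
      at a time.\<close>
    have pow: "s \<in> ann i" if "s \<in> carrier R" "s \<otimes> ?x [^] t \<in> ann i" for s and t :: nat
      using that
    proof (induction t arbitrary: s)
      case 0
      then show ?case by simp
    next
      case (Suc t)
      have "(?x \<otimes> s) \<otimes> ?x [^] t \<in> ann i"
        using Suc.prems x by (simp add: m_ac)
      then have xs: "?x \<otimes> s \<in> ann i" using Suc.IH[of "?x \<otimes> s"] Suc.prems(1) x by simp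
      have "s \<odot>\<^bsub>M\<^esub> y \<in> N i" if "y \<in> carrier M" for y
        using xs that Suc.prems(1) x reg[OF i(1), of "s \<odot>\<^bsub>M\<^esub> y"]
        by (simp add: ann_def M.smult_assoc)
      then show ?case using Suc.prems(1) by (simp add: ann_def)
    qed
    have S1: "ann i \<inter> ?S = {}"
      using pow p(3) mono unfolding i(2) by (fastforce simp: ann_def)
    have S2: "\<one> \<in> ?S"
    proof -
      have "\<one> = \<one> \<otimes> ?x [^] (0::nat)" by simp
      moreover have "\<one> \<notin> p 0" using p0.I_notcarr p0.one_imp_carrier by auto
      ultimately show ?thesis by blast
    qed
    have S3: "u \<otimes> v \<in> ?S" if "u \<in> ?S" "v \<in> ?S" for u v
    proof -
      from that obtain s t s' t' where *: "u = s \<otimes> ?x [^] (t::nat)" "v = s' \<otimes> ?x [^] (t'::nat)"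
          "s \<in> carrier R" "s \<notin> p 0" "s' \<in> carrier R" "s' \<notin> p 0"
        by auto
      have "u \<otimes> v = (s \<otimes> s') \<otimes> (?x [^] t \<otimes> ?x [^] t')"
        unfolding * using * x by (simp add: m_ac)
      also have "\<dots> = (s \<otimes> s') \<otimes> ?x [^] (t + t')"
        using x by (simp add: nat_pow_mult)
      finally show ?thesis using * p0.I_prime by auto
    qed
    have S4: "?S \<subseteq> carrier R" using x by auto
    obtain p' where p': "primeideal p' R" "ann i \<subseteq> p'" "p' \<inter> ?S = {}"
      by (rule prime_ideal_avoiding[OF ann S1 S4 S2 S3])
    interpret p': primeideal p' R by fact
    have "r \<in> p 0" if "r \<in> p'" for r
    proof (rule ccontr)
      assume "r \<notin> p 0"
      moreover have "r \<in> carrier R" "r = r \<otimes> ?x [^] (0::nat)" using that by auto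
      ultimately have "r \<in> ?S" by blast
      then show False using that p'(3) by blast
    qed
    \<comment> \<open>The element x_i witnesses that the inclusion is strict: it annihilates M
      modulo x_1, ..., x_i, whereas p' misses the multiplicative set, to which x_i belongs.\<close>
    moreover have "?x \<in> p 0"
    proof -
      have "?x \<odot>\<^bsub>M\<^esub> y \<in> N (Suc i)" if "y \<in> carrier M" for y
        unfolding N_def using that i(1) by (intro smult_span_memI) (simp_all add: take_Suc_conv_app_nth)
      then show ?thesis using p(3) x unfolding i(2) ann_def by blast
    qed
    moreover have "?x \<notin> p'"
    proof -
      have "\<one> \<notin> p 0" using p0.I_notcarr p0.one_imp_carrier by auto
      then have "\<one> \<otimes> ?x [^] (1::nat) \<in> ?S" by blast
      then show ?thesis using p'(3) x by auto
    qed
    ultimately have "p' \<subset> p 0" by blast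
    then show ?case
      using p p' unfolding i_def[symmetric]
      by (intro exI[of _ "\<lambda>j. case j of 0 \<Rightarrow> p' | Suc j \<Rightarrow> p j"]) (auto split: nat.splits)
  qed
  show ?thesis
    using chain[OF order_refl] unfolding krull_dim_def by (intro Sup_upper) auto
qed

section \<open>Idempotents in module-finite algebras over complete local rings\<close>

lemma (in ideal) minus_closed_ideal: "\<lbrakk>x \<in> I; y \<in> I\<rbrakk> \<Longrightarrow> x \<ominus> y \<in> I"
  unfolding a_minus_def
  by (rule additive_subgroup.a_closed[OF additive_subgroup_axioms]) (auto intro: a_inv_closed)

lemma (in ring) minus_minus_cancel:
  assumes "x \<in> carrier R" "y \<in> carrier R" "z \<in> carrier R"
  shows "(x \<ominus> z) \<ominus> (y \<ominus> z) = x \<ominus> y" "(z \<ominus> y) \<ominus> (z \<ominus> x) = x \<ominus> y"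
  using assms by algebra+

text \<open>Coefficients with respect to \<open>Z\<close> are not unique, so no coordinate sequences
  can be read off from \<open>c\<close>. Instead one generator \<open>z\<close> is split off at a
  time: its coefficients in the increments are chosen, summed up in the complete ring
  \<open>R\<close>, and subtracted. Spelling out the span of \<mm>^n Z instead of \<mm>^n M makes
  this induction on \<open>Z\<close> possible.\<close>

lemma (in noetherian_local) fin_gen_complete:
  assumes compl: "adic_complete R \<mm>" and M: "left_module R M"
    and Z: "finite Z" "Z \<subseteq> carrier M"
    and c: "\<And>n. c n \<in> carrier M"
      "\<And>n. c (Suc n) \<ominus>\<^bsub>M\<^esub> c n \<in> mod_span R M {r \<odot>\<^bsub>M\<^esub> z | r z. r \<in> ideal_pow R \<mm> n \<and> z \<in> Z}"
  shows "\<exists>y\<in>carrier M. \<forall>n. y \<ominus>\<^bsub>M\<^esub> c n \<in> mod_span R M {r \<odot>\<^bsub>M\<^esub> z | r z. r \<in> ideal_pow R \<mm> n \<and> z \<in> Z}"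
  using Z c
proof (induction Z arbitrary: c)
  interpret M: left_module R M by fact
  case empty
  have eq: "c n = c 0" for n
  proof (induction n)
    case (Suc n)
    have "c (Suc n) \<ominus>\<^bsub>M\<^esub> c n = \<zero>\<^bsub>M\<^esub>" using empty.prems(3)[of n] by (simp add: M.mod_span_empty)
    then have "c (Suc n) = c n"
      by (rule M.eq_if_minus_eq_zero[OF empty.prems(2) empty.prems(2)])
    then show ?case using Suc by simp
  qed simp
  show ?case
  proof (intro bexI allI)
    fix n
    have "c 0 \<ominus>\<^bsub>M\<^esub> c n = \<zero>\<^bsub>M\<^esub>" using empty.prems(2) by (simp add: eq[of n] M.minus_eq M.r_neg)
    then show "c 0 \<ominus>\<^bsub>M\<^esub> c n \<in> mod_span R M {r \<odot>\<^bsub>M\<^esub> z | r z. r \<in> ideal_pow R \<mm> n \<and> z \<in> {}}"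
      by (simp add: M.mod_span_empty)
  qed (rule empty.prems(2))
next
  interpret M: left_module R M by fact
  case (insert z Z)
  let ?W = "\<lambda>Z n. mod_span R M {r \<odot>\<^bsub>M\<^esub> z | r z. r \<in> ideal_pow R \<mm> n \<and> z \<in> Z}"
  have z: "z \<in> carrier M" "Z \<subseteq> carrier M" using insert.prems(1) by auto
  have W: "submodule (?W Z n) R M" for n
    by (rule M.mod_span_submodule) (use z ideal_pow_subset[of n] in auto)
  have W': "submodule (?W (insert z Z) n) R M" for n
    by (rule M.mod_span_submodule) (use z ideal_pow_subset[of n] in auto)
  have WW': "?W Z n \<subseteq> ?W (insert z Z) n" for n by (rule mod_span_mono) blast
  have split: "\<exists>r\<in>ideal_pow R \<mm> n. \<exists>y\<in>?W Z n. x = r \<odot>\<^bsub>M\<^esub> z \<oplus>\<^bsub>M\<^esub> y"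
    if "x \<in> ?W (insert z Z) n" for x n
  proof -
    interpret I: ideal "ideal_pow R \<mm> n" R by (rule ideal_ideal_pow)
    let ?P = "{r \<odot>\<^bsub>M\<^esub> z | r. r \<in> ideal_pow R \<mm> n}"
    have P: "submodule ?P R M"
    proof (rule M.submoduleI)
      show "\<zero>\<^bsub>M\<^esub> \<in> ?P" using z by (auto intro!: exI[of _ \<zero>])
      show "x \<oplus>\<^bsub>M\<^esub> y \<in> ?P" if "x \<in> ?P" "y \<in> ?P" for x y
      proof -
        obtain r s where "r \<in> ideal_pow R \<mm> n" "s \<in> ideal_pow R \<mm> n" "x = r \<odot>\<^bsub>M\<^esub> z" "y = s \<odot>\<^bsub>M\<^esub> z"
          using \<open>x \<in> ?P\<close> \<open>y \<in> ?P\<close> by blast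
        then show ?thesis using z by (auto intro!: exI[of _ "r \<oplus> s"] simp: M.smult_l_distr)
      qed
      show "a \<odot>\<^bsub>M\<^esub> x \<in> ?P" if "a \<in> carrier R" "x \<in> ?P" for a x
      proof -
        obtain r where "r \<in> ideal_pow R \<mm> n" "x = r \<odot>\<^bsub>M\<^esub> z" using \<open>x \<in> ?P\<close> by blast
        then show ?thesis
          using z that(1) by (auto intro!: exI[of _ "a \<otimes> r"] I.I_l_closed simp: M.smult_assoc)
      qed
    qed (use z in auto)
    have "?W (insert z Z) n \<subseteq> ?P <+>\<^bsub>M\<^esub> ?W Z n"
    proof (rule mod_span_minimal[OF M.submodule_set_add[OF P W]])
      have "r \<odot>\<^bsub>M\<^esub> w \<in> ?W Z n" if "r \<in> ideal_pow R \<mm> n" "w \<in> Z" for r w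
        by (rule subsetD[OF mod_span_superset]) (use that in blast)
      then have "{r \<odot>\<^bsub>M\<^esub> w | r w. r \<in> ideal_pow R \<mm> n \<and> w \<in> insert z Z} \<subseteq> ?P \<union> ?W Z n" by blast
      then show "{r \<odot>\<^bsub>M\<^esub> w | r w. r \<in> ideal_pow R \<mm> n \<and> w \<in> insert z Z} \<subseteq> ?P <+>\<^bsub>M\<^esub> ?W Z n"
        using M.subset_set_add[OF P W] by (meson Un_least subset_trans)
    qed
    then have "x \<in> ?P <+>\<^bsub>M\<^esub> ?W Z n" using that by blast
    then show ?thesis by (auto elim!: M.set_add_memE)
  qed
  have "\<exists>p. fst p \<in> ideal_pow R \<mm> n \<and> snd p \<in> ?W Z n \<and> c (Suc n) \<ominus>\<^bsub>M\<^esub> c n = fst p \<odot>\<^bsub>M\<^esub> z \<oplus>\<^bsub>M\<^esub> snd p" for n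
  proof -
    obtain r y where "r \<in> ideal_pow R \<mm> n" "y \<in> ?W Z n" "c (Suc n) \<ominus>\<^bsub>M\<^esub> c n = r \<odot>\<^bsub>M\<^esub> z \<oplus>\<^bsub>M\<^esub> y"
      using split[OF insert.prems(3)[of n]] by (elim bexE)
    then show ?thesis by (intro exI[of _ "(r, y)"]) simp
  qed
  then have "\<forall>n. \<exists>p. fst p \<in> ideal_pow R \<mm> n \<and> snd p \<in> ?W Z n \<and>
      c (Suc n) \<ominus>\<^bsub>M\<^esub> c n = fst p \<odot>\<^bsub>M\<^esub> z \<oplus>\<^bsub>M\<^esub> snd p" ..
  from choice[OF this] obtain p where p: "\<forall>n. fst (p n) \<in> ideal_pow R \<mm> n \<and> snd (p n) \<in> ?W Z n \<and>
      c (Suc n) \<ominus>\<^bsub>M\<^esub> c n = fst (p n) \<odot>\<^bsub>M\<^esub> z \<oplus>\<^bsub>M\<^esub> snd (p n)" ..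
  define r where "r n = fst (p n)" for n
  define y where "y n = snd (p n)" for n
  have ry: "r n \<in> ideal_pow R \<mm> n" "y n \<in> ?W Z n"
      "c (Suc n) \<ominus>\<^bsub>M\<^esub> c n = r n \<odot>\<^bsub>M\<^esub> z \<oplus>\<^bsub>M\<^esub> y n" for n
    using p unfolding r_def y_def by simp_all
  have rc: "r n \<in> carrier R" for n using ry(1) ideal_pow_subset by blast
  have yc: "y n \<in> carrier M" for n using submodule_in_carrier[OF W ry(2)] .
  \<comment> \<open>Partial sums of the chosen coefficients of \<open>z\<close>. They are Cauchy
    because the n-th summand lies in \<mm>^n.\<close>
  define \<rho> where "\<rho> = rec_nat \<zero> (\<lambda>n v. v \<oplus> r n)"
  have \<rho>_Suc: "\<rho> (Suc n) = \<rho> n \<oplus> r n" for n unfolding \<rho>_def by simp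
  have \<rho>c: "\<rho> n \<in> carrier R" for n by (induction n) (simp_all add: \<rho>_def rc)
  have diff: "\<rho> (n + k) \<ominus> \<rho> n \<in> ideal_pow R \<mm> n" for n k
  proof (induction k)
    interpret I: ideal "ideal_pow R \<mm> n" R by (rule ideal_ideal_pow)
    case 0
    show ?case using \<rho>c by (simp add: minus_eq r_neg)
    case (Suc k)
    have "\<rho> (n + Suc k) \<ominus> \<rho> n = (\<rho> (n + k) \<ominus> \<rho> n) \<oplus> r (n + k)"
      using \<rho>c rc by (simp add: \<rho>_Suc minus_eq a_ac)
    moreover have "r (n + k) \<in> ideal_pow R \<mm> n"
      using ry(1)[of "n + k"] ideal_pow_mono[of n "n + k"] by auto
    ultimately show ?case using Suc by simp
  qed
  have cauchy: "\<forall>k. \<exists>N. \<forall>i\<ge>N. \<forall>j\<ge>N. \<rho> i \<ominus> \<rho> j \<in> ideal_pow R \<mm> k"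
  proof (intro allI exI[of _ "k" for k] impI)
    fix k i j :: nat assume ij: "k \<le> i" "k \<le> j"
    interpret I: ideal "ideal_pow R \<mm> k" R by (rule ideal_ideal_pow)
    have "\<rho> i \<ominus> \<rho> k \<in> ideal_pow R \<mm> k" "\<rho> j \<ominus> \<rho> k \<in> ideal_pow R \<mm> k"
      using diff[of k "i - k"] diff[of k "j - k"] ij by auto
    then have "(\<rho> i \<ominus> \<rho> k) \<ominus> (\<rho> j \<ominus> \<rho> k) \<in> ideal_pow R \<mm> k"
      by (rule I.minus_closed_ideal)
    moreover have "(\<rho> i \<ominus> \<rho> k) \<ominus> (\<rho> j \<ominus> \<rho> k) = \<rho> i \<ominus> \<rho> j"
      using \<rho>c by (intro minus_minus_cancel)
    ultimately show "\<rho> i \<ominus> \<rho> j \<in> ideal_pow R \<mm> k" by simp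
  qed
  have "\<exists>!y. y \<in> carrier R \<and> (\<forall>k. \<exists>N. \<forall>i\<ge>N. \<rho> i \<ominus> y \<in> ideal_pow R \<mm> k)"
    by (rule compl[unfolded adic_complete_def, THEN spec, THEN mp]) (intro conjI allI \<rho>c cauchy[THEN spec])
  then obtain \<rho>' where \<rho>': "\<rho>' \<in> carrier R" "\<forall>k. \<exists>N. \<forall>i\<ge>N. \<rho> i \<ominus> \<rho>' \<in> ideal_pow R \<mm> k"
    by (elim ex1E) auto
  have lim: "\<rho>' \<ominus> \<rho> n \<in> ideal_pow R \<mm> n" for n
  proof -
    interpret I: ideal "ideal_pow R \<mm> n" R by (rule ideal_ideal_pow)
    obtain N where N: "\<forall>i\<ge>N. \<rho> i \<ominus> \<rho>' \<in> ideal_pow R \<mm> n"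
      using \<rho>'(2)[THEN spec, of n] ..
    have "(\<rho> (n + N) \<ominus> \<rho> n) \<ominus> (\<rho> (n + N) \<ominus> \<rho>') \<in> ideal_pow R \<mm> n"
      by (rule I.minus_closed_ideal[OF diff]) (use N in simp)
    moreover have "(\<rho> (n + N) \<ominus> \<rho> n) \<ominus> (\<rho> (n + N) \<ominus> \<rho>') = \<rho>' \<ominus> \<rho> n"
      using \<rho>c \<rho>'(1) by (intro minus_minus_cancel)
    ultimately show ?thesis by simp
  qed
  \<comment> \<open>With the contribution of \<open>z\<close> removed, the n-th increment is
    \<open>y n\<close>, which lies in the span over the remaining generators.\<close>
  define c' where "c' n = c n \<ominus>\<^bsub>M\<^esub> \<rho> n \<odot>\<^bsub>M\<^esub> z" for n
  have c'c: "c' n \<in> carrier M" for n unfolding c'_def using insert.prems(2) \<rho>c z by simp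
  have "c' (Suc n) \<ominus>\<^bsub>M\<^esub> c' n = y n" for n
  proof -
    have cc: "c n \<in> carrier M" for n by (rule insert.prems(2))
    have *: "c (Suc n) = (r n \<odot>\<^bsub>M\<^esub> z \<oplus>\<^bsub>M\<^esub> y n) \<oplus>\<^bsub>M\<^esub> c n"
      using ry(3)[of n] cc[of n] cc[of "Suc n"] by (simp add: M.minus_eq M.a_assoc M.l_neg flip: ry(3))
    show ?thesis
      unfolding c'_def * \<rho>_Suc using z \<rho>c rc yc cc[of n]
      by (simp add: M.smult_l_distr M.minus_eq M.minus_add M.a_ac M.r_neg1 M.r_neg2 M.r_neg M.add_add_minus_cancel)
  qed
  then have "\<exists>v\<in>carrier M. \<forall>n. v \<ominus>\<^bsub>M\<^esub> c' n \<in> ?W Z n"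
    using insert.IH[of c', OF z(2) c'c] ry(2) by simp
  then obtain v where v: "v \<in> carrier M" "\<And>n. v \<ominus>\<^bsub>M\<^esub> c' n \<in> ?W Z n" by blast
  show ?case
  proof (intro bexI allI)
    fix n
    have "(v \<oplus>\<^bsub>M\<^esub> \<rho>' \<odot>\<^bsub>M\<^esub> z) \<ominus>\<^bsub>M\<^esub> c n = (v \<ominus>\<^bsub>M\<^esub> c' n) \<oplus>\<^bsub>M\<^esub> (\<rho>' \<ominus> \<rho> n) \<odot>\<^bsub>M\<^esub> z"
      unfolding c'_def using v(1) \<rho>'(1) \<rho>c z insert.prems(2)
      by (simp add: M.smult_l_diff M.minus_eq M.minus_add M.a_ac M.r_neg1 M.r_neg2 M.r_neg M.add_add_minus_cancel)
    moreover have "(\<rho>' \<ominus> \<rho> n) \<odot>\<^bsub>M\<^esub> z \<in> ?W (insert z Z) n"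
      by (rule subsetD[OF mod_span_superset]) (use lim in blast)
    moreover have "v \<ominus>\<^bsub>M\<^esub> c' n \<in> ?W (insert z Z) n" using v(2) WW' by blast
    ultimately show "(v \<oplus>\<^bsub>M\<^esub> \<rho>' \<odot>\<^bsub>M\<^esub> z) \<ominus>\<^bsub>M\<^esub> c n \<in> ?W (insert z Z) n"
      using submodule_add[OF W'] by simp
  qed (use v(1) \<rho>'(1) z in simp)
qed

text \<open>Translates I M into the form with generators in which completeness is proved.\<close>

lemma (in noetherian_local) smult_span_eq_mod_span:
  assumes M: "left_module R M" and Z: "Z \<subseteq> carrier M" "mod_span R M Z = carrier M"
    and S: "ideal I R"
  shows "smult_span R I M = mod_span R M {r \<odot>\<^bsub>M\<^esub> z | r z. r \<in> I \<and> z \<in> Z}" (is "_ = ?W")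
proof
  interpret M: left_module R M by fact
  interpret I: ideal I R by fact
  have W: "submodule ?W R M" by (rule M.mod_span_submodule) (use Z(1) in auto)
  have "carrier M \<subseteq> {y \<in> carrier M. \<forall>r\<in>I. r \<odot>\<^bsub>M\<^esub> y \<in> ?W}"
    unfolding Z(2)[symmetric]
  proof (rule mod_span_minimal)
    have "r \<odot>\<^bsub>M\<^esub> z \<in> ?W" if "r \<in> I" "z \<in> Z" for r z
      by (rule subsetD[OF mod_span_superset]) (use that in blast)
    then show "Z \<subseteq> {y \<in> mod_span R M Z. \<forall>r\<in>I. r \<odot>\<^bsub>M\<^esub> y \<in> ?W}"
      using Z by auto
    show "submodule {y \<in> mod_span R M Z. \<forall>r\<in>I. r \<odot>\<^bsub>M\<^esub> y \<in> ?W} R M"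
      unfolding Z(2)
    proof (rule M.submoduleI)
      fix a y assume ay: "a \<in> carrier R" "y \<in> {y \<in> carrier M. \<forall>r\<in>I. r \<odot>\<^bsub>M\<^esub> y \<in> ?W}"
      have "r \<odot>\<^bsub>M\<^esub> (a \<odot>\<^bsub>M\<^esub> y) \<in> ?W" if "r \<in> I" for r
      proof -
        have "r \<odot>\<^bsub>M\<^esub> (a \<odot>\<^bsub>M\<^esub> y) = a \<odot>\<^bsub>M\<^esub> (r \<odot>\<^bsub>M\<^esub> y)"
          using ay that by (simp add: m_comm flip: M.smult_assoc)
        then show ?thesis using ay that submodule_smult[OF W ay(1)] by simp
      qed
      then show "a \<odot>\<^bsub>M\<^esub> y \<in> {y \<in> carrier M. \<forall>r\<in>I. r \<odot>\<^bsub>M\<^esub> y \<in> ?W}" using ay by simp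
    qed (auto simp: M.smult_r_distr intro: submodule_zero[OF W] submodule_add[OF W])
  qed
  then show "smult_span R I M \<subseteq> ?W"
    by (intro smult_span_minimal[OF W]) auto
  show "?W \<subseteq> smult_span R I M"
    unfolding smult_span_def by (rule mod_span_mono) (use Z(1) in auto)
qed

context ring
begin

text \<open>One Newton step for X^2 - X at \<open>b\<close>, where \<open>d\<close> is the defect
  and \<open>t\<close> = 2 b - 1 the derivative. Since t^2 = 1 + 4 d, multiplication by
  \<open>t\<close> replaces division by it, and the new defect t^2 d^2 - 4 d^2 is quadratic in
  \<open>d\<close>.\<close>

lemma newton_idempotent:
  assumes b: "b \<in> carrier R" and d: "d = b \<otimes> b \<ominus> b" and t: "t = b \<oplus> b \<ominus> \<one>"
  shows "(b \<ominus> t \<otimes> d) \<otimes> (b \<ominus> t \<otimes> d) \<ominus> (b \<ominus> t \<otimes> d)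
    = t \<otimes> t \<otimes> (d \<otimes> d) \<ominus> (d \<oplus> d \<oplus> (d \<oplus> d)) \<otimes> d"
proof -
  have dc: "d \<in> carrier R" and tc: "t \<in> carrier R" using b d t by auto
  have db: "d \<otimes> b = b \<otimes> d" and bb: "b \<otimes> b = b \<oplus> d"
    unfolding d using b by algebra+
  have dt: "d \<otimes> t = t \<otimes> d"
    unfolding t using b dc db by (simp add: minus_eq l_distr r_distr l_minus r_minus)
  have bt: "b \<otimes> t \<oplus> t \<otimes> b = t \<otimes> t \<oplus> t"
    using b t by (algebra, simp)
  have tt: "t \<otimes> t = (d \<oplus> d \<oplus> (d \<oplus> d)) \<oplus> \<one>"
    unfolding t d using b by (algebra, simp add: a_ac)
  have "d \<otimes> (t \<otimes> d) = t \<otimes> (d \<otimes> d)" using dc tc dt by (simp flip: m_assoc)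
  then have sq: "(b \<ominus> t \<otimes> d) \<otimes> (b \<ominus> t \<otimes> d) = b \<otimes> b \<ominus> (b \<otimes> t \<oplus> t \<otimes> b) \<otimes> d \<oplus> t \<otimes> t \<otimes> (d \<otimes> d)"
    using b dc tc db
    by (simp add: minus_eq l_distr r_distr l_minus r_minus m_assoc minus_add a_ac)
  define y where "y = d \<oplus> d \<oplus> (d \<oplus> d)"
  have yc: "y \<in> carrier R" unfolding y_def using dc by simp
  show ?thesis
    unfolding sq bb bt tt y_def[symmetric] using b dc tc yc by algebra
qed

lemma minus_telescope:
  "\<lbrakk>x \<in> carrier R; y \<in> carrier R; z \<in> carrier R\<rbrakk> \<Longrightarrow> (x \<ominus> y) \<oplus> (y \<ominus> z) = x \<ominus> z"
  by algebra

lemma minus_add_cancel: "\<lbrakk>x \<in> carrier R; y \<in> carrier R\<rbrakk> \<Longrightarrow> (x \<ominus> y) \<oplus> y = x"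
  by (simp add: minus_eq a_assoc l_neg)

lemma one_minus_pow:
  assumes "a \<in> carrier R"
  shows "\<exists>s\<in>carrier R. s \<otimes> (\<one> \<ominus> a) = \<one> \<ominus> a [^] (n::nat)"
proof (induction n)
  case 0
  show ?case using assms by (intro bexI[of _ \<zero>]) (auto simp: minus_eq r_neg)
next
  case (Suc n)
  then obtain s where s: "s \<in> carrier R" "s \<otimes> (\<one> \<ominus> a) = \<one> \<ominus> a [^] n" by blast
  have "(\<one> \<oplus> s \<otimes> a) \<otimes> (\<one> \<ominus> a) = (\<one> \<ominus> a) \<oplus> (s \<otimes> (\<one> \<ominus> a)) \<otimes> a"
    using s(1) assms by (simp add: minus_eq l_distr r_distr l_minus r_minus m_assoc minus_add a_ac)
  also have "\<dots> = \<one> \<ominus> a [^] Suc n"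
    unfolding s(2) using assms
    by (simp add: minus_eq l_distr l_minus a_assoc r_neg2 r_neg1)
  finally show ?case using s(1) assms by (intro bexI[of _ "\<one> \<oplus> s \<otimes> a"]) auto
qed

end

declare ideal_pow.simps(2) [simp del]

text \<open>\<open>corner\<close> is only defined for records without further fields.\<close>

locale plain_algebra = assoc_algebra R A
  for R :: "('r, 'k) ring_scheme" (structure) and A :: "('r, 'a) module" (structure)

section \<open>The \<mm>-adic filtration of a module-finite algebra\<close>

locale finite_algebra = noetherian_local R \<mm> + A: plain_algebra R A
  for R :: "('r, 'k) ring_scheme" (structure) and \<mm> and A :: "('r, 'a) module" +
  assumes adic_complete: "adic_complete R \<mm>" and fin_gen: "fin_gen R A"
begin

lemma left_module_R: "left_module R A"
  by (intro left_module.intro left_module_axioms.intro ring_axioms A.abelian_group_axioms)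
    (simp_all add: A.smult_l_distr A.smult_r_distr A.smult_assoc1)

sublocale L: left_module R A by (rule left_module_R)

lemma noetherian_A: "noetherian_module R A"
  by (rule noetherian_if_fin_gen[OF left_module_R fin_gen])

abbreviation "K n \<equiv> smult_span R (ideal_pow R \<mm> n) A"

lemma K_submodule: "submodule (K n) R A"
  by (rule L.smult_span_submodule[OF ideal_pow_subset])

lemma K_carrier: "y \<in> K n \<Longrightarrow> y \<in> carrier A"
  by (rule submodule_in_carrier[OF K_submodule])

lemma K_mono: "n \<le> k \<Longrightarrow> K k \<subseteq> K n"
  by (rule smult_span_mono[OF ideal_pow_mono])

lemma smult_span_mult_right:
  assumes "S \<subseteq> carrier R" "y \<in> smult_span R S A" "c \<in> carrier A"
  shows "y \<otimes>\<^bsub>A\<^esub> c \<in> smult_span R S A"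
proof -
  note sub = L.smult_span_submodule[OF assms(1)]
  have "smult_span R S A \<subseteq> {y \<in> carrier A. y \<otimes>\<^bsub>A\<^esub> c \<in> smult_span R S A}"
  proof (rule smult_span_minimal)
    show "submodule {y \<in> carrier A. y \<otimes>\<^bsub>A\<^esub> c \<in> smult_span R S A} R A"
      by (rule L.submoduleI) (use assms(3) in \<open>auto simp: A.l_distr A.smult_mult_left
        intro: submodule_zero[OF sub] submodule_add[OF sub] submodule_smult[OF sub]\<close>)
    fix s x assume *: "s \<in> S" "x \<in> carrier A"
    then have "s \<in> carrier R" using assms(1) by blast
    then show "s \<odot>\<^bsub>A\<^esub> x \<in> {y \<in> carrier A. y \<otimes>\<^bsub>A\<^esub> c \<in> smult_span R S A}"
      using * assms(3) by (simp add: A.smult_mult_left smult_span_memI)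
  qed
  then show ?thesis using assms(2) by blast
qed

lemma smult_span_mult_left:
  assumes "S \<subseteq> carrier R" "y \<in> smult_span R S A" "c \<in> carrier A"
  shows "c \<otimes>\<^bsub>A\<^esub> y \<in> smult_span R S A"
proof -
  note sub = L.smult_span_submodule[OF assms(1)]
  have "smult_span R S A \<subseteq> {y \<in> carrier A. c \<otimes>\<^bsub>A\<^esub> y \<in> smult_span R S A}"
  proof (rule smult_span_minimal)
    show "submodule {y \<in> carrier A. c \<otimes>\<^bsub>A\<^esub> y \<in> smult_span R S A} R A"
      by (rule L.submoduleI) (use assms(3) in \<open>auto simp: A.r_distr A.smult_mult_right
        intro: submodule_zero[OF sub] submodule_add[OF sub] submodule_smult[OF sub]\<close>)
    fix s x assume *: "s \<in> S" "x \<in> carrier A"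
    then have "s \<in> carrier R" using assms(1) by blast
    then show "s \<odot>\<^bsub>A\<^esub> x \<in> {y \<in> carrier A. c \<otimes>\<^bsub>A\<^esub> y \<in> smult_span R S A}"
      using * assms(3) by (simp add: A.smult_mult_right smult_span_memI)
  qed
  then show ?thesis using assms(2) by blast
qed

lemmas K_mult_right = smult_span_mult_right[OF ideal_pow_subset]
lemmas K_mult_left = smult_span_mult_left[OF ideal_pow_subset]

lemma mm_smult_K:
  assumes c: "c \<in> \<mm>" and y: "y \<in> K n"
  shows "c \<odot>\<^bsub>A\<^esub> y \<in> K (Suc n)"
proof -
  have cc: "c \<in> carrier R" using c mm_subset by blast
  have "K n \<subseteq> {y \<in> carrier A. c \<odot>\<^bsub>A\<^esub> y \<in> K (Suc n)}"
  proof (rule smult_span_minimal)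
    show "submodule {y \<in> carrier A. c \<odot>\<^bsub>A\<^esub> y \<in> K (Suc n)} R A"
    proof (rule L.submoduleI)
      fix a y assume *: "a \<in> carrier R" "y \<in> {y \<in> carrier A. c \<odot>\<^bsub>A\<^esub> y \<in> K (Suc n)}"
      then have "c \<odot>\<^bsub>A\<^esub> (a \<odot>\<^bsub>A\<^esub> y) = a \<odot>\<^bsub>A\<^esub> (c \<odot>\<^bsub>A\<^esub> y)"
        using cc by (simp add: m_comm flip: L.smult_assoc)
      then show "a \<odot>\<^bsub>A\<^esub> y \<in> {y \<in> carrier A. c \<odot>\<^bsub>A\<^esub> y \<in> K (Suc n)}"
        using * submodule_smult[OF K_submodule[of "Suc n"]] by simp
    qed (use cc in \<open>auto simp: L.smult_r_distr
      intro: submodule_zero[OF K_submodule] submodule_add[OF K_submodule]\<close>)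
    fix r x assume *: "r \<in> ideal_pow R \<mm> n" "x \<in> carrier A"
    then have rc: "r \<in> carrier R" using ideal_pow_subset by blast
    have "c \<odot>\<^bsub>A\<^esub> (r \<odot>\<^bsub>A\<^esub> x) = (r \<otimes> c) \<odot>\<^bsub>A\<^esub> x"
      using cc rc * by (simp add: m_comm flip: L.smult_assoc)
    also have "\<dots> \<in> K (Suc n)"
      using * c by (intro smult_span_memI) (auto simp: ideal_pow.simps(2) intro: ideal_prod.prod)
    finally show "r \<odot>\<^bsub>A\<^esub> x \<in> {y \<in> carrier A. c \<odot>\<^bsub>A\<^esub> y \<in> K (Suc n)}" using rc * by simp
  qed
  then show ?thesis using y by blast
qed

text \<open>A product of two elements of \<mm>^(n+1) A gains at least one power of \<mm>. This
  already suffices for the Newton iterates to converge.\<close>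

lemma K_mult_K:
  assumes "d \<in> K (Suc n)" "d' \<in> K (Suc n)"
  shows "d \<otimes>\<^bsub>A\<^esub> d' \<in> K (Suc (Suc n))"
proof -
  have d'c: "d' \<in> carrier A" by (rule K_carrier[OF assms(2)])
  have "K (Suc n) \<subseteq> {d \<in> carrier A. d \<otimes>\<^bsub>A\<^esub> d' \<in> K (Suc (Suc n))}"
  proof (rule smult_span_minimal)
    show "submodule {d \<in> carrier A. d \<otimes>\<^bsub>A\<^esub> d' \<in> K (Suc (Suc n))} R A"
      by (rule L.submoduleI) (use d'c in \<open>auto simp: A.l_distr A.smult_mult_left
        intro: submodule_zero[OF K_submodule] submodule_add[OF K_submodule] submodule_smult[OF K_submodule]\<close>)
    fix r x assume *: "r \<in> ideal_pow R \<mm> (Suc n)" "x \<in> carrier A"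
    then have r: "r \<in> carrier R" "r \<in> \<mm>"
      using ideal_pow_subset ideal_pow_mono[of "Suc 0" "Suc n"] ideal_pow_1 by auto
    have "r \<odot>\<^bsub>A\<^esub> (x \<otimes>\<^bsub>A\<^esub> d') \<in> K (Suc (Suc n))"
      by (rule mm_smult_K[OF r(2) K_mult_left[OF assms(2) *(2)]])
    then show "r \<odot>\<^bsub>A\<^esub> x \<in> {d \<in> carrier A. d \<otimes>\<^bsub>A\<^esub> d' \<in> K (Suc (Suc n))}"
      using r * d'c by (simp add: A.smult_mult_left)
  qed
  then show ?thesis using assms(1) by blast
qed

text \<open>\<mm> A lies in the radical of A. Every x equals x (1 - y) + x y with x y in \<mm> A, so
  Nakayama's lemma over R gives A (1 - y) = A.\<close>

lemma one_minus_K_invertible: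
  assumes y: "y \<in> K (Suc 0)"
  shows "\<exists>t\<in>carrier A. t \<otimes>\<^bsub>A\<^esub> (\<one>\<^bsub>A\<^esub> \<ominus>\<^bsub>A\<^esub> y) = \<one>\<^bsub>A\<^esub>"
proof -
  have yc: "y \<in> carrier A" by (rule K_carrier[OF y])
  let ?u = "\<one>\<^bsub>A\<^esub> \<ominus>\<^bsub>A\<^esub> y"
  have u: "?u \<in> carrier A" using yc by simp
  let ?N = "{t \<otimes>\<^bsub>A\<^esub> ?u | t. t \<in> carrier A}"
  have "?N = carrier A"
  proof (rule nakayama_mm[OF noetherian_A _ L.submodule_carrier])
    show "submodule ?N R A"
    proof (rule L.submoduleI)
      show "\<zero>\<^bsub>A\<^esub> \<in> ?N" using u by (auto intro!: exI[of _ "\<zero>\<^bsub>A\<^esub>"])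
      show "v \<oplus>\<^bsub>A\<^esub> w \<in> ?N" if "v \<in> ?N" "w \<in> ?N" for v w
        using that u by (auto simp flip: A.l_distr)
      show "r \<odot>\<^bsub>A\<^esub> v \<in> ?N" if "r \<in> carrier R" "v \<in> ?N" for r v
        using that u by (auto simp flip: A.smult_mult_left)
    qed (use u in auto)
    show "?N \<subseteq> carrier A" using u by auto
    fix L assume L: "submodule L R A" "?N \<subseteq> L"
      "\<And>c x. \<lbrakk>c \<in> \<mm>; x \<in> carrier A\<rbrakk> \<Longrightarrow> c \<odot>\<^bsub>A\<^esub> x \<in> L"
    have KL: "K (Suc 0) \<subseteq> L"
      by (rule smult_span_minimal[OF L(1)]) (use L(3) ideal_pow_1 in blast)
    show "carrier A \<subseteq> L"
    proof
      fix x assume x: "x \<in> carrier A"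
      have "x = x \<otimes>\<^bsub>A\<^esub> ?u \<oplus>\<^bsub>A\<^esub> x \<otimes>\<^bsub>A\<^esub> y"
        using x yc by (simp add: A.minus_eq A.a_assoc A.l_neg flip: A.r_distr)
      moreover have "x \<otimes>\<^bsub>A\<^esub> ?u \<in> L" using L(2) x by blast
      moreover have "x \<otimes>\<^bsub>A\<^esub> y \<in> L" using KL K_mult_left[OF y x] by blast
      ultimately show "x \<in> L" using submodule_add[OF L(1)] by metis
    qed
  qed
  then have "\<one>\<^bsub>A\<^esub> \<in> ?N" by simp
  then obtain t where "t \<in> carrier A" "\<one>\<^bsub>A\<^esub> = t \<otimes>\<^bsub>A\<^esub> ?u" by blast
  then show ?thesis by (intro bexI[of _ t]) simp_all
qed

end

section \<open>Lifting idempotents and connected algebras\<close>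

context finite_algebra
begin

text \<open>The Newton iterates have defect in \<mm>^(n+1) A and converge by completeness. The
  defect of the limit lies in every \<mm>^n A, so it vanishes by Krull's intersection
  theorem.\<close>

lemma idempotent_lifting:
  assumes b: "b \<in> carrier A" "b \<otimes>\<^bsub>A\<^esub> b \<ominus>\<^bsub>A\<^esub> b \<in> K (Suc 0)"
  obtains c where "c \<in> carrier A" "c \<otimes>\<^bsub>A\<^esub> c = c" "c \<ominus>\<^bsub>A\<^esub> b \<in> K (Suc 0)"
proof -
  define step where "step b = b \<ominus>\<^bsub>A\<^esub> (b \<oplus>\<^bsub>A\<^esub> b \<ominus>\<^bsub>A\<^esub> \<one>\<^bsub>A\<^esub>) \<otimes>\<^bsub>A\<^esub> (b \<otimes>\<^bsub>A\<^esub> b \<ominus>\<^bsub>A\<^esub> b)" for b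
  define c where "c n = (step ^^ n) b" for n
  have c_Suc: "c (Suc n) = step (c n)" for n by (simp add: c_def)
  have cn: "c n \<in> carrier A \<and> c n \<otimes>\<^bsub>A\<^esub> c n \<ominus>\<^bsub>A\<^esub> c n \<in> K (Suc n)" for n
  proof (induction n)
    case 0
    then show ?case using b by (simp add: c_def)
  next
    case (Suc n)
    define d where "d = c n \<otimes>\<^bsub>A\<^esub> c n \<ominus>\<^bsub>A\<^esub> c n"
    define t where "t = c n \<oplus>\<^bsub>A\<^esub> c n \<ominus>\<^bsub>A\<^esub> \<one>\<^bsub>A\<^esub>"
    have cc: "c n \<in> carrier A" and d: "d \<in> K (Suc n)" using Suc unfolding d_def by auto
    have tc: "t \<in> carrier A" and dc: "d \<in> carrier A" unfolding t_def d_def using cc by auto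
    have eq: "c (Suc n) = c n \<ominus>\<^bsub>A\<^esub> t \<otimes>\<^bsub>A\<^esub> d" unfolding c_Suc step_def t_def d_def ..
    have "c (Suc n) \<otimes>\<^bsub>A\<^esub> c (Suc n) \<ominus>\<^bsub>A\<^esub> c (Suc n)
        = t \<otimes>\<^bsub>A\<^esub> t \<otimes>\<^bsub>A\<^esub> (d \<otimes>\<^bsub>A\<^esub> d) \<ominus>\<^bsub>A\<^esub> (d \<oplus>\<^bsub>A\<^esub> d \<oplus>\<^bsub>A\<^esub> (d \<oplus>\<^bsub>A\<^esub> d)) \<otimes>\<^bsub>A\<^esub> d"
      unfolding eq by (rule A.newton_idempotent[OF cc d_def t_def])
    also have "\<dots> \<in> K (Suc (Suc n))"
      using tc d by (intro submodule_minus[OF K_submodule] K_mult_left[OF K_mult_K] K_mult_K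
          submodule_add[OF K_submodule[of "Suc n"]]) auto
    finally show ?case using cc tc dc unfolding eq by simp
  qed
  have diff: "c (Suc n) \<ominus>\<^bsub>A\<^esub> c n \<in> K (Suc n)" for n
  proof -
    let ?t = "c n \<oplus>\<^bsub>A\<^esub> c n \<ominus>\<^bsub>A\<^esub> \<one>\<^bsub>A\<^esub>" and ?d = "c n \<otimes>\<^bsub>A\<^esub> c n \<ominus>\<^bsub>A\<^esub> c n"
    have cc: "c n \<in> carrier A" "?t \<in> carrier A" "?d \<in> carrier A" using cn[of n] by auto
    have "c (Suc n) \<ominus>\<^bsub>A\<^esub> c n = \<ominus>\<^bsub>A\<^esub> (?t \<otimes>\<^bsub>A\<^esub> ?d)"
      unfolding c_Suc step_def using cc
      by (simp add: A.minus_eq[of "c n" "?t \<otimes>\<^bsub>A\<^esub> ?d"] A.minus_eq[of "c n \<oplus>\<^bsub>A\<^esub> _" "c n"] A.a_ac A.r_neg1 A.r_neg2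
          A.add_add_minus_cancel del: A.minus_closed)
    also have "\<dots> \<in> K (Suc n)"
      using cn[of n] cc by (intro submodule_uminus[OF K_submodule] K_mult_left) auto
    finally show ?thesis .
  qed
  obtain Z where Z: "finite Z" "Z \<subseteq> carrier A" "mod_span R A Z = carrier A"
    using fin_gen unfolding fin_gen_def by blast
  note K_eq = smult_span_eq_mod_span[OF left_module_R Z(2,3) ideal_ideal_pow]
  have "\<exists>y\<in>carrier A. \<forall>n. y \<ominus>\<^bsub>A\<^esub> c n \<in> K n"
    unfolding K_eq
    by (rule fin_gen_complete[OF adic_complete left_module_R Z(1,2)])
      (use cn diff K_mono[of n "Suc n" for n] in \<open>auto simp flip: K_eq\<close>)
  then obtain y where y: "y \<in> carrier A" "\<And>n. y \<ominus>\<^bsub>A\<^esub> c n \<in> K n" by blast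
  have "y \<otimes>\<^bsub>A\<^esub> y \<ominus>\<^bsub>A\<^esub> y \<in> K n" for n
  proof -
    have cc: "c n \<in> carrier A" using cn by blast
    \<comment> \<open>The defect of the limit is expanded through y - c_n and the defect of c_n
      without commuting y and c_n.\<close>
    have "y \<otimes>\<^bsub>A\<^esub> y \<ominus>\<^bsub>A\<^esub> y = (y \<otimes>\<^bsub>A\<^esub> (y \<ominus>\<^bsub>A\<^esub> c n) \<oplus>\<^bsub>A\<^esub> (y \<ominus>\<^bsub>A\<^esub> c n) \<otimes>\<^bsub>A\<^esub> c n)
        \<oplus>\<^bsub>A\<^esub> ((c n \<otimes>\<^bsub>A\<^esub> c n \<ominus>\<^bsub>A\<^esub> c n) \<ominus>\<^bsub>A\<^esub> (y \<ominus>\<^bsub>A\<^esub> c n))"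
      using y(1) cc by algebra
    also have "\<dots> \<in> K n"
      using cn[of n] K_mono[of n "Suc n"]
      by (intro submodule_add[OF K_submodule] submodule_minus[OF K_submodule _ y(2)]
          K_mult_left[OF y(2) y(1)] K_mult_right[OF y(2) cc]) auto
    finally show ?thesis .
  qed
  then have "y \<otimes>\<^bsub>A\<^esub> y \<ominus>\<^bsub>A\<^esub> y = \<zero>\<^bsub>A\<^esub>" by (rule krull_intersection[OF noetherian_A])
  then have yy: "y \<otimes>\<^bsub>A\<^esub> y = y" by (rule A.eq_if_minus_eq_zero[OF A.m_closed[OF y(1) y(1)] y(1)])
  have yb: "y \<ominus>\<^bsub>A\<^esub> b \<in> K (Suc 0)"
  proof -
    have "(y \<ominus>\<^bsub>A\<^esub> c (Suc 0)) \<oplus>\<^bsub>A\<^esub> (c (Suc 0) \<ominus>\<^bsub>A\<^esub> c 0) = y \<ominus>\<^bsub>A\<^esub> b"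
      using A.minus_telescope[OF y(1) conjunct1[OF cn] conjunct1[OF cn], of "Suc 0" 0]
      unfolding c_def[of 0] by simp
    then show ?thesis using submodule_add[OF K_submodule y(2) diff[of 0]] by simp
  qed
  show ?thesis by (rule that[OF y(1) yy yb])
qed

text \<open>
  Every element \<open>a\<close> satisfies a monic polynomial over \<open>R\<close>. Modulo \<open>\<mm>\<close> its lowest
  nonvanishing coefficient is a unit, which yields \<open>a\<^sup>q \<in> a\<^sup>q\<^sup>+\<^sup>1 A\<close>.
\<close>

lemma fitting_relation:
  assumes a: "a \<in> carrier A"
  obtains q g where "g \<in> carrier A" "a \<otimes>\<^bsub>A\<^esub> g = g \<otimes>\<^bsub>A\<^esub> a"
    "a [^]\<^bsub>A\<^esub> (q::nat) \<ominus>\<^bsub>A\<^esub> a [^]\<^bsub>A\<^esub> Suc q \<otimes>\<^bsub>A\<^esub> g \<in> K (Suc 0)"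
proof -
  \<comment> \<open>\<open>pol n\<close> consists of the polynomials in \<open>a\<close> of degree
    less than n, built in Horner form so that the constant coefficient can be split off.\<close>
  define pol where "pol = rec_nat {\<zero>\<^bsub>A\<^esub>}
    (\<lambda>_ P. {r \<odot>\<^bsub>A\<^esub> \<one>\<^bsub>A\<^esub> \<oplus>\<^bsub>A\<^esub> a \<otimes>\<^bsub>A\<^esub> h | r h. r \<in> carrier R \<and> h \<in> P})"
  have pol_0: "pol 0 = {\<zero>\<^bsub>A\<^esub>}"
    and pol_Suc: "pol (Suc n) = {r \<odot>\<^bsub>A\<^esub> \<one>\<^bsub>A\<^esub> \<oplus>\<^bsub>A\<^esub> a \<otimes>\<^bsub>A\<^esub> h | r h. r \<in> carrier R \<and> h \<in> pol n}" for n
    by (simp_all add: pol_def)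
  have sub: "submodule (pol n) R A" for n
  proof (induction n)
    case 0
    show ?case unfolding pol_0 by (rule L.submodule_trivial)
  next
    case (Suc n)
    note c = submodule_in_carrier[OF Suc]
    show ?case
    proof (rule L.submoduleI)
      show "pol (Suc n) \<subseteq> carrier A" using c a by (auto simp: pol_Suc)
      have "\<zero>\<^bsub>A\<^esub> = \<zero> \<odot>\<^bsub>A\<^esub> \<one>\<^bsub>A\<^esub> \<oplus>\<^bsub>A\<^esub> a \<otimes>\<^bsub>A\<^esub> \<zero>\<^bsub>A\<^esub>" using a by simp
      then show "\<zero>\<^bsub>A\<^esub> \<in> pol (Suc n)" using submodule_zero[OF Suc] unfolding pol_Suc by blast
      fix x y assume "x \<in> pol (Suc n)" "y \<in> pol (Suc n)"
      then obtain r h s k where *: "r \<in> carrier R" "h \<in> pol n" "x = r \<odot>\<^bsub>A\<^esub> \<one>\<^bsub>A\<^esub> \<oplus>\<^bsub>A\<^esub> a \<otimes>\<^bsub>A\<^esub> h"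
          "s \<in> carrier R" "k \<in> pol n" "y = s \<odot>\<^bsub>A\<^esub> \<one>\<^bsub>A\<^esub> \<oplus>\<^bsub>A\<^esub> a \<otimes>\<^bsub>A\<^esub> k"
        by (auto simp: pol_Suc)
      have "x \<oplus>\<^bsub>A\<^esub> y = (r \<oplus> s) \<odot>\<^bsub>A\<^esub> \<one>\<^bsub>A\<^esub> \<oplus>\<^bsub>A\<^esub> a \<otimes>\<^bsub>A\<^esub> (h \<oplus>\<^bsub>A\<^esub> k)"
        unfolding * using * c a by (simp add: L.smult_l_distr A.r_distr A.a_ac)
      then show "x \<oplus>\<^bsub>A\<^esub> y \<in> pol (Suc n)"
        using * submodule_add[OF Suc *(2,5)] unfolding pol_Suc by blast
    next
      fix r x assume r: "r \<in> carrier R" and "x \<in> pol (Suc n)"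
      then obtain s h where *: "s \<in> carrier R" "h \<in> pol n" "x = s \<odot>\<^bsub>A\<^esub> \<one>\<^bsub>A\<^esub> \<oplus>\<^bsub>A\<^esub> a \<otimes>\<^bsub>A\<^esub> h"
        by (auto simp: pol_Suc)
      have "r \<odot>\<^bsub>A\<^esub> x = (r \<otimes> s) \<odot>\<^bsub>A\<^esub> \<one>\<^bsub>A\<^esub> \<oplus>\<^bsub>A\<^esub> a \<otimes>\<^bsub>A\<^esub> (r \<odot>\<^bsub>A\<^esub> h)"
        unfolding * using * c a r by (simp add: L.smult_r_distr L.smult_assoc A.smult_mult_right)
      then show "r \<odot>\<^bsub>A\<^esub> x \<in> pol (Suc n)"
        using * r submodule_smult[OF Suc r *(2)] unfolding pol_Suc by blast
    qed
  qed
  note c = submodule_in_carrier[OF sub]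
  have mono: "pol n \<subseteq> pol (Suc n)" for n
  proof (induction n)
    case 0
    show ?case using submodule_zero[OF sub[of "Suc 0"]] by (simp add: pol_0)
  next
    case (Suc n)
    then show ?case unfolding pol_Suc by blast
  qed
  have comm: "a \<otimes>\<^bsub>A\<^esub> h = h \<otimes>\<^bsub>A\<^esub> a" if "h \<in> pol n" for h n
    using that
  proof (induction n arbitrary: h)
    case 0
    then show ?case using a by (simp add: pol_0)
  next
    case (Suc n)
    then obtain s k where *: "s \<in> carrier R" "k \<in> pol n" "h = s \<odot>\<^bsub>A\<^esub> \<one>\<^bsub>A\<^esub> \<oplus>\<^bsub>A\<^esub> a \<otimes>\<^bsub>A\<^esub> k"
      by (auto simp: pol_Suc)
    have kc: "k \<in> carrier A" using c *(2) by blast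
    have "a \<otimes>\<^bsub>A\<^esub> (a \<otimes>\<^bsub>A\<^esub> k) = (a \<otimes>\<^bsub>A\<^esub> k) \<otimes>\<^bsub>A\<^esub> a"
      using A.m_assoc[OF a kc a] Suc.IH[OF *(2)] by simp
    then show ?case
      unfolding *(3) using *(1) kc a
      by (simp add: A.r_distr A.l_distr A.smult_mult_left A.smult_mult_right)
  qed
  \<comment> \<open>When the chain stops at n, the power a^n is itself a polynomial of degree less
    than n in \<open>a\<close>, which is the monic equation.\<close>
  obtain n where n: "pol (Suc n) = pol n"
    by (rule noetherian_module_chain[of R A pol, OF noetherian_A sub mono])
  have pow: "a [^]\<^bsub>A\<^esub> n \<in> pol (Suc n)" for n
  proof (induction n)
    case 0
    have "\<one>\<^bsub>A\<^esub> = \<one> \<odot>\<^bsub>A\<^esub> \<one>\<^bsub>A\<^esub> \<oplus>\<^bsub>A\<^esub> a \<otimes>\<^bsub>A\<^esub> \<zero>\<^bsub>A\<^esub>" using a by simp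
    then show ?case
      using submodule_zero[OF sub[of 0]] unfolding pol_Suc by (auto intro!: exI[of _ \<one>] exI[of _ "\<zero>\<^bsub>A\<^esub>"])
  next
    case (Suc n)
    have "a [^]\<^bsub>A\<^esub> Suc n = \<zero> \<odot>\<^bsub>A\<^esub> \<one>\<^bsub>A\<^esub> \<oplus>\<^bsub>A\<^esub> a \<otimes>\<^bsub>A\<^esub> a [^]\<^bsub>A\<^esub> n"
      using a by (simp add: A.nat_pow_comm[of a 1 n, simplified])
    then show ?case using Suc unfolding pol_Suc[of "Suc n"] by blast
  qed
  define good where "good \<longleftrightarrow> (\<exists>q g. g \<in> carrier A \<and> a \<otimes>\<^bsub>A\<^esub> g = g \<otimes>\<^bsub>A\<^esub> a \<and>
    a [^]\<^bsub>A\<^esub> (q::nat) \<ominus>\<^bsub>A\<^esub> a [^]\<^bsub>A\<^esub> Suc q \<otimes>\<^bsub>A\<^esub> g \<in> K (Suc 0))"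
  \<comment> \<open>While constant coefficients lie in \<mm> they are dropped modulo \<mm> A, and
    one factor \<open>a\<close> is moved in front. The process stops with a relation when a
    coefficient is a unit.\<close>
  have claim: "good \<or> (\<exists>h\<in>pol (n - k). a [^]\<^bsub>A\<^esub> n \<ominus>\<^bsub>A\<^esub> a [^]\<^bsub>A\<^esub> k \<otimes>\<^bsub>A\<^esub> h \<in> K (Suc 0))" if "k \<le> n" for k
    using that
  proof (induction k)
    case 0
    have "a [^]\<^bsub>A\<^esub> n \<ominus>\<^bsub>A\<^esub> a [^]\<^bsub>A\<^esub> (0::nat) \<otimes>\<^bsub>A\<^esub> a [^]\<^bsub>A\<^esub> n = \<zero>\<^bsub>A\<^esub>"
      using a by (simp add: A.minus_eq A.r_neg)
    then show ?case using pow[of n] n submodule_zero[OF K_submodule[of "Suc 0"]] by force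
  next
    case (Suc k)
    show ?case
    proof (cases good)
      case False
      then obtain h where h: "h \<in> pol (n - k)" "a [^]\<^bsub>A\<^esub> n \<ominus>\<^bsub>A\<^esub> a [^]\<^bsub>A\<^esub> k \<otimes>\<^bsub>A\<^esub> h \<in> K (Suc 0)"
        using Suc by auto
      have nk: "n - k = Suc (n - Suc k)" using Suc.prems by simp
      obtain r h' where *: "r \<in> carrier R" "h' \<in> pol (n - Suc k)" "h = r \<odot>\<^bsub>A\<^esub> \<one>\<^bsub>A\<^esub> \<oplus>\<^bsub>A\<^esub> a \<otimes>\<^bsub>A\<^esub> h'"
        using h(1) unfolding nk pol_Suc by blast
      have h'c: "h' \<in> carrier A" using c *(2) by blast
      let ?p = "a [^]\<^bsub>A\<^esub> k"
      have pc: "?p \<in> carrier A" using a by simp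
      let ?v = "a [^]\<^bsub>A\<^esub> n \<ominus>\<^bsub>A\<^esub> a [^]\<^bsub>A\<^esub> Suc k \<otimes>\<^bsub>A\<^esub> h'"
      have "?p \<otimes>\<^bsub>A\<^esub> h = r \<odot>\<^bsub>A\<^esub> ?p \<oplus>\<^bsub>A\<^esub> a [^]\<^bsub>A\<^esub> Suc k \<otimes>\<^bsub>A\<^esub> h'"
        unfolding *(3) using *(1) h'c a by (simp add: A.r_distr A.smult_mult_right A.m_assoc)
      then have v: "?v \<ominus>\<^bsub>A\<^esub> r \<odot>\<^bsub>A\<^esub> ?p \<in> K (Suc 0)"
        using h(2) *(1) h'c a pc by (simp add: A.minus_eq A.minus_add A.a_ac)
      have vc: "?v \<in> carrier A" using h'c a by simp
      show ?thesis
      proof (cases "r \<in> \<mm>")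
        case True
        have "K 0 = carrier A"
          using L.smult_span_submodule[of "carrier R"] submodule_subset
            smult_span_memI[of \<one> "carrier R" _ A R] by fastforce
        then have "r \<odot>\<^bsub>A\<^esub> ?p \<in> K (Suc 0)" using mm_smult_K[OF True, of ?p 0] pc by simp
        then have "(?v \<ominus>\<^bsub>A\<^esub> r \<odot>\<^bsub>A\<^esub> ?p) \<oplus>\<^bsub>A\<^esub> r \<odot>\<^bsub>A\<^esub> ?p \<in> K (Suc 0)"
          by (rule submodule_add[OF K_submodule v])
        then have "?v \<in> K (Suc 0)"
          using A.minus_add_cancel[OF vc L.smult_closed[OF *(1) pc]] by (simp only:)
        then show ?thesis using *(2) by blast
      next
        case False
        then have r: "r \<in> Units R" using notin_mm_Units *(1) by blast
        then have ir: "inv r \<in> carrier R" "inv r \<otimes> r = \<one>" by auto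
        \<comment> \<open>Here r a^k is congruent to a^n - a^(k+1) h', in which a^(k+1) can be
          factored out; dividing by the unit r gives the relation with exponent k.\<close>
        define g where "g = inv r \<odot>\<^bsub>A\<^esub> (a [^]\<^bsub>A\<^esub> (n - Suc k) \<ominus>\<^bsub>A\<^esub> h')"
        have gc: "g \<in> carrier A" unfolding g_def using ir h'c a by simp
        have "a \<otimes>\<^bsub>A\<^esub> (a [^]\<^bsub>A\<^esub> (n - Suc k) \<ominus>\<^bsub>A\<^esub> h') = (a [^]\<^bsub>A\<^esub> (n - Suc k) \<ominus>\<^bsub>A\<^esub> h') \<otimes>\<^bsub>A\<^esub> a"
          using a h'c comm[OF *(2)] A.nat_pow_comm[of a 1 "n - Suc k"]
          by (simp add: A.minus_eq A.r_distr A.l_distr A.l_minus A.r_minus)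
        then have ag: "a \<otimes>\<^bsub>A\<^esub> g = g \<otimes>\<^bsub>A\<^esub> a"
          unfolding g_def using ir a h'c by (simp add: A.smult_mult_left A.smult_mult_right)
        have "a [^]\<^bsub>A\<^esub> n = a [^]\<^bsub>A\<^esub> Suc k \<otimes>\<^bsub>A\<^esub> a [^]\<^bsub>A\<^esub> (n - Suc k)"
          using A.nat_pow_mult[OF a, of "Suc k" "n - Suc k"] Suc.prems by (simp del: A.nat_pow_Suc)
        then have "?v = a [^]\<^bsub>A\<^esub> Suc k \<otimes>\<^bsub>A\<^esub> (a [^]\<^bsub>A\<^esub> (n - Suc k) \<ominus>\<^bsub>A\<^esub> h')"
          using a h'c by (simp add: A.minus_eq A.r_distr A.r_minus del: A.nat_pow_Suc)
        then have "inv r \<odot>\<^bsub>A\<^esub> ?v = a [^]\<^bsub>A\<^esub> Suc k \<otimes>\<^bsub>A\<^esub> g"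
          unfolding g_def using ir a h'c by (simp add: A.smult_mult_right del: A.nat_pow_Suc)
        moreover have "inv r \<odot>\<^bsub>A\<^esub> (r \<odot>\<^bsub>A\<^esub> ?p) = ?p"
          using ir *(1) pc by (simp flip: L.smult_assoc)
        ultimately have "inv r \<odot>\<^bsub>A\<^esub> (?v \<ominus>\<^bsub>A\<^esub> r \<odot>\<^bsub>A\<^esub> ?p) = a [^]\<^bsub>A\<^esub> Suc k \<otimes>\<^bsub>A\<^esub> g \<ominus>\<^bsub>A\<^esub> ?p"
          using ir *(1) pc vc by (simp add: L.smult_r_diff)
        then have "a [^]\<^bsub>A\<^esub> Suc k \<otimes>\<^bsub>A\<^esub> g \<ominus>\<^bsub>A\<^esub> ?p \<in> K (Suc 0)"
          using submodule_smult[OF K_submodule ir(1) v] by simp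
        then have "\<ominus>\<^bsub>A\<^esub> (a [^]\<^bsub>A\<^esub> Suc k \<otimes>\<^bsub>A\<^esub> g \<ominus>\<^bsub>A\<^esub> ?p) \<in> K (Suc 0)"
          by (rule submodule_uminus[OF K_submodule])
        moreover have "\<ominus>\<^bsub>A\<^esub> (a [^]\<^bsub>A\<^esub> Suc k \<otimes>\<^bsub>A\<^esub> g \<ominus>\<^bsub>A\<^esub> ?p) = ?p \<ominus>\<^bsub>A\<^esub> a [^]\<^bsub>A\<^esub> Suc k \<otimes>\<^bsub>A\<^esub> g"
          using gc a pc by (simp add: A.minus_eq A.minus_add A.a_ac)
        ultimately have good unfolding good_def using gc ag by auto
        then show ?thesis ..
      qed
    qed simp
  qed
  \<comment> \<open>If every coefficient was in \<mm>, the remaining polynomial is 0 and a^n lies in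
    \<mm> A, so that 0 serves as g.\<close>
  have good
  proof (rule ccontr)
    assume "\<not> good"
    then obtain h where "h \<in> pol 0" "a [^]\<^bsub>A\<^esub> n \<ominus>\<^bsub>A\<^esub> a [^]\<^bsub>A\<^esub> n \<otimes>\<^bsub>A\<^esub> h \<in> K (Suc 0)"
      using claim[of n] by auto
    then have "a [^]\<^bsub>A\<^esub> n \<ominus>\<^bsub>A\<^esub> a [^]\<^bsub>A\<^esub> Suc n \<otimes>\<^bsub>A\<^esub> \<zero>\<^bsub>A\<^esub> \<in> K (Suc 0)"
      using a by (simp add: pol_0)
    then have good
      unfolding good_def using a by (intro exI[of _ n] exI[of _ "\<zero>\<^bsub>A\<^esub>"] conjI) simp_all
    with \<open>\<not> good\<close> show False ..
  qed
  then show ?thesis using that unfolding good_def by blast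
qed

end

context finite_algebra
begin

text \<open>
  In the notation of the relation above, \<open>b = (a g)\<^sup>q\<^sup>+\<^sup>1\<close> is idempotent modulo \<open>\<mm>\<close>. If its lift is \<open>1\<close>
  then \<open>a\<close> is invertible; if it is \<open>0\<close> then a power of \<open>a\<close> lies in \<open>\<mm> A\<close>.
\<close>

theorem local_if_connected:
  assumes idem: "\<And>c. \<lbrakk>c \<in> carrier A; c \<otimes>\<^bsub>A\<^esub> c = c\<rbrakk> \<Longrightarrow> c = \<zero>\<^bsub>A\<^esub> \<or> c = \<one>\<^bsub>A\<^esub>"
    and a: "a \<in> carrier A"
  shows "\<exists>t\<in>carrier A. t \<otimes>\<^bsub>A\<^esub> a = \<one>\<^bsub>A\<^esub> \<or> t \<otimes>\<^bsub>A\<^esub> (\<one>\<^bsub>A\<^esub> \<ominus>\<^bsub>A\<^esub> a) = \<one>\<^bsub>A\<^esub>"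
proof -
  obtain q g where g: "g \<in> carrier A" "a \<otimes>\<^bsub>A\<^esub> g = g \<otimes>\<^bsub>A\<^esub> a"
    and q: "a [^]\<^bsub>A\<^esub> (q::nat) \<ominus>\<^bsub>A\<^esub> a [^]\<^bsub>A\<^esub> Suc q \<otimes>\<^bsub>A\<^esub> g \<in> K (Suc 0)"
    by (rule fitting_relation[OF a])
  define w where "w = a \<otimes>\<^bsub>A\<^esub> g"
  define p where "p = a [^]\<^bsub>A\<^esub> Suc q"
  have w: "w \<in> carrier A" and p: "p \<in> carrier A" unfolding w_def p_def using a g by auto
  have aw: "a \<otimes>\<^bsub>A\<^esub> w = w \<otimes>\<^bsub>A\<^esub> a" unfolding w_def using A.m_assoc[OF a g(1) a] g(2) by simp
  have "a \<otimes>\<^bsub>A\<^esub> (a [^]\<^bsub>A\<^esub> q \<ominus>\<^bsub>A\<^esub> a [^]\<^bsub>A\<^esub> Suc q \<otimes>\<^bsub>A\<^esub> g) = p \<ominus>\<^bsub>A\<^esub> p \<otimes>\<^bsub>A\<^esub> w"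
  proof -
    have "a \<otimes>\<^bsub>A\<^esub> a [^]\<^bsub>A\<^esub> q = p" unfolding p_def using a A.nat_pow_comm[of a 1 q] by simp
    moreover have "a \<otimes>\<^bsub>A\<^esub> a [^]\<^bsub>A\<^esub> Suc q = p \<otimes>\<^bsub>A\<^esub> a"
      unfolding p_def using a A.nat_pow_comm[of a 1 "Suc q"] by simp
    ultimately show ?thesis
      unfolding w_def using a g(1) p
      by (simp add: A.minus_eq A.r_distr A.r_minus del: A.nat_pow_Suc flip: A.m_assoc)
  qed
  then have pw: "p \<ominus>\<^bsub>A\<^esub> p \<otimes>\<^bsub>A\<^esub> w \<in> K (Suc 0)"
    using K_mult_left[OF q a] by simp
  \<comment> \<open>The congruence of p and p w modulo \<mm> A is iterated.\<close>
  have pwk: "p \<ominus>\<^bsub>A\<^esub> p \<otimes>\<^bsub>A\<^esub> w [^]\<^bsub>A\<^esub> k \<in> K (Suc 0)" for k :: nat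
  proof (induction k)
    case 0
    show ?case using p submodule_zero[OF K_submodule[of "Suc 0"]] by (simp add: A.minus_eq A.r_neg)
  next
    case (Suc k)
    have "p \<ominus>\<^bsub>A\<^esub> p \<otimes>\<^bsub>A\<^esub> w [^]\<^bsub>A\<^esub> Suc k
        = (p \<ominus>\<^bsub>A\<^esub> p \<otimes>\<^bsub>A\<^esub> w) \<oplus>\<^bsub>A\<^esub> (p \<ominus>\<^bsub>A\<^esub> p \<otimes>\<^bsub>A\<^esub> w [^]\<^bsub>A\<^esub> k) \<otimes>\<^bsub>A\<^esub> w"
      using p w by (simp add: A.minus_eq A.l_distr A.l_minus A.m_assoc A.a_assoc A.r_neg1 A.r_neg2)
    then show ?case
      using submodule_add[OF K_submodule pw K_mult_right[OF Suc w]] by simp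
  qed
  \<comment> \<open>The exponent q + 1 makes b a left multiple h p of p = a^(q+1). Therefore b^2 - b
    = - h (p - p b), and the iterated congruence gives idempotency modulo \<mm>.\<close>
  define b where "b = w [^]\<^bsub>A\<^esub> Suc q"
  have b: "b \<in> carrier A" unfolding b_def using w by simp
  define h where "h = g [^]\<^bsub>A\<^esub> Suc q"
  have h: "h \<in> carrier A" unfolding h_def using g(1) by simp
  have b_eq: "b = h \<otimes>\<^bsub>A\<^esub> p"
    unfolding b_def p_def h_def w_def g(2) using A.pow_mult_distrib[OF g(2)[symmetric] g(1) a] by blast
  have pb: "p \<ominus>\<^bsub>A\<^esub> p \<otimes>\<^bsub>A\<^esub> b \<in> K (Suc 0)" unfolding b_def by (rule pwk)
  have "b \<otimes>\<^bsub>A\<^esub> b \<ominus>\<^bsub>A\<^esub> b = \<ominus>\<^bsub>A\<^esub> (h \<otimes>\<^bsub>A\<^esub> (p \<ominus>\<^bsub>A\<^esub> p \<otimes>\<^bsub>A\<^esub> b))"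
  proof -
    have "h \<otimes>\<^bsub>A\<^esub> (p \<ominus>\<^bsub>A\<^esub> p \<otimes>\<^bsub>A\<^esub> b) = b \<ominus>\<^bsub>A\<^esub> b \<otimes>\<^bsub>A\<^esub> b"
      using p b h by (simp add: A.minus_eq A.r_distr A.r_minus b_eq[symmetric] flip: A.m_assoc)
    then show ?thesis using b by (simp add: A.minus_eq A.minus_add A.a_comm)
  qed
  also have "\<dots> \<in> K (Suc 0)"
    by (rule submodule_uminus[OF K_submodule]) (rule K_mult_left[OF pb h])
  finally obtain c where c: "c \<in> carrier A" "c \<otimes>\<^bsub>A\<^esub> c = c" "c \<ominus>\<^bsub>A\<^esub> b \<in> K (Suc 0)"
    by (rule idempotent_lifting[OF b])
  from idem[OF c(1,2)] show ?thesis
  proof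
    assume "c = \<zero>\<^bsub>A\<^esub>"
    then have "\<ominus>\<^bsub>A\<^esub> b \<in> K (Suc 0)" using c(3) b by (simp add: A.minus_eq)
    then have "b \<in> K (Suc 0)" using submodule_uminus[OF K_submodule] b by fastforce
    then have "p \<otimes>\<^bsub>A\<^esub> b \<in> K (Suc 0)" using K_mult_left p by blast
    then have "(p \<ominus>\<^bsub>A\<^esub> p \<otimes>\<^bsub>A\<^esub> b) \<oplus>\<^bsub>A\<^esub> p \<otimes>\<^bsub>A\<^esub> b \<in> K (Suc 0)"
      by (rule submodule_add[OF K_submodule pb])
    then have "p \<in> K (Suc 0)" using p b by (simp add: A.minus_eq A.a_assoc A.l_neg)
    then obtain t where t: "t \<in> carrier A" "t \<otimes>\<^bsub>A\<^esub> (\<one>\<^bsub>A\<^esub> \<ominus>\<^bsub>A\<^esub> p) = \<one>\<^bsub>A\<^esub>"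
      using one_minus_K_invertible by blast
    obtain s where s: "s \<in> carrier A" "s \<otimes>\<^bsub>A\<^esub> (\<one>\<^bsub>A\<^esub> \<ominus>\<^bsub>A\<^esub> a) = \<one>\<^bsub>A\<^esub> \<ominus>\<^bsub>A\<^esub> p"
      using A.one_minus_pow[OF a] unfolding p_def by blast
    have "(t \<otimes>\<^bsub>A\<^esub> s) \<otimes>\<^bsub>A\<^esub> (\<one>\<^bsub>A\<^esub> \<ominus>\<^bsub>A\<^esub> a) = \<one>\<^bsub>A\<^esub>"
      using t s a by (simp add: A.m_assoc)
    then show ?thesis using t s by blast
  next
    assume "c = \<one>\<^bsub>A\<^esub>"
    then obtain t where t: "t \<in> carrier A" "t \<otimes>\<^bsub>A\<^esub> (\<one>\<^bsub>A\<^esub> \<ominus>\<^bsub>A\<^esub> (\<one>\<^bsub>A\<^esub> \<ominus>\<^bsub>A\<^esub> b)) = \<one>\<^bsub>A\<^esub>"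
      using one_minus_K_invertible c(3) by blast
    have "\<one>\<^bsub>A\<^esub> \<ominus>\<^bsub>A\<^esub> (\<one>\<^bsub>A\<^esub> \<ominus>\<^bsub>A\<^esub> b) = b"
      using b by (simp add: A.minus_eq A.minus_add A.r_neg2)
    then have tb: "t \<otimes>\<^bsub>A\<^esub> b = \<one>\<^bsub>A\<^esub>" using t(2) by simp
    have "b = (w [^]\<^bsub>A\<^esub> q \<otimes>\<^bsub>A\<^esub> g) \<otimes>\<^bsub>A\<^esub> a"
      unfolding b_def using w g a by (simp add: A.m_assoc w_def)
    then have "(t \<otimes>\<^bsub>A\<^esub> (w [^]\<^bsub>A\<^esub> q \<otimes>\<^bsub>A\<^esub> g)) \<otimes>\<^bsub>A\<^esub> a = \<one>\<^bsub>A\<^esub>"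
      using tb t(1) w g(1) a by (simp add: A.m_assoc)
    then show ?thesis using t(1) w g(1) by blast
  qed
qed

end

section \<open>Corner algebras\<close>

lemma corner_simps [simp]:
  "carrier (corner A e) = {e \<otimes>\<^bsub>A\<^esub> a \<otimes>\<^bsub>A\<^esub> e | a. a \<in> carrier A}"
  "monoid.mult (corner A e) = monoid.mult A" "monoid.one (corner A e) = e"
  "ring.zero (corner A e) = ring.zero A" "ring.add (corner A e) = ring.add A"
  "smult (corner A e) = smult A"
  by (simp_all add: corner_def)

text \<open>The submodule enters as a separate record \<open>M'\<close> with the same operations,
  because corner algebras are records of their own.\<close>

lemma noetherian_submodule:
  assumes M: "noetherian_module A M" and N: "submodule N A M"
    and M': "left_module A M'" "carrier M' = N" "ring.add M' = ring.add M" "ring.zero M' = ring.zero M"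
      "smult M' = smult M"
  shows "noetherian_module A M'"
proof -
  interpret M: left_module A M using M unfolding noetherian_module_def by blast
  interpret M': left_module A M' by fact
  have iff: "submodule L A M' \<longleftrightarrow> submodule L A M \<and> L \<subseteq> N" for L
  proof
    assume L: "submodule L A M'"
    show "submodule L A M \<and> L \<subseteq> N"
    proof
      show LN: "L \<subseteq> N" using submodule_subset[OF L] M'(2) by simp
      show "submodule L A M"
        using submodule_zero[OF L] submodule_add[OF L] submodule_smult[OF L] LN submodule_subset[OF N]
        by (intro M.submoduleI) (auto simp: M'(3-))
    qed
  next
    assume "submodule L A M \<and> L \<subseteq> N"
    then show "submodule L A M'"
      by (intro M'.submoduleI) (auto simp: M'(2-) intro: submodule_zero submodule_add submodule_smult)
  qed
  show ?thesis
    unfolding noetherian_module_def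
  proof (intro conjI allI impI M'(1))
    fix L assume L: "submodule L A M'"
    then obtain Z where Z: "finite Z" "Z \<subseteq> L" "mod_span A M Z = L"
      using M iff unfolding noetherian_module_def by blast
    have "L \<subseteq> mod_span A M' Z"
      unfolding Z(3)[symmetric]
    proof (rule mod_span_minimal[OF _ mod_span_superset])
      show "submodule (mod_span A M' Z) A M"
        using M'.mod_span_submodule[of Z] Z(2) submodule_subset[OF L] iff by blast
    qed
    then show "\<exists>Z. finite Z \<and> Z \<subseteq> L \<and> mod_span A M' Z = L"
      using Z(1,2) mod_span_minimal[OF L Z(2)] by blast
  qed
qed

context plain_algebra
begin

lemma corner_memI: "\<lbrakk>e \<in> carrier A; e \<otimes>\<^bsub>A\<^esub> e = e; e \<otimes>\<^bsub>A\<^esub> a = a; a \<otimes>\<^bsub>A\<^esub> e = a; a \<in> carrier A\<rbrakk> \<Longrightarrow> a \<in> carrier (corner A e)"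
  by (auto intro!: exI[of _ a])

lemma corner_memD:
  assumes "e \<in> carrier A" "e \<otimes>\<^bsub>A\<^esub> e = e" "a \<in> carrier (corner A e)"
  shows "a \<in> carrier A" "e \<otimes>\<^bsub>A\<^esub> a = a" "a \<otimes>\<^bsub>A\<^esub> e = a"
proof -
  obtain b where b: "b \<in> carrier A" "a = e \<otimes>\<^bsub>A\<^esub> b \<otimes>\<^bsub>A\<^esub> e" using assms(3) by auto
  show "a \<in> carrier A" using b assms(1) by simp
  show "a \<otimes>\<^bsub>A\<^esub> e = a" unfolding b(2) using assms(1,2) b(1) by (simp add: m_assoc)
  have "e \<otimes>\<^bsub>A\<^esub> (e \<otimes>\<^bsub>A\<^esub> (b \<otimes>\<^bsub>A\<^esub> e)) = e \<otimes>\<^bsub>A\<^esub> (b \<otimes>\<^bsub>A\<^esub> e)"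
    using assms(1,2) b(1) by (simp flip: m_assoc)
  then show "e \<otimes>\<^bsub>A\<^esub> a = a" unfolding b(2) using assms(1) b(1) by (simp add: m_assoc)
qed

lemma corner_submodule:
  assumes "e \<in> carrier A" "e \<otimes>\<^bsub>A\<^esub> e = e"
  shows "submodule (carrier (corner A e)) R A"
proof -
  have L: "left_module R A"
    by (intro left_module.intro left_module_axioms.intro R.ring_axioms abelian_group_axioms)
      (simp_all add: smult_l_distr smult_r_distr smult_assoc1)
  note D = corner_memD[OF assms] and I = corner_memI[OF assms]
  show ?thesis
  proof (rule left_module.submoduleI[OF L])
    show "carrier (corner A e) \<subseteq> carrier A" using D(1) by blast
    show "\<zero>\<^bsub>A\<^esub> \<in> carrier (corner A e)" by (rule I) (use assms in auto)
    show "x \<oplus>\<^bsub>A\<^esub> y \<in> carrier (corner A e)"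
      if "x \<in> carrier (corner A e)" "y \<in> carrier (corner A e)" for x y
      by (rule I) (use assms D[OF that(1)] D[OF that(2)] in \<open>auto simp: l_distr r_distr\<close>)
    show "r \<odot>\<^bsub>A\<^esub> x \<in> carrier (corner A e)"
      if "r \<in> carrier R" "x \<in> carrier (corner A e)" for r x
      by (rule I) (use assms that(1) D[OF that(2)] in \<open>auto simp: smult_mult_left smult_mult_right\<close>)
  qed
qed

lemma corner_algebra:
  assumes e: "e \<in> carrier A" "e \<otimes>\<^bsub>A\<^esub> e = e"
  shows "plain_algebra R (corner A e)"
proof -
  note D = corner_memD[OF e] and I = corner_memI[OF e] and S = corner_submodule[OF e]
  have ab: "abelian_group (corner A e)"
  proof (rule abelian_groupI)
    fix x y z assume x: "x \<in> carrier (corner A e)" and y: "y \<in> carrier (corner A e)"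
    show "x \<oplus>\<^bsub>corner A e\<^esub> y \<in> carrier (corner A e)"
      using submodule_add[OF S x y] by (simp only: corner_simps)
    show "x \<oplus>\<^bsub>corner A e\<^esub> y = y \<oplus>\<^bsub>corner A e\<^esub> x"
      using D(1)[OF x] D(1)[OF y] by (simp add: a_comm)
    show "\<exists>y\<in>carrier (corner A e). y \<oplus>\<^bsub>corner A e\<^esub> x = \<zero>\<^bsub>corner A e\<^esub>"
      by (rule bexI[OF _ submodule_uminus[OF S x]]) (use D(1)[OF x] in \<open>simp add: l_neg\<close>)
    assume z: "z \<in> carrier (corner A e)"
    show "(x \<oplus>\<^bsub>corner A e\<^esub> y) \<oplus>\<^bsub>corner A e\<^esub> z = x \<oplus>\<^bsub>corner A e\<^esub> (y \<oplus>\<^bsub>corner A e\<^esub> z)"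
      using D(1)[OF x] D(1)[OF y] D(1)[OF z] by (simp add: a_assoc)
  next
    show "\<zero>\<^bsub>corner A e\<^esub> \<in> carrier (corner A e)"
      using submodule_zero[OF S] by (simp only: corner_simps)
    fix x assume x: "x \<in> carrier (corner A e)"
    show "\<zero>\<^bsub>corner A e\<^esub> \<oplus>\<^bsub>corner A e\<^esub> x = x" using D(1)[OF x] by simp
  qed
  have ri: "ring (corner A e)"
  proof (rule ringI[OF ab])
    show "monoid (corner A e)"
    proof (rule monoidI)
      fix x y z assume x: "x \<in> carrier (corner A e)" and y: "y \<in> carrier (corner A e)"
      show "x \<otimes>\<^bsub>corner A e\<^esub> y \<in> carrier (corner A e)"
        using D[OF x] D[OF y] e(1) by (simp only: corner_simps(2), intro I) (simp_all add: m_assoc flip: m_assoc[of e])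
      assume z: "z \<in> carrier (corner A e)"
      show "x \<otimes>\<^bsub>corner A e\<^esub> y \<otimes>\<^bsub>corner A e\<^esub> z = x \<otimes>\<^bsub>corner A e\<^esub> (y \<otimes>\<^bsub>corner A e\<^esub> z)"
        using D(1)[OF x] D(1)[OF y] D(1)[OF z] by (simp add: m_assoc)
    next
      show "\<one>\<^bsub>corner A e\<^esub> \<in> carrier (corner A e)"
        by (simp only: corner_simps(3)) (rule I, use e in auto)
      fix x assume x: "x \<in> carrier (corner A e)"
      show "\<one>\<^bsub>corner A e\<^esub> \<otimes>\<^bsub>corner A e\<^esub> x = x" "x \<otimes>\<^bsub>corner A e\<^esub> \<one>\<^bsub>corner A e\<^esub> = x"
        using D[OF x] by simp_all
    qed
    fix x y z assume x: "x \<in> carrier (corner A e)" and y: "y \<in> carrier (corner A e)"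
      and z: "z \<in> carrier (corner A e)"
    show "(x \<oplus>\<^bsub>corner A e\<^esub> y) \<otimes>\<^bsub>corner A e\<^esub> z = x \<otimes>\<^bsub>corner A e\<^esub> z \<oplus>\<^bsub>corner A e\<^esub> y \<otimes>\<^bsub>corner A e\<^esub> z"
      "z \<otimes>\<^bsub>corner A e\<^esub> (x \<oplus>\<^bsub>corner A e\<^esub> y) = z \<otimes>\<^bsub>corner A e\<^esub> x \<oplus>\<^bsub>corner A e\<^esub> z \<otimes>\<^bsub>corner A e\<^esub> y"
      using D(1)[OF x] D(1)[OF y] D(1)[OF z] by (simp_all add: l_distr r_distr)
  qed
  show ?thesis
  proof (intro plain_algebra.intro assoc_algebra.intro assoc_algebra_axioms.intro ri moduleI ab)
    show "cring R" by (rule R.is_cring)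
    fix r x assume r: "r \<in> carrier R" and x: "x \<in> carrier (corner A e)"
    show "r \<odot>\<^bsub>corner A e\<^esub> x \<in> carrier (corner A e)"
      using submodule_smult[OF S r x] by (simp only: corner_simps)
  qed (use D(1) in \<open>simp_all only: corner_simps(2-6) smult_l_distr smult_r_distr smult_assoc1 smult_one
      smult_mult_left smult_mult_right\<close>)
qed

text \<open>Negation in the corner is described over a smaller carrier, so equality with the ambient
  difference is a fact and not a simplification.\<close>

lemma corner_minus:
  assumes e: "e \<in> carrier A" "e \<otimes>\<^bsub>A\<^esub> e = e"
    and x: "x \<in> carrier (corner A e)" and y: "y \<in> carrier (corner A e)"
  shows "x \<ominus>\<^bsub>corner A e\<^esub> y = x \<ominus>\<^bsub>A\<^esub> y"
proof -
  interpret C: plain_algebra R "corner A e" by (rule corner_algebra[OF e])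
  note D = corner_memD(1)[OF e]
  have "(x \<ominus>\<^bsub>corner A e\<^esub> y) \<oplus>\<^bsub>A\<^esub> y = x"
    using C.minus_add_cancel[OF x y] by simp
  moreover have "(z \<oplus>\<^bsub>A\<^esub> y) \<ominus>\<^bsub>A\<^esub> y = z" if "z \<in> carrier A" for z
    using that D[OF y] by (simp add: minus_eq a_assoc r_neg)
  ultimately show ?thesis using D[OF C.minus_closed[OF x y]] by metis
qed

end

text \<open>e A e is an R-submodule of the Noetherian R-module A, hence finitely generated.\<close>

lemma (in finite_algebra) corner_finite_algebra:
  assumes e: "e \<in> carrier A" "e \<otimes>\<^bsub>A\<^esub> e = e"
  shows "finite_algebra R \<mm> (corner A e)"
proof -
  interpret C: plain_algebra R "corner A e" by (rule A.corner_algebra[OF e])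
  have LC: "left_module R (corner A e)"
    by (intro left_module.intro left_module_axioms.intro ring_axioms C.abelian_group_axioms)
      (simp_all only: C.smult_closed C.smult_l_distr C.smult_r_distr C.smult_assoc1 C.smult_one)
  have "noetherian_module R (corner A e)"
    by (rule noetherian_submodule[OF noetherian_A A.corner_submodule[OF e] LC]) (simp_all del: corner_simps(1))
  then have "fin_gen R (corner A e)"
    unfolding noetherian_module_def fin_gen_def using left_module.submodule_carrier[OF LC] by blast
  then show ?thesis
    by (intro finite_algebra.intro finite_algebra_axioms.intro noetherian_local_axioms
        C.plain_algebra_axioms adic_complete)
qed

text \<open>An idempotent c of e A e splits e into the orthogonal idempotents c and e - c, so by
  primitivity only 0 and e remain and \<open>local_if_connected\<close> applies to the
  corner.\<close>

lemma (in finite_algebra) primitive_idempotent_local: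
  assumes e: "primitive_idempotent A e"
    and a: "a \<in> carrier A" "e \<otimes>\<^bsub>A\<^esub> a = a" "a \<otimes>\<^bsub>A\<^esub> e = a"
  shows "\<exists>t\<in>carrier A. t \<otimes>\<^bsub>A\<^esub> a = e \<or> t \<otimes>\<^bsub>A\<^esub> (e \<ominus>\<^bsub>A\<^esub> a) = e"
proof -
  have e1: "e \<in> carrier A" "e \<otimes>\<^bsub>A\<^esub> e = e"
    and prim: "\<And>f g. \<lbrakk>f \<in> carrier A; g \<in> carrier A; f \<otimes>\<^bsub>A\<^esub> f = f; g \<otimes>\<^bsub>A\<^esub> g = g; f \<otimes>\<^bsub>A\<^esub> g = \<zero>\<^bsub>A\<^esub>; g \<otimes>\<^bsub>A\<^esub> f = \<zero>\<^bsub>A\<^esub>;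
      e = f \<oplus>\<^bsub>A\<^esub> g\<rbrakk> \<Longrightarrow> f = \<zero>\<^bsub>A\<^esub> \<or> g = \<zero>\<^bsub>A\<^esub>"
    using e unfolding primitive_idempotent_def by blast+
  interpret C: finite_algebra R \<mm> "corner A e" by (rule corner_finite_algebra[OF e1])
  note D = A.corner_memD[OF e1] and I = A.corner_memI[OF e1]
  have "\<exists>t\<in>carrier (corner A e). t \<otimes>\<^bsub>corner A e\<^esub> a = \<one>\<^bsub>corner A e\<^esub> \<or>
      t \<otimes>\<^bsub>corner A e\<^esub> (\<one>\<^bsub>corner A e\<^esub> \<ominus>\<^bsub>corner A e\<^esub> a) = \<one>\<^bsub>corner A e\<^esub>"
  proof (rule C.local_if_connected)
    fix c assume c: "c \<in> carrier (corner A e)" "c \<otimes>\<^bsub>corner A e\<^esub> c = c"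
    note cD = D[OF c(1)]
    have cc: "c \<otimes>\<^bsub>A\<^esub> c = c" using c(2) by simp
    let ?g = "e \<ominus>\<^bsub>A\<^esub> c"
    have "c = \<zero>\<^bsub>A\<^esub> \<or> ?g = \<zero>\<^bsub>A\<^esub>"
      using cD e1 cc
      by (intro prim) (simp_all add: A.minus_eq A.l_distr A.r_distr A.l_minus A.r_minus A.r_neg A.l_neg A.r_neg1 A.r_neg2 A.add_add_minus_cancel A.minus_add)
    then show "c = \<zero>\<^bsub>corner A e\<^esub> \<or> c = \<one>\<^bsub>corner A e\<^esub>"
      using A.eq_if_minus_eq_zero[OF e1(1) cD(1)] by auto
  next
    show "a \<in> carrier (corner A e)" by (rule I[OF a(2,3,1)])
  qed
  moreover have "\<one>\<^bsub>corner A e\<^esub> \<ominus>\<^bsub>corner A e\<^esub> a = e \<ominus>\<^bsub>A\<^esub> a"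
    using A.corner_minus[OF e1 C.A.one_closed I[OF a(2,3,1)]] by simp
  ultimately obtain t where t: "t \<in> carrier (corner A e)" "t \<otimes>\<^bsub>A\<^esub> a = e \<or> t \<otimes>\<^bsub>A\<^esub> (e \<ominus>\<^bsub>A\<^esub> a) = e"
    by (auto simp del: corner_simps(1))
  show ?thesis using t(2) by (intro bexI[OF _ D(1)[OF t(1)]])
qed

section \<open>Projective modules\<close>

lemma (in left_module) smult_finsum:
  assumes "finite Z" "a \<in> carrier A" "f \<in> Z \<rightarrow> carrier M"
  shows "a \<odot>\<^bsub>M\<^esub> (\<Oplus>\<^bsub>M\<^esub>z\<in>Z. f z) = (\<Oplus>\<^bsub>M\<^esub>z\<in>Z. a \<odot>\<^bsub>M\<^esub> f z)"
  using assms
proof (induction Z)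
  case (insert z Z)
  then show ?case by (simp add: Pi_def smult_r_distr)
qed simp

lemma (in abelian_monoid) finsum_memI:
  assumes "finite Z" "H \<subseteq> carrier G" "\<zero> \<in> H" "\<And>x y. \<lbrakk>x \<in> H; y \<in> H\<rbrakk> \<Longrightarrow> x \<oplus> y \<in> H"
    and "\<And>z. z \<in> Z \<Longrightarrow> f z \<in> H"
  shows "(\<Oplus>z\<in>Z. f z) \<in> H"
  using assms(1,5)
proof (induction Z)
  case (insert z Z)
  then have "f \<in> insert z Z \<rightarrow> carrier G" using assms(2) by blast
  then show ?case using insert assms(4) by (simp add: Pi_def)
qed (use assms(3) in simp)

text \<open>This is the dual basis lemma, phrased without sums.\<close>

theorem projective_dual_basis:
  fixes P :: "('a, 'p) module"
  assumes P: "projective A P" and Z: "finite Z" "Z \<subseteq> carrier P" "mod_span A P Z = carrier P"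
    and p: "p \<in> carrier P"
    and H: "H \<subseteq> carrier P" "\<zero>\<^bsub>P\<^esub> \<in> H" "\<And>x y. \<lbrakk>x \<in> H; y \<in> H\<rbrakk> \<Longrightarrow> x \<oplus>\<^bsub>P\<^esub> y \<in> H"
    and fz: "\<And>f z. \<lbrakk>f \<in> lin_maps A P (reg_module A); z \<in> Z\<rbrakk> \<Longrightarrow> f p \<odot>\<^bsub>P\<^esub> z \<in> H"
  shows "p \<in> H"
proof -
  interpret P: left_module A P using P unfolding projective_def by blast
  \<comment> \<open>The free module on Z, realised by functions that vanish off Z. It lives on the
    type over which the definition of \<open>projective\<close> quantifies.\<close>
  define F :: "('a, 'p \<Rightarrow> 'a) module" where
    "F = \<lparr>carrier = {u. (\<forall>z. u z \<in> carrier A) \<and> (\<forall>z. z \<notin> Z \<longrightarrow> u z = \<zero>\<^bsub>A\<^esub>)},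
      monoid.mult = (\<lambda>u v. u), monoid.one = (\<lambda>_. \<zero>\<^bsub>A\<^esub>), ring.zero = (\<lambda>_. \<zero>\<^bsub>A\<^esub>), ring.add = (\<lambda>u v z. u z \<oplus>\<^bsub>A\<^esub> v z),
      smult = (\<lambda>a u z. a \<otimes>\<^bsub>A\<^esub> u z)\<rparr>"
  have F_simps: "carrier F = {u. (\<forall>z. u z \<in> carrier A) \<and> (\<forall>z. z \<notin> Z \<longrightarrow> u z = \<zero>\<^bsub>A\<^esub>)}"
    "ring.zero F = (\<lambda>_. \<zero>\<^bsub>A\<^esub>)" "ring.add F = (\<lambda>u v z. u z \<oplus>\<^bsub>A\<^esub> v z)" "smult F = (\<lambda>a u z. a \<otimes>\<^bsub>A\<^esub> u z)"
    by (simp_all add: F_def)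
  have F: "left_module A F"
  proof (intro left_module.intro left_module_axioms.intro P.A.ring_axioms abelian_groupI)
    fix u assume "u \<in> carrier F"
    then show "\<exists>v\<in>carrier F. v \<oplus>\<^bsub>F\<^esub> u = \<zero>\<^bsub>F\<^esub>"
      by (intro bexI[of _ "\<lambda>z. \<ominus>\<^bsub>A\<^esub> u z"]) (auto simp: F_simps P.A.l_neg)
  qed (auto simp: F_simps P.A.a_assoc P.A.l_distr P.A.r_distr P.A.m_assoc intro!: ext intro: P.A.a_comm)
  define ev where "ev u = (\<Oplus>\<^bsub>P\<^esub>z\<in>Z. u z \<odot>\<^bsub>P\<^esub> z)" for u :: "'p \<Rightarrow> 'a"
  have terms: "(\<lambda>z. u z \<odot>\<^bsub>P\<^esub> z) \<in> Z \<rightarrow> carrier P" if "u \<in> carrier F" for u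
    using that Z(2) by (auto simp: F_simps)
  have ev: "ev \<in> lin_maps A F P"
  proof (rule lin_mapsI)
    fix u assume u: "u \<in> carrier F"
    show "ev u \<in> carrier P" unfolding ev_def using terms[OF u] by simp
    fix v assume v: "v \<in> carrier F"
    have "ev (u \<oplus>\<^bsub>F\<^esub> v) = (\<Oplus>\<^bsub>P\<^esub>z\<in>Z. u z \<odot>\<^bsub>P\<^esub> z \<oplus>\<^bsub>P\<^esub> v z \<odot>\<^bsub>P\<^esub> z)"
      unfolding ev_def using u v Z(2) by (intro P.M.finsum_cong') (auto simp: F_simps P.smult_l_distr)
    then show "ev (u \<oplus>\<^bsub>F\<^esub> v) = ev u \<oplus>\<^bsub>P\<^esub> ev v"
      unfolding ev_def using P.M.finsum_addf[OF terms[OF u] terms[OF v]] by simp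
  next
    fix a u assume a: "a \<in> carrier A" and u: "u \<in> carrier F"
    have "ev (a \<odot>\<^bsub>F\<^esub> u) = (\<Oplus>\<^bsub>P\<^esub>z\<in>Z. a \<odot>\<^bsub>P\<^esub> (u z \<odot>\<^bsub>P\<^esub> z))"
      unfolding ev_def using u a Z(2) by (intro P.M.finsum_cong') (auto simp: F_simps P.smult_assoc)
    then show "ev (a \<odot>\<^bsub>F\<^esub> u) = a \<odot>\<^bsub>P\<^esub> ev u"
      unfolding ev_def using P.smult_finsum[OF Z(1) a terms[OF u]] by simp
  qed
  have "Z \<subseteq> ev ` carrier F"
  proof
    fix z assume z: "z \<in> Z"
    let ?u = "\<lambda>y. if z = y then \<one>\<^bsub>A\<^esub> else \<zero>\<^bsub>A\<^esub>"
    have "ev ?u = (\<Oplus>\<^bsub>P\<^esub>y\<in>Z. if z = y then y else \<zero>\<^bsub>P\<^esub>)"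
      unfolding ev_def using Z(2) by (intro P.M.finsum_cong') auto
    also have "\<dots> = z"
      using P.M.finsum_singleton[OF z Z(1), of "\<lambda>y. y"] Z(2) by auto
    finally show "z \<in> ev ` carrier F"
      using z by (intro image_eqI[of _ _ ?u]) (auto simp: F_simps)
  qed
  then have "carrier P \<subseteq> ev ` carrier F"
    using mod_span_minimal[OF lin_maps_image_submodule[OF F P.left_module_axioms ev]] Z(3) by blast
  then have surj: "ev ` carrier F = carrier P"
    using lin_maps_closed[OF ev] by blast
  \<comment> \<open>Lifting the identity of P along \<open>ev\<close> gives a section, whose
    coordinates are the linear forms of the dual basis.\<close>
  have "(\<lambda>x. x) \<in> lin_maps A P P" by (rule lin_mapsI) auto
  then have "\<exists>h\<in>lin_maps A P F. \<forall>x\<in>carrier P. ev (h x) = x"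
    using P F P.left_module_axioms ev surj unfolding projective_def by blast
  then obtain h where h: "h \<in> lin_maps A P F" "\<And>x. x \<in> carrier P \<Longrightarrow> ev (h x) = x" by blast
  have "(\<lambda>x. h x z) \<in> lin_maps A P (reg_module A)" for z
    using lin_maps_closed[OF h(1)]
    by (intro lin_mapsI) (auto simp: F_simps lin_maps_add[OF h(1)] lin_maps_smult[OF h(1)])
  then have "h p z \<odot>\<^bsub>P\<^esub> z \<in> H" if "z \<in> Z" for z
    using fz[of "\<lambda>x. h x z" z] that by simp
  then have "ev (h p) \<in> H"
    unfolding ev_def by (intro P.M.finsum_memI[OF Z(1) H]) auto
  then show ?thesis using h(2)[OF p] by simp
qed

section \<open>The projective modules A e and the trace of a basic set\<close>

lemma left_ideal_module_simps [simp]: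
  "carrier (left_ideal_module A e) = {a \<otimes>\<^bsub>A\<^esub> e | a. a \<in> carrier A}"
  "ring.zero (left_ideal_module A e) = ring.zero A" "ring.add (left_ideal_module A e) = ring.add A"
  "smult (left_ideal_module A e) = monoid.mult A"
  by (simp_all add: left_ideal_module_def)

context plain_algebra
begin

lemma left_ideal_module:
  assumes e: "e \<in> carrier A"
  shows "left_module A (left_ideal_module A e)"
proof (intro left_module.intro left_module_axioms.intro ring_axioms abelian_groupI)
  let ?P = "left_ideal_module A e"
  have c: "x \<in> carrier A" if "x \<in> carrier ?P" for x using that e by auto
  fix x assume x: "x \<in> carrier ?P"
  then obtain a where a: "a \<in> carrier A" "x = a \<otimes>\<^bsub>A\<^esub> e" by auto
  then have "\<ominus>\<^bsub>A\<^esub> x = (\<ominus>\<^bsub>A\<^esub> a) \<otimes>\<^bsub>A\<^esub> e" using e by (simp add: l_minus)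
  then have "\<ominus>\<^bsub>A\<^esub> x \<in> carrier ?P" using a by auto
  then show "\<exists>y\<in>carrier ?P. y \<oplus>\<^bsub>?P\<^esub> x = \<zero>\<^bsub>?P\<^esub>"
    using c[OF x] by (intro bexI[of _ "\<ominus>\<^bsub>A\<^esub> x"]) (simp_all add: l_neg del: left_ideal_module_simps(1))
  fix y assume y: "y \<in> carrier ?P"
  then obtain b where b: "b \<in> carrier A" "y = b \<otimes>\<^bsub>A\<^esub> e" by auto
  have "x \<oplus>\<^bsub>A\<^esub> y = (a \<oplus>\<^bsub>A\<^esub> b) \<otimes>\<^bsub>A\<^esub> e" using a b e by (simp add: l_distr)
  then show "x \<oplus>\<^bsub>?P\<^esub> y \<in> carrier ?P" using a(1) b(1) by auto
  show "x \<oplus>\<^bsub>?P\<^esub> y = y \<oplus>\<^bsub>?P\<^esub> x" using c[OF x] c[OF y] by (simp add: a_comm)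
  fix z assume z: "z \<in> carrier ?P"
  show "(x \<oplus>\<^bsub>?P\<^esub> y) \<oplus>\<^bsub>?P\<^esub> z = x \<oplus>\<^bsub>?P\<^esub> (y \<oplus>\<^bsub>?P\<^esub> z)"
    using c[OF x] c[OF y] c[OF z] by (simp add: a_assoc)
next
  have "\<zero>\<^bsub>A\<^esub> = \<zero>\<^bsub>A\<^esub> \<otimes>\<^bsub>A\<^esub> e" using e by simp
  then show "\<zero>\<^bsub>left_ideal_module A e\<^esub> \<in> carrier (left_ideal_module A e)"
    by (simp only: left_ideal_module_simps) (blast intro: zero_closed)
next
  fix a x assume a: "a \<in> carrier A" and "x \<in> carrier (left_ideal_module A e)"
  then obtain b where b: "b \<in> carrier A" "x = b \<otimes>\<^bsub>A\<^esub> e" by auto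
  have "a \<otimes>\<^bsub>A\<^esub> x = (a \<otimes>\<^bsub>A\<^esub> b) \<otimes>\<^bsub>A\<^esub> e" using a b e by (simp add: m_assoc)
  then show "a \<odot>\<^bsub>left_ideal_module A e\<^esub> x \<in> carrier (left_ideal_module A e)" using a b(1) by auto
qed (use e in \<open>auto simp: l_distr r_distr m_assoc\<close>)

lemma left_ideal_memD:
  assumes "e \<in> carrier A" "e \<otimes>\<^bsub>A\<^esub> e = e" "x \<in> carrier (left_ideal_module A e)"
  shows "x \<in> carrier A" "x \<otimes>\<^bsub>A\<^esub> e = x"
  using assms by (auto simp: m_assoc)

lemma projective_left_ideal_module:
  assumes e: "e \<in> carrier A" "e \<otimes>\<^bsub>A\<^esub> e = e"
  shows "projective A (left_ideal_module A e)"
  unfolding projective_def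
proof (intro conjI allI impI left_ideal_module e(1))
  let ?P = "left_ideal_module A e"
  note D = left_ideal_memD[OF e]
  have eP: "e \<in> carrier ?P" using e by (auto intro!: exI[of _ e])
  fix M :: "('a, 'a \<Rightarrow> 'a) module" and N :: "('a, 'a) module" and g f
  assume *: "left_module A M \<and> left_module A N \<and> g \<in> lin_maps A M N \<and> g ` carrier M = carrier N \<and>
    f \<in> lin_maps A ?P N"
  then interpret M: left_module A M by blast
  from * have g: "g \<in> lin_maps A M N" "g ` carrier M = carrier N" and f: "f \<in> lin_maps A ?P N" by auto
  have "f e \<in> g ` carrier M" using lin_maps_closed[OF f eP] g(2) by simp
  then obtain m where m: "m \<in> carrier M" "g m = f e" by force
  show "\<exists>h\<in>lin_maps A ?P M. \<forall>x\<in>carrier ?P. g (h x) = f x"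
  proof (intro bexI ballI)
    show "(\<lambda>a. a \<odot>\<^bsub>M\<^esub> m) \<in> lin_maps A ?P M"
      using D m(1) by (intro lin_mapsI) (simp_all add: M.smult_l_distr M.smult_assoc del: left_ideal_module_simps(1))
    fix x assume x: "x \<in> carrier ?P"
    have "g (x \<odot>\<^bsub>M\<^esub> m) = x \<odot>\<^bsub>N\<^esub> f e" using lin_maps_smult[OF g(1) D(1)[OF x] m(1)] m(2) by simp
    also have "\<dots> = f (x \<otimes>\<^bsub>A\<^esub> e)" using lin_maps_smult[OF f D(1)[OF x] eP] by simp
    finally show "g (x \<odot>\<^bsub>M\<^esub> m) = f x" using D(2)[OF x] by simp
  qed
qed

text \<open>The components f and g of e along a decomposition of A e are orthogonal idempotents with
  sum e. Primitivity makes one of them 0, and then e lies in the other summand.\<close>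

lemma indecomposable_left_ideal_module:
  assumes e: "primitive_idempotent A e"
  shows "indecomposable A (left_ideal_module A e)"
  unfolding indecomposable_def
proof (intro conjI allI impI)
  let ?P = "left_ideal_module A e"
  have e1: "e \<in> carrier A" "e \<otimes>\<^bsub>A\<^esub> e = e" "e \<noteq> \<zero>\<^bsub>A\<^esub>"
    and prim: "\<And>f g. \<lbrakk>f \<in> carrier A; g \<in> carrier A; f \<otimes>\<^bsub>A\<^esub> f = f; g \<otimes>\<^bsub>A\<^esub> g = g; f \<otimes>\<^bsub>A\<^esub> g = \<zero>\<^bsub>A\<^esub>; g \<otimes>\<^bsub>A\<^esub> f = \<zero>\<^bsub>A\<^esub>;
      e = f \<oplus>\<^bsub>A\<^esub> g\<rbrakk> \<Longrightarrow> f = \<zero>\<^bsub>A\<^esub> \<or> g = \<zero>\<^bsub>A\<^esub>"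
    using e unfolding primitive_idempotent_def by blast+
  interpret P: left_module A ?P by (rule left_ideal_module[OF e1(1)])
  note D = left_ideal_memD[OF e1(1,2)]
  have eP: "e \<in> carrier ?P" using e1 by (auto intro!: exI[of _ e])
  then show "carrier ?P \<noteq> {\<zero>\<^bsub>?P\<^esub>}" using e1(3) by (auto simp del: left_ideal_module_simps(1))
  fix N1 N2
  assume "submodule N1 A ?P \<and> submodule N2 A ?P \<and> N1 <+>\<^bsub>?P\<^esub> N2 = carrier ?P \<and> N1 \<inter> N2 = {\<zero>\<^bsub>?P\<^esub>}"
  then have N: "submodule N1 A ?P" "submodule N2 A ?P" and sum: "N1 <+>\<^bsub>?P\<^esub> N2 = carrier ?P"
    and int: "N1 \<inter> N2 = {\<zero>\<^bsub>A\<^esub>}" by auto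
  obtain f g where fg: "f \<in> N1" "g \<in> N2" "e = f \<oplus>\<^bsub>A\<^esub> g"
    using eP sum P.set_add_memE[of e N1 N2] by auto
  note f = D[OF submodule_in_carrier[OF N(1) fg(1)]] and g = D[OF submodule_in_carrier[OF N(2) fg(2)]]
  have sm: "a \<otimes>\<^bsub>A\<^esub> x \<in> N1" if "a \<in> carrier A" "x \<in> N1" for a x using submodule_smult[OF N(1) that] by simp
  have sm2: "a \<otimes>\<^bsub>A\<^esub> x \<in> N2" if "a \<in> carrier A" "x \<in> N2" for a x using submodule_smult[OF N(2) that] by simp
  have mult: "x \<otimes>\<^bsub>A\<^esub> f \<ominus>\<^bsub>A\<^esub> x = \<ominus>\<^bsub>A\<^esub> (x \<otimes>\<^bsub>A\<^esub> g)" if "x \<in> carrier A" "x \<otimes>\<^bsub>A\<^esub> e = x" for x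
  proof -
    have "x = x \<otimes>\<^bsub>A\<^esub> f \<oplus>\<^bsub>A\<^esub> x \<otimes>\<^bsub>A\<^esub> g" using that f(1) g(1) fg(3) by (simp flip: r_distr)
    then have "x \<otimes>\<^bsub>A\<^esub> f \<ominus>\<^bsub>A\<^esub> x = x \<otimes>\<^bsub>A\<^esub> f \<ominus>\<^bsub>A\<^esub> (x \<otimes>\<^bsub>A\<^esub> f \<oplus>\<^bsub>A\<^esub> x \<otimes>\<^bsub>A\<^esub> g)" by simp
    also have "\<dots> = \<ominus>\<^bsub>A\<^esub> (x \<otimes>\<^bsub>A\<^esub> g)"
      using that f(1) g(1) by (simp add: minus_eq minus_add r_neg2)
    finally show ?thesis .
  qed
  have Nminus: "\<ominus>\<^bsub>A\<^esub> x \<in> N2" if "x \<in> N2" for x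
  proof -
    have xc: "x \<in> carrier A" using D(1)[OF submodule_in_carrier[OF N(2) that]] .
    have "(\<ominus>\<^bsub>A\<^esub> \<one>\<^bsub>A\<^esub>) \<otimes>\<^bsub>A\<^esub> x \<in> N2" by (rule sm2) (use that in auto)
    then show ?thesis using xc by (simp add: l_minus)
  qed
  have Nadd: "x \<ominus>\<^bsub>A\<^esub> y \<in> N1" if "x \<in> N1" "y \<in> N1" for x y
  proof -
    have yc: "y \<in> carrier A" using D(1)[OF submodule_in_carrier[OF N(1) that(2)]] .
    have "(\<ominus>\<^bsub>A\<^esub> \<one>\<^bsub>A\<^esub>) \<otimes>\<^bsub>A\<^esub> y \<in> N1" by (rule sm) (use that in auto)
    then have "\<ominus>\<^bsub>A\<^esub> y \<in> N1" using yc by (simp add: l_minus)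
    then show ?thesis using submodule_add[OF N(1) that(1)] by (simp add: minus_eq)
  qed
  \<comment> \<open>This difference is in N1 as it stands, and in N2 because it equals - f
    g.\<close>
  have "f \<otimes>\<^bsub>A\<^esub> f \<ominus>\<^bsub>A\<^esub> f \<in> N1 \<inter> N2"
    using mult[OF f] Nadd[OF sm[OF f(1) fg(1)] fg(1)] Nminus[OF sm2[OF f(1) fg(2)]] by auto
  then have ff0: "f \<otimes>\<^bsub>A\<^esub> f \<ominus>\<^bsub>A\<^esub> f = \<zero>\<^bsub>A\<^esub>" using int by blast
  have ff: "f \<otimes>\<^bsub>A\<^esub> f = f" by (rule eq_if_minus_eq_zero[OF m_closed[OF f(1) f(1)] f(1) ff0])
  have "\<ominus>\<^bsub>A\<^esub> (f \<otimes>\<^bsub>A\<^esub> g) = \<zero>\<^bsub>A\<^esub>" using mult[OF f] ff0 by simp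
  then have fg0: "f \<otimes>\<^bsub>A\<^esub> g = \<zero>\<^bsub>A\<^esub>" using minus_minus[of "f \<otimes>\<^bsub>A\<^esub> g"] f(1) g(1) by simp
  have gf: "g \<otimes>\<^bsub>A\<^esub> f \<ominus>\<^bsub>A\<^esub> \<zero>\<^bsub>A\<^esub> \<in> N1" "g \<otimes>\<^bsub>A\<^esub> f = \<ominus>\<^bsub>A\<^esub> (g \<otimes>\<^bsub>A\<^esub> g) \<oplus>\<^bsub>A\<^esub> g"
  proof -
    show "g \<otimes>\<^bsub>A\<^esub> f \<ominus>\<^bsub>A\<^esub> \<zero>\<^bsub>A\<^esub> \<in> N1" using sm[OF g(1) fg(1)] f(1) g(1) by (simp add: minus_eq)
    have "(g \<otimes>\<^bsub>A\<^esub> f \<ominus>\<^bsub>A\<^esub> g) \<oplus>\<^bsub>A\<^esub> g = g \<otimes>\<^bsub>A\<^esub> f"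
      using f(1) g(1) by (simp add: minus_eq a_assoc l_neg)
    then show "g \<otimes>\<^bsub>A\<^esub> f = \<ominus>\<^bsub>A\<^esub> (g \<otimes>\<^bsub>A\<^esub> g) \<oplus>\<^bsub>A\<^esub> g" using mult[OF g] by simp
  qed
  have "\<ominus>\<^bsub>A\<^esub> (g \<otimes>\<^bsub>A\<^esub> g) \<oplus>\<^bsub>A\<^esub> g \<in> N2"
    using submodule_add[OF N(2) Nminus[OF sm2[OF g(1) fg(2)]] fg(2)] by simp
  then have "g \<otimes>\<^bsub>A\<^esub> f \<in> N1 \<inter> N2" using gf sm[OF g(1) fg(1)] by simp
  then have gf0: "g \<otimes>\<^bsub>A\<^esub> f = \<zero>\<^bsub>A\<^esub>" using int by blast
  have "g \<otimes>\<^bsub>A\<^esub> e = g \<otimes>\<^bsub>A\<^esub> f \<oplus>\<^bsub>A\<^esub> g \<otimes>\<^bsub>A\<^esub> g" using f(1) g(1) fg(3) by (simp add: r_distr)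
  then have gg: "g \<otimes>\<^bsub>A\<^esub> g = g" using g gf0 by simp
  have all: "carrier ?P \<subseteq> N" if "submodule N A ?P" "e \<in> N" for N
  proof
    fix x assume x: "x \<in> carrier ?P"
    have "x \<otimes>\<^bsub>A\<^esub> e \<in> N" using submodule_smult[OF that(1) D(1)[OF x] that(2)] by simp
    then show "x \<in> N" using D(2)[OF x] by simp
  qed
  have "f = \<zero>\<^bsub>A\<^esub> \<or> g = \<zero>\<^bsub>A\<^esub>" by (rule prim[OF f(1) g(1) ff gg fg0 gf0 fg(3)])
  then show "N1 = {\<zero>\<^bsub>?P\<^esub>} \<or> N2 = {\<zero>\<^bsub>?P\<^esub>}"
  proof
    assume "f = \<zero>\<^bsub>A\<^esub>"
    then have "e \<in> N2" using fg g by simp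
    then have "N1 \<subseteq> N2" using all[OF N(2)] submodule_subset[OF N(1)] by blast
    then show ?thesis using int by (simp add: Int_absorb2)
  next
    assume "g = \<zero>\<^bsub>A\<^esub>"
    then have "e \<in> N1" using fg f by simp
    then have "N2 \<subseteq> N1" using all[OF N(1)] submodule_subset[OF N(2)] by blast
    then show ?thesis using int by (simp add: Int_absorb1)
  qed
qed

end

text \<open>A primitive idempotent g with A g isomorphic to A e_i lies in A e_i A. Instead of
  decomposing 1 into primitive idempotents, take an idempotent g outside T with A (1 - g) maximal.
  It is not primitive, hence g = f + h with orthogonal nonzero parts; both A (1 - f) and A (1 - h)
  are strictly larger, so f and h, and with them g, are in T.\<close>

theorem (in finite_algebra) one_in_trace_of_basic_idempotents:
  assumes basic: "basic_idempotents A l e"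
    and T: "\<zero>\<^bsub>A\<^esub> \<in> T" "\<And>x y. \<lbrakk>x \<in> T; y \<in> T\<rbrakk> \<Longrightarrow> x \<oplus>\<^bsub>A\<^esub> y \<in> T"
      "\<And>a b i. \<lbrakk>a \<in> carrier A; b \<in> carrier A; i \<in> {1..l}\<rbrakk> \<Longrightarrow> a \<otimes>\<^bsub>A\<^esub> e i \<otimes>\<^bsub>A\<^esub> b \<in> T"
  shows "\<one>\<^bsub>A\<^esub> \<in> T"
proof (rule ccontr)
  assume one: "\<one>\<^bsub>A\<^esub> \<notin> T"
  let ?idem = "\<lambda>g. g \<in> carrier A \<and> g \<otimes>\<^bsub>A\<^esub> g = g \<and> g \<notin> T"
  let ?N = "\<lambda>g. {a \<otimes>\<^bsub>A\<^esub> (\<one>\<^bsub>A\<^esub> \<ominus>\<^bsub>A\<^esub> g) | a. a \<in> carrier A}"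
  let ?F = "{?N g | g. ?idem g}"
  have sub: "submodule (?N g) R A" if g: "g \<in> carrier A" for g
  proof (rule L.submoduleI)
    let ?u = "\<one>\<^bsub>A\<^esub> \<ominus>\<^bsub>A\<^esub> g"
    have u: "?u \<in> carrier A" using g by simp
    show "?N g \<subseteq> carrier A" using u by auto
    have "\<zero>\<^bsub>A\<^esub> = \<zero>\<^bsub>A\<^esub> \<otimes>\<^bsub>A\<^esub> ?u" using u by simp
    then show "\<zero>\<^bsub>A\<^esub> \<in> ?N g" by blast
    fix x y assume "x \<in> ?N g" "y \<in> ?N g"
    then obtain a b where "a \<in> carrier A" "b \<in> carrier A" "x = a \<otimes>\<^bsub>A\<^esub> ?u" "y = b \<otimes>\<^bsub>A\<^esub> ?u" by blast
    then show "x \<oplus>\<^bsub>A\<^esub> y \<in> ?N g" using u by (auto intro!: exI[of _ "a \<oplus>\<^bsub>A\<^esub> b"] simp: A.l_distr)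
  next
    let ?u = "\<one>\<^bsub>A\<^esub> \<ominus>\<^bsub>A\<^esub> g"
    have u: "?u \<in> carrier A" using g by simp
    fix r x assume r: "r \<in> carrier R" and "x \<in> ?N g"
    then obtain a where "a \<in> carrier A" "x = a \<otimes>\<^bsub>A\<^esub> ?u" by blast
    then show "r \<odot>\<^bsub>A\<^esub> x \<in> ?N g" using u r by (auto intro!: exI[of _ "r \<odot>\<^bsub>A\<^esub> a"] simp: A.smult_mult_left)
  qed
  have "?idem \<one>\<^bsub>A\<^esub>" using one by simp
  then have "?F \<noteq> {}" by blast
  then obtain K where K: "K \<in> ?F" "\<And>N. \<lbrakk>N \<in> ?F; K \<subseteq> N\<rbrakk> \<Longrightarrow> N = K"
    using noetherian_module_maximal[OF noetherian_A, of ?F] sub by auto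
  then obtain g where g: "g \<in> carrier A" "g \<otimes>\<^bsub>A\<^esub> g = g" "g \<notin> T" and Kg: "K = ?N g" by blast
  have "\<not> primitive_idempotent A g"
  proof
    assume prim: "primitive_idempotent A g"
    let ?P = "left_ideal_module A g"
    obtain i where i: "i \<in> {1..l}" "lin_isomorphic A ?P (left_ideal_module A (e i))"
      using basic A.projective_left_ideal_module[OF g(1,2)] A.indecomposable_left_ideal_module[OF prim]
      unfolding basic_idempotents_def by blast
    let ?Q = "left_ideal_module A (e i)"
    have ei: "e i \<in> carrier A" "e i \<otimes>\<^bsub>A\<^esub> e i = e i"
      using basic i(1) unfolding basic_idempotents_def primitive_idempotent_def by blast+
    obtain f where f: "f \<in> lin_maps A ?P ?Q" "bij_betw f (carrier ?P) (carrier ?Q)"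
      using i(2) unfolding lin_isomorphic_def by blast
    have gP: "g \<in> carrier ?P" using g by (auto intro!: exI[of _ g])
    have eQ: "e i \<in> carrier ?Q" using ei by (auto intro!: exI[of _ "e i"])
    have "e i \<in> f ` carrier ?P" using eQ f(2) unfolding bij_betw_def by simp
    then obtain v where v: "v \<in> carrier ?P" "f v = e i" by force
    note vD = A.left_ideal_memD[OF g(1,2) v(1)]
    note uD = A.left_ideal_memD[OF ei lin_maps_closed[OF f(1) gP]]
    interpret P: left_module A ?P by (rule A.left_ideal_module[OF g(1)])
    have inj: "inj_on f (carrier ?P)" using f(2) unfolding bij_betw_def by blast
    \<comment> \<open>With v the preimage of e_i, the isomorphism f maps both g and f(g) v to f(g).
      Injectivity gives g = f(g) e_i v.\<close>
    have "f (f g \<otimes>\<^bsub>A\<^esub> v) = f g \<otimes>\<^bsub>A\<^esub> e i"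
      using lin_maps_smult[OF f(1) uD(1) v(1)] v(2) by simp
    also have "\<dots> = f g" by (rule uD(2))
    finally have "f g \<otimes>\<^bsub>A\<^esub> v = g"
      using inj_onD[OF inj _ _ gP] P.smult_closed[OF uD(1) v(1)] by simp
    then have "g = f g \<otimes>\<^bsub>A\<^esub> e i \<otimes>\<^bsub>A\<^esub> v" using uD(2) by simp
    then show False using T(3)[OF uD(1) vD(1) i(1)] g(3) by simp
  qed
  moreover have "g \<noteq> \<zero>\<^bsub>A\<^esub>" using g(3) T(1) by blast
  ultimately obtain f h where fh: "f \<in> carrier A" "h \<in> carrier A" "f \<otimes>\<^bsub>A\<^esub> f = f" "h \<otimes>\<^bsub>A\<^esub> h = h"
      "f \<otimes>\<^bsub>A\<^esub> h = \<zero>\<^bsub>A\<^esub>" "h \<otimes>\<^bsub>A\<^esub> f = \<zero>\<^bsub>A\<^esub>" "g = f \<oplus>\<^bsub>A\<^esub> h" "f \<noteq> \<zero>\<^bsub>A\<^esub>" "h \<noteq> \<zero>\<^bsub>A\<^esub>"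
    using g(1,2) unfolding primitive_idempotent_def by blast
  have step: "f \<in> T"
    if fh: "f \<in> carrier A" "h \<in> carrier A" "f \<otimes>\<^bsub>A\<^esub> f = f" "h \<otimes>\<^bsub>A\<^esub> h = h"
      "f \<otimes>\<^bsub>A\<^esub> h = \<zero>\<^bsub>A\<^esub>" "h \<otimes>\<^bsub>A\<^esub> f = \<zero>\<^bsub>A\<^esub>" "g = f \<oplus>\<^bsub>A\<^esub> h" "h \<noteq> \<zero>\<^bsub>A\<^esub>" for f h
  proof (rule ccontr)
    assume "f \<notin> T"
    then have F: "?N f \<in> ?F" using fh by blast
    have gf: "g \<otimes>\<^bsub>A\<^esub> f = f" and hg: "h \<otimes>\<^bsub>A\<^esub> g = h" unfolding fh(7) using fh by (simp_all add: A.l_distr A.r_distr)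
    have "a \<otimes>\<^bsub>A\<^esub> (\<one>\<^bsub>A\<^esub> \<ominus>\<^bsub>A\<^esub> g) = (a \<otimes>\<^bsub>A\<^esub> (\<one>\<^bsub>A\<^esub> \<ominus>\<^bsub>A\<^esub> g)) \<otimes>\<^bsub>A\<^esub> (\<one>\<^bsub>A\<^esub> \<ominus>\<^bsub>A\<^esub> f)" if "a \<in> carrier A" for a
      using that g(1) fh(1) gf
      by (simp add: A.m_assoc A.minus_eq A.l_distr A.r_distr A.l_minus A.r_minus A.minus_add A.a_assoc A.r_neg1 A.l_neg)
    moreover have "a \<otimes>\<^bsub>A\<^esub> (\<one>\<^bsub>A\<^esub> \<ominus>\<^bsub>A\<^esub> g) \<in> carrier A" if "a \<in> carrier A" for a using that g(1) by simp
    ultimately have "K \<subseteq> ?N f" unfolding Kg by blast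
    then have eq: "?N f = K" by (rule K(2)[OF F])
    \<comment> \<open>The element h separates the two left ideals: it lies in A (1 - f), whereas h g
      = h excludes it from A (1 - g).\<close>
    have "h = h \<otimes>\<^bsub>A\<^esub> (\<one>\<^bsub>A\<^esub> \<ominus>\<^bsub>A\<^esub> f)" using fh by (simp add: A.minus_eq A.r_distr A.r_minus)
    then have "h \<in> K" using eq fh(2) by blast
    then obtain a where a: "a \<in> carrier A" "h = a \<otimes>\<^bsub>A\<^esub> (\<one>\<^bsub>A\<^esub> \<ominus>\<^bsub>A\<^esub> g)" unfolding Kg by blast
    have "h = h \<otimes>\<^bsub>A\<^esub> g" using hg by simp
    also have "\<dots> = a \<otimes>\<^bsub>A\<^esub> ((\<one>\<^bsub>A\<^esub> \<ominus>\<^bsub>A\<^esub> g) \<otimes>\<^bsub>A\<^esub> g)" unfolding a(2) using a(1) g(1) by (simp add: A.m_assoc)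
    also have "(\<one>\<^bsub>A\<^esub> \<ominus>\<^bsub>A\<^esub> g) \<otimes>\<^bsub>A\<^esub> g = \<zero>\<^bsub>A\<^esub>" using g(1,2) by (simp add: A.minus_eq A.l_distr A.l_minus A.r_neg)
    finally show False using a(1) fh(8) by simp
  qed
  have "f \<in> T" by (rule step[of f h]) (use fh in auto)
  moreover have "h \<in> T" by (rule step[of h f]) (use fh in \<open>auto simp: A.a_comm\<close>)
  ultimately show False using T(2) fh(7) g(3) by blast
qed

section \<open>Tensor products with left ideals generated by idempotents\<close>

locale right_module = A: plain_algebra R A + M: abelian_group M
  for R :: "('r, 'k) ring_scheme" and A :: "('r, 'a) module" and M :: "('a, 'v) module" +
  assumes smult_closed: "\<lbrakk>a \<in> carrier A; v \<in> carrier M\<rbrakk> \<Longrightarrow> a \<odot>\<^bsub>M\<^esub> v \<in> carrier M"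
    and smult_l_distr: "\<lbrakk>a \<in> carrier A; b \<in> carrier A; v \<in> carrier M\<rbrakk> \<Longrightarrow>
      (a \<oplus>\<^bsub>A\<^esub> b) \<odot>\<^bsub>M\<^esub> v = a \<odot>\<^bsub>M\<^esub> v \<oplus>\<^bsub>M\<^esub> b \<odot>\<^bsub>M\<^esub> v"
    and smult_r_distr: "\<lbrakk>a \<in> carrier A; v \<in> carrier M; w \<in> carrier M\<rbrakk> \<Longrightarrow>
      a \<odot>\<^bsub>M\<^esub> (v \<oplus>\<^bsub>M\<^esub> w) = a \<odot>\<^bsub>M\<^esub> v \<oplus>\<^bsub>M\<^esub> a \<odot>\<^bsub>M\<^esub> w"
    and smult_assoc: "\<lbrakk>a \<in> carrier A; b \<in> carrier A; v \<in> carrier M\<rbrakk> \<Longrightarrow>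
      a \<odot>\<^bsub>M\<^esub> (b \<odot>\<^bsub>M\<^esub> v) = (b \<otimes>\<^bsub>A\<^esub> a) \<odot>\<^bsub>M\<^esub> v"
    and smult_one: "v \<in> carrier M \<Longrightarrow> \<one>\<^bsub>A\<^esub> \<odot>\<^bsub>M\<^esub> v = v"
begin

lemma smult_r_null: "a \<in> carrier A \<Longrightarrow> a \<odot>\<^bsub>M\<^esub> \<zero>\<^bsub>M\<^esub> = \<zero>\<^bsub>M\<^esub>"
  by (metis M.add.r_cancel_one' M.zero_closed smult_closed smult_r_distr)

end

text \<open>The submodule \<open>W\<close> varies because two cases are needed: the socle, for
  admissibility, and all of V, for comparing images inside V \<otimes> A e.\<close>

locale idempotent_tensor = right_module R A V
  for R :: "('r, 'k) ring_scheme" and A :: "('r, 'a) module" and V :: "('a, 'v) module" +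
  fixes e W
  assumes e: "e \<in> carrier A" "e \<otimes>\<^bsub>A\<^esub> e = e"
    and W: "W \<subseteq> carrier V" "\<zero>\<^bsub>V\<^esub> \<in> W" "\<And>x y. \<lbrakk>x \<in> W; y \<in> W\<rbrakk> \<Longrightarrow> x \<oplus>\<^bsub>V\<^esub> y \<in> W"
      "\<And>a x. \<lbrakk>a \<in> carrier A; x \<in> W\<rbrakk> \<Longrightarrow> a \<odot>\<^bsub>V\<^esub> x \<in> W"
begin

abbreviation "Ae \<equiv> left_ideal_module A e"
abbreviation "VW \<equiv> V\<lparr>carrier := W\<rparr>"
abbreviation "FG \<equiv> free_Abelian_group (W \<times> carrier Ae)"
abbreviation "N \<equiv> tensor_kernel A VW Ae"

lemma e_in: "e \<in> carrier Ae"
  using e by (auto intro!: exI[of _ e])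

lemma Ae_left_module: "left_module A Ae"
  by (rule A.left_ideal_module[OF e(1)])

lemma rels_subset: "tensor_rels A VW Ae \<subseteq> carrier FG"
proof -
  have "p \<oplus>\<^bsub>A\<^esub> q \<in> carrier Ae" if "p \<in> carrier Ae" "q \<in> carrier Ae" for p q
    using abelian_monoid.a_closed[OF abelian_group.axioms(1)[OF left_module.axioms(2)[OF Ae_left_module]] that]
    by (simp del: left_ideal_module_simps(1))
  moreover have "a \<otimes>\<^bsub>A\<^esub> p \<in> carrier Ae" if "a \<in> carrier A" "p \<in> carrier Ae" for a p
    using left_module.smult_closed[OF Ae_left_module that] by (simp del: left_ideal_module_simps(1))
  moreover have "Poly_Mapping.keys (frag_of x - frag_of y) \<subseteq> S" if "x \<in> S" "y \<in> S" for x y and S :: "('v \<times> 'a) set"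
    using keys_diff[of "frag_of x" "frag_of y"] that by auto
  moreover have "Poly_Mapping.keys (frag_of x - frag_of y - frag_of z) \<subseteq> S"
    if "x \<in> S" "y \<in> S" "z \<in> S" for x y z and S :: "('v \<times> 'a) set"
    using keys_diff[of "frag_of x - frag_of y" "frag_of z"] keys_diff[of "frag_of x" "frag_of y"] that by auto
  ultimately show ?thesis
    using W(3,4) unfolding tensor_rels_def
    by (auto simp del: left_ideal_module_simps(1))
qed

lemma N_subgroup: "subgroup N FG"
  unfolding tensor_kernel_def
  using group.generate_is_subgroup[OF group_free_Abelian_group rels_subset] by simp

lemma N_normal: "N \<lhd> FG"
  by (rule comm_group.subgroup_imp_normal[OF abelian_free_Abelian_group N_subgroup])

lemma N_add: "\<lbrakk>x \<in> N; y \<in> N\<rbrakk> \<Longrightarrow> x + y \<in> N"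
  using subgroup.m_closed[OF N_subgroup] by simp

lemma N_uminus: "x \<in> N \<Longrightarrow> - x \<in> N"
  using subgroup.m_inv_closed[OF N_subgroup, of x] subgroup.mem_carrier[OF N_subgroup, of x] by simp

lemma N_diff: "\<lbrakk>x \<in> N; y \<in> N\<rbrakk> \<Longrightarrow> x - y \<in> N"
  using N_add[of x "- y"] N_uminus by simp

lemma rels_N: "tensor_rels A VW Ae \<subseteq> N"
  unfolding tensor_kernel_def by (auto intro: generate.incl)

text \<open>The relation v \<otimes> a e = v a e \<otimes> e, so every pure tensor can be written
  with second factor e.\<close>

lemma tensor_reduce:
  assumes v: "v \<in> W" and a: "a \<in> carrier A"
  shows "frag_of (e \<odot>\<^bsub>V\<^esub> (a \<odot>\<^bsub>V\<^esub> v), e) - frag_of (v, a \<otimes>\<^bsub>A\<^esub> e) \<in> N"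
proof -
  have rel: "frag_of (b \<odot>\<^bsub>V\<^esub> w, p) - frag_of (w, b \<otimes>\<^bsub>A\<^esub> p) \<in> N"
    if "b \<in> carrier A" "w \<in> W" "p \<in> carrier Ae" for b w p
    by (rule subsetD[OF rels_N]) (use that in \<open>force simp: tensor_rels_def simp del: left_ideal_module_simps(1)\<close>)
  have "frag_of (e \<odot>\<^bsub>V\<^esub> (a \<odot>\<^bsub>V\<^esub> v), e) - frag_of (a \<odot>\<^bsub>V\<^esub> v, e) \<in> N"
    using rel[OF e(1) W(4)[OF a v] e_in] e by simp
  then show ?thesis using N_add[OF _ rel[OF a v e_in]] by fastforce
qed

lemma tensor_trivial:
  assumes "\<And>v. v \<in> W \<Longrightarrow> e \<odot>\<^bsub>V\<^esub> v = \<zero>\<^bsub>V\<^esub>"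
  shows "carrier (tensor A VW Ae) = {\<one>\<^bsub>tensor A VW Ae\<^esub>}"
proof -
  have "frag_of (\<zero>\<^bsub>V\<^esub> \<oplus>\<^bsub>V\<^esub> \<zero>\<^bsub>V\<^esub>, e) - frag_of (\<zero>\<^bsub>V\<^esub>, e) - frag_of (\<zero>\<^bsub>V\<^esub>, e) \<in> N"
    by (rule subsetD[OF rels_N]) (use W(2) e_in in \<open>force simp: tensor_rels_def simp del: left_ideal_module_simps(1)\<close>)
  then have "frag_of (\<zero>\<^bsub>V\<^esub>, e) \<in> N" using N_uminus by fastforce
  then have gen: "frag_of (v, a \<otimes>\<^bsub>A\<^esub> e) \<in> N" if "v \<in> W" "a \<in> carrier A" for v a
    using N_diff[OF _ tensor_reduce[OF that]] assms[OF W(4)[OF that(2,1)]] by fastforce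
  have all: "c \<in> N" if "Poly_Mapping.keys c \<subseteq> W \<times> carrier Ae" for c
    using that
  proof (induction rule: frag_induction)
    case zero
    show ?case using subgroup.one_closed[OF N_subgroup] by simp
  next
    case (one x)
    then show ?case using gen by auto
  next
    case (diff a b)
    then show ?case by (rule N_diff)
  qed
  have "r_coset FG N c = N" if "c \<in> carrier FG" for c
    using subgroup.rcos_const[OF N_subgroup group_free_Abelian_group] all that by auto
  then show ?thesis
    unfolding tensor_def using subgroup.one_closed[OF N_subgroup]
    by (auto simp: carrier_FactGroup simp del: left_ideal_module_simps(1) intro!: image_eqI[of _ _ 0])
qed

end

text \<open>The identification of V \<otimes> A e with V e, in the form needed for s_I. From right
  to left every pure tensor is rewritten with second factor e. From left to right the action v
  \<otimes> p \<mapsto> v p detects membership in W'.\<close>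

lemma (in right_module) tensor_image_subset_iff:
  assumes e: "e \<in> carrier A" "e \<otimes>\<^bsub>A\<^esub> e = e"
    and W: "W \<subseteq> carrier M" "\<And>a x. \<lbrakk>a \<in> carrier A; x \<in> W\<rbrakk> \<Longrightarrow> a \<odot>\<^bsub>M\<^esub> x \<in> W"
    and W': "subgroup W' (add_monoid M)" "\<And>a x. \<lbrakk>a \<in> carrier A; x \<in> W'\<rbrakk> \<Longrightarrow> a \<odot>\<^bsub>M\<^esub> x \<in> W'"
  shows "tensor_image A M (left_ideal_module A e) W \<subseteq> tensor_image A M (left_ideal_module A e) W' \<longleftrightarrow>
    (\<forall>v\<in>W. e \<odot>\<^bsub>M\<^esub> v \<in> W')"
proof -
  interpret T: idempotent_tensor R A M e "carrier M"
    by unfold_locales (use e smult_closed in auto)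
  let ?P = "left_ideal_module A e" and ?N = "tensor_kernel A M (left_ideal_module A e)"
  let ?F = "free_Abelian_group (carrier M \<times> carrier (left_ideal_module A e))"
  have VW: "M\<lparr>carrier := carrier M\<rparr> = M" by simp
  note T = T.N_normal T.N_subgroup T.tensor_reduce T.rels_subset T.e_in
  note T' = T[unfolded VW]
  have W'c: "W' \<subseteq> carrier M" using subgroup.subset[OF W'(1)] by simp
  have backward: "tensor_image A M ?P W \<subseteq> tensor_image A M ?P W'" if sub: "\<forall>v\<in>W. e \<odot>\<^bsub>M\<^esub> v \<in> W'"
  proof -
    have "{pure_tensor A M ?P v p | v p. v \<in> W \<and> p \<in> carrier ?P} \<subseteq>
      {pure_tensor A M ?P v p | v p. v \<in> W' \<and> p \<in> carrier ?P}"
    proof safe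
      fix v p assume v: "v \<in> W" and p: "p \<in> carrier ?P"
      then obtain a where a: "a \<in> carrier A" "p = a \<otimes>\<^bsub>A\<^esub> e" by auto
      let ?w = "e \<odot>\<^bsub>M\<^esub> (a \<odot>\<^bsub>M\<^esub> v)"
      have w: "?w \<in> W'" using sub W(2)[OF a(1) v] by blast
      have vM: "v \<in> carrier M" using v W(1) by blast
      have "pure_tensor A M ?P v p = pure_tensor A M ?P ?w e"
        unfolding pure_tensor_def
      proof (rule group.repr_independence[OF group_free_Abelian_group _ _ T'(2), symmetric])
        show "frag_of (v, p) \<in> r_coset ?F ?N (frag_of (?w, e))"
          using T.N_uminus[unfolded VW, OF T'(3)[OF vM a(1)]] a(2)
          unfolding r_coset_def by force
        show "frag_of (?w, e) \<in> carrier ?F" using w W'c T'(5) by (auto simp del: left_ideal_module_simps(1))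
      qed
      then show "\<exists>v' p'. pure_tensor A M ?P v p = pure_tensor A M ?P v' p' \<and> v' \<in> W' \<and> p' \<in> carrier ?P"
        using w T'(5) by blast
    qed
    then show ?thesis
      unfolding tensor_image_def tensor_def
      by (rule group.mono_generate[OF normal.factorgroup_is_group[OF T'(1)]])
  qed
  \<comment> \<open>The action is extended to the free abelian group. It kills the tensor relations,
    so its values depend on the cosets only.\<close>
  have "(\<lambda>(v, p). p \<odot>\<^bsub>M\<^esub> v) ` (carrier M \<times> carrier ?P) \<subseteq> carrier (add_monoid M)"
    using smult_closed e(1) by auto
  then obtain h where h: "h \<in> hom ?F (add_monoid M)"
    "\<And>x. x \<in> carrier M \<times> carrier ?P \<Longrightarrow> h (frag_of x) = (\<lambda>(v, p). p \<odot>\<^bsub>M\<^esub> v) x"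
    by (rule comm_group.free_Abelian_group_universal[OF M.a_comm_group]) blast
  interpret h: group_hom ?F "add_monoid M" h
    using h(1) M.a_group by (intro group_hom.intro group_hom_axioms.intro) auto
  have hf: "h (frag_of (v, p)) = p \<odot>\<^bsub>M\<^esub> v" if "v \<in> carrier M" "p \<in> carrier ?P" for v p
    using h(2)[of "(v, p)"] that by simp
  have hd: "h (x - y) = h x \<ominus>\<^bsub>M\<^esub> h y" if "x \<in> carrier ?F" "y \<in> carrier ?F" for x y
  proof -
    have "- y = inv\<^bsub>?F\<^esub> y" using that by simp
    then have "h (- y) = \<ominus>\<^bsub>M\<^esub> h y" using h.hom_inv[OF that(2)] by (simp add: a_inv_def)
    moreover have "- y \<in> carrier ?F" using that by simp
    ultimately show ?thesis using h.hom_mult[OF that(1), of "- y"] by (simp add: M.minus_eq)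
  qed
  have fc: "frag_of (v, p) \<in> carrier ?F" if "v \<in> carrier M" "p \<in> carrier ?P" for v p
    using that by auto
  interpret P: left_module A ?P by (rule A.left_ideal_module[OF e(1)])
  note Pc = A.left_ideal_memD(1)[OF e]
  have "tensor_rels A M ?P \<subseteq> kernel ?F (add_monoid M) h"
  proof
    fix x assume x: "x \<in> tensor_rels A M ?P"
    then have xc: "x \<in> carrier ?F" using T'(4) by blast
    have sub0: "u \<oplus>\<^bsub>M\<^esub> w \<ominus>\<^bsub>M\<^esub> u \<ominus>\<^bsub>M\<^esub> w = \<zero>\<^bsub>M\<^esub>" if "u \<in> carrier M" "w \<in> carrier M" for u w
      using that by (simp add: M.minus_eq M.a_ac M.r_neg1 M.r_neg2 M.r_neg M.add_add_minus_cancel)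
    have dc: "y - z \<in> carrier ?F" if "y \<in> carrier ?F" "z \<in> carrier ?F" for y z
      using that keys_diff[of y z] by auto
    from x consider
      v w p where "x = frag_of (v \<oplus>\<^bsub>M\<^esub> w, p) - frag_of (v, p) - frag_of (w, p)"
        "v \<in> carrier M" "w \<in> carrier M" "p \<in> carrier ?P"
      | v p q where "x = frag_of (v, p \<oplus>\<^bsub>A\<^esub> q) - frag_of (v, p) - frag_of (v, q)"
        "v \<in> carrier M" "p \<in> carrier ?P" "q \<in> carrier ?P"
      | a v p where "x = frag_of (a \<odot>\<^bsub>M\<^esub> v, p) - frag_of (v, a \<otimes>\<^bsub>A\<^esub> p)"
        "a \<in> carrier A" "v \<in> carrier M" "p \<in> carrier ?P"
      unfolding tensor_rels_def by (auto simp del: left_ideal_module_simps(1))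
    then have "h x = \<zero>\<^bsub>M\<^esub>"
    proof cases
      case 1
      then show ?thesis
        using Pc[OF 1(4)]
        by (simp add: hd dc fc hf smult_r_distr sub0 smult_closed del: left_ideal_module_simps(1) carrier_free_Abelian_group_iff)
    next
      case 2
      have pq: "p \<oplus>\<^bsub>A\<^esub> q \<in> carrier ?P" using P.M.a_closed[OF 2(3,4)] by (simp del: left_ideal_module_simps(1))
      then show ?thesis
        using 2 Pc[OF 2(3)] Pc[OF 2(4)]
        by (simp add: hd dc fc hf smult_l_distr sub0 smult_closed del: left_ideal_module_simps(1) carrier_free_Abelian_group_iff)
    next
      case 3
      have ap: "a \<otimes>\<^bsub>A\<^esub> p \<in> carrier ?P" using P.smult_closed[OF 3(2,4)] by (simp del: left_ideal_module_simps(1))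
      then show ?thesis
        using 3 Pc[OF 3(4)]
        by (simp add: hd dc fc hf smult_assoc smult_closed M.minus_eq M.r_neg del: left_ideal_module_simps(1) carrier_free_Abelian_group_iff)
    qed
    then show "x \<in> kernel ?F (add_monoid M) h" using xc by (simp add: kernel_def)
  qed
  then have ker: "?N \<subseteq> kernel ?F (add_monoid M) h"
    unfolding tensor_kernel_def by (rule group.generate_subgroup_incl[OF group_free_Abelian_group _ h.subgroup_kernel])
  \<comment> \<open>The preimage of W' under the action. Its image in the tensor product is a
    subgroup containing the image of W' \<otimes> A e.\<close>
  let ?H = "{y \<in> carrier ?F. h y \<in> W'}"
  have H: "subgroup ?H ?F"
  proof (rule subgroup.intro)
    show "x \<otimes>\<^bsub>?F\<^esub> y \<in> ?H" if "x \<in> ?H" "y \<in> ?H" for x y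
    proof -
      have "x \<otimes>\<^bsub>?F\<^esub> y \<in> carrier ?F"
        using that by (intro monoid.m_closed[OF group.is_monoid[OF group_free_Abelian_group]]) auto
      moreover have "h (x \<otimes>\<^bsub>?F\<^esub> y) \<in> W'"
        using that h.hom_mult[of x y] subgroup.m_closed[OF W'(1), of "h x" "h y"] by simp
      ultimately show ?thesis by blast
    qed
    show "\<one>\<^bsub>?F\<^esub> \<in> ?H" using h.hom_one subgroup.one_closed[OF W'(1)] by simp
    show "inv\<^bsub>?F\<^esub> x \<in> ?H" if "x \<in> ?H" for x
      using that h.hom_inv[of x] subgroup.m_inv_closed[OF W'(1), of "h x"] by simp
  qed auto
  let ?G = "?F Mod ?N"
  interpret q: group_hom ?F ?G "\<lambda>c. r_coset ?F ?N c"
    using normal.r_coset_hom_Mod[OF T'(1)] normal.factorgroup_is_group[OF T'(1)]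
    by (intro group_hom.intro group_hom_axioms.intro) auto
  have "{pure_tensor A M ?P v p | v p. v \<in> W' \<and> p \<in> carrier ?P} \<subseteq> (\<lambda>c. r_coset ?F ?N c) ` ?H"
  proof safe
    fix v p assume vp: "v \<in> W'" "p \<in> carrier ?P"
    then have "h (frag_of (v, p)) \<in> W'" using hf[of v p] W'c W'(2)[OF Pc[OF vp(2)] vp(1)] by (simp only: subset_iff)
    then show "pure_tensor A M ?P v p \<in> (\<lambda>c. r_coset ?F ?N c) ` ?H"
      unfolding pure_tensor_def using fc vp W'c by blast
  qed
  then have "tensor_image A M ?P W' \<subseteq> (\<lambda>c. r_coset ?F ?N c) ` ?H"
    unfolding tensor_image_def tensor_def
    by (rule group.generate_subgroup_incl[OF normal.factorgroup_is_group[OF T'(1)] _ q.subgroup_img_is_subgroup[OF H]])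
  note im = this
  have "e \<odot>\<^bsub>M\<^esub> v \<in> W'" if sub: "tensor_image A M ?P W \<subseteq> tensor_image A M ?P W'" and v: "v \<in> W" for v
  proof -
    have vM: "v \<in> carrier M" using v W(1) by blast
    have "pure_tensor A M ?P v e \<in> tensor_image A M ?P W"
      unfolding tensor_image_def by (rule generate.incl) (use v T'(5) in blast)
    then obtain y where y: "y \<in> ?H" "r_coset ?F ?N (frag_of (v, e)) = r_coset ?F ?N y"
      using im sub unfolding pure_tensor_def by blast
    have "frag_of (v, e) \<in> r_coset ?F ?N y"
      by (subst y(2)[symmetric]) (rule group.rcos_self[OF group_free_Abelian_group fc[OF vM T'(5)] T'(2)])
    then obtain k where k: "k \<in> ?N" "frag_of (v, e) = k + y"
      by (auto simp: r_coset_def)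
    have kc: "k \<in> carrier ?F" "h k = \<zero>\<^bsub>M\<^esub>" using ker k(1) unfolding kernel_def by auto
    have "h (frag_of (v, e)) = h k \<oplus>\<^bsub>M\<^esub> h y" using h.hom_mult[OF kc(1), of y] y(1) k(2) by simp
    also have "\<dots> = h y" using kc(2) y(1) W'c by (simp add: subset_iff)
    finally show ?thesis using hf[OF vM T'(5)] y(1) by simp
  qed
  then show ?thesis using backward by blast
qed

section \<open>Radical and socle\<close>

text \<open>Left-right symmetry of the radical. A left inverse t of 1 - c a has the form 1 - x a
  itself, so it is left invertible and therefore a two-sided inverse. Then 1 + a t c is a right
  inverse of 1 - a c. The symmetry is needed because forms on left modules produce left inverses,
  while the socle is that of a right module.\<close>

lemma (in ring) right_invertible_if_left_radical:
  assumes a: "a \<in> carrier R" and rad: "\<And>x. x \<in> carrier R \<Longrightarrow> \<exists>t\<in>carrier R. t \<otimes> (\<one> \<ominus> x \<otimes> a) = \<one>"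
    and c: "c \<in> carrier R"
  shows "\<exists>t\<in>carrier R. (\<one> \<ominus> a \<otimes> c) \<otimes> t = \<one>"
proof -
  obtain t where t: "t \<in> carrier R" "t \<otimes> (\<one> \<ominus> c \<otimes> a) = \<one>" using rad[OF c] by blast
  let ?u = "\<one> \<ominus> c \<otimes> a"
  have u: "?u \<in> carrier R" using a c by simp
  have "t \<ominus> t \<otimes> (c \<otimes> a) = \<one>"
    using t a c by (simp add: minus_eq r_distr r_minus)
  then have "(t \<ominus> t \<otimes> (c \<otimes> a)) \<oplus> t \<otimes> (c \<otimes> a) = \<one> \<oplus> t \<otimes> (c \<otimes> a)" by simp
  then have "\<one> \<ominus> (\<ominus> (t \<otimes> c)) \<otimes> a = t"
    using t(1) a c minus_add_cancel[of t "t \<otimes> (c \<otimes> a)"] by (simp add: minus_eq l_minus m_assoc)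
  then obtain s where s: "s \<in> carrier R" "s \<otimes> t = \<one>"
    using rad[of "\<ominus> (t \<otimes> c)"] t(1) c by auto
  have "s = (s \<otimes> t) \<otimes> ?u" using s(1) t u by (simp add: m_assoc)
  then have "s = ?u" using s(2) u by simp
  then have ut: "?u \<otimes> t = \<one>" using s(2) by simp
  have "(\<one> \<ominus> a \<otimes> c) \<otimes> (\<one> \<oplus> a \<otimes> t \<otimes> c) = \<one> \<ominus> a \<otimes> c \<oplus> a \<otimes> (?u \<otimes> t) \<otimes> c"
    using a c t(1) by (algebra, simp)
  also have "\<dots> = \<one>" unfolding ut using a c by (simp add: minus_add_cancel)
  finally show ?thesis using a c t(1) by (intro bexI[of _ "\<one> \<oplus> a \<otimes> t \<otimes> c"]) auto
qed

context right_module
begin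

lemma submoduleI:
  assumes "N \<subseteq> carrier M" "\<zero>\<^bsub>M\<^esub> \<in> N" "\<And>x y. \<lbrakk>x \<in> N; y \<in> N\<rbrakk> \<Longrightarrow> x \<oplus>\<^bsub>M\<^esub> y \<in> N"
    "\<And>a x. \<lbrakk>a \<in> carrier A; x \<in> N\<rbrakk> \<Longrightarrow> a \<odot>\<^bsub>M\<^esub> x \<in> N"
  shows "submodule N A M"
proof (rule submodule_groupI[OF M.abelian_group_axioms])
  fix x assume x: "x \<in> N"
  then have xc: "x \<in> carrier M" using assms(1) by blast
  have "(\<ominus>\<^bsub>A\<^esub> \<one>\<^bsub>A\<^esub>) \<odot>\<^bsub>M\<^esub> x \<oplus>\<^bsub>M\<^esub> x = (\<ominus>\<^bsub>A\<^esub> \<one>\<^bsub>A\<^esub> \<oplus>\<^bsub>A\<^esub> \<one>\<^bsub>A\<^esub>) \<odot>\<^bsub>M\<^esub> x"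
    using xc by (simp add: smult_l_distr smult_one)
  also have "\<dots> = \<zero>\<^bsub>M\<^esub>"
    using xc smult_l_distr[of "\<zero>\<^bsub>A\<^esub>" "\<zero>\<^bsub>A\<^esub>" x] smult_closed[of "\<zero>\<^bsub>A\<^esub>" x] by (simp add: A.l_neg)
  finally have "\<ominus>\<^bsub>M\<^esub> x = (\<ominus>\<^bsub>A\<^esub> \<one>\<^bsub>A\<^esub>) \<odot>\<^bsub>M\<^esub> x"
    using xc by (intro M.minus_equality smult_closed) auto
  then show "\<ominus>\<^bsub>M\<^esub> x \<in> N" using assms(4)[OF _ x, of "\<ominus>\<^bsub>A\<^esub> \<one>\<^bsub>A\<^esub>"] by simp
qed (use assms in auto)

lemma submodule_carrier: "submodule (carrier M) A M"
  by (rule submoduleI) (auto intro: smult_closed)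

lemma smult_l_null: "x \<in> carrier M \<Longrightarrow> \<zero>\<^bsub>A\<^esub> \<odot>\<^bsub>M\<^esub> x = \<zero>\<^bsub>M\<^esub>"
  using smult_l_distr[of "\<zero>\<^bsub>A\<^esub>" "\<zero>\<^bsub>A\<^esub>" x] smult_closed[of "\<zero>\<^bsub>A\<^esub>" x] by simp

lemma smult_l_diff:
  assumes "a \<in> carrier A" "b \<in> carrier A" "x \<in> carrier M"
  shows "(a \<ominus>\<^bsub>A\<^esub> b) \<odot>\<^bsub>M\<^esub> x = a \<odot>\<^bsub>M\<^esub> x \<ominus>\<^bsub>M\<^esub> b \<odot>\<^bsub>M\<^esub> x"
proof -
  have "(a \<ominus>\<^bsub>A\<^esub> b) \<odot>\<^bsub>M\<^esub> x \<oplus>\<^bsub>M\<^esub> b \<odot>\<^bsub>M\<^esub> x = a \<odot>\<^bsub>M\<^esub> x"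
    using assms by (simp add: A.minus_add_cancel flip: smult_l_distr)
  moreover have "((a \<ominus>\<^bsub>A\<^esub> b) \<odot>\<^bsub>M\<^esub> x \<oplus>\<^bsub>M\<^esub> b \<odot>\<^bsub>M\<^esub> x) \<ominus>\<^bsub>M\<^esub> b \<odot>\<^bsub>M\<^esub> x = (a \<ominus>\<^bsub>A\<^esub> b) \<odot>\<^bsub>M\<^esub> x"
    using assms by (simp add: M.minus_eq M.a_assoc M.r_neg smult_closed)
  ultimately show ?thesis by simp
qed

lemma submodule_socle: "submodule (socle A M) A M"
  unfolding socle_def mod_span_def
proof (rule submodule_Inter[OF M.abelian_group_axioms])
  have "\<Union>{S. simple_submodule S A M} \<subseteq> carrier M"
    by (rule Union_least) (auto simp: simple_submodule_def dest: submodule_in_carrier)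
  then show "{N. submodule N A M \<and> \<Union>{S. simple_submodule S A M} \<subseteq> N} \<noteq> {}"
    using submodule_carrier by auto
qed simp

text \<open>In right-handed notation: if v b a is nonzero in a simple submodule containing v, then v
  = v b a c for some c, so v (1 - b a c) = 0 and v = 0.\<close>

lemma socle_annihilated:
  assumes a: "a \<in> carrier A"
    and rad: "\<And>b c. \<lbrakk>b \<in> carrier A; c \<in> carrier A\<rbrakk> \<Longrightarrow> \<exists>t\<in>carrier A. (\<one>\<^bsub>A\<^esub> \<ominus>\<^bsub>A\<^esub> b \<otimes>\<^bsub>A\<^esub> a \<otimes>\<^bsub>A\<^esub> c) \<otimes>\<^bsub>A\<^esub> t = \<one>\<^bsub>A\<^esub>"
    and w: "w \<in> socle A M"
  shows "a \<odot>\<^bsub>M\<^esub> w = \<zero>\<^bsub>M\<^esub>"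
proof -
  \<comment> \<open>The factor b is inserted because the elements killed by \<open>a\<close> alone
    need not form a submodule.\<close>
  let ?N = "{v \<in> carrier M. \<forall>b\<in>carrier A. (b \<otimes>\<^bsub>A\<^esub> a) \<odot>\<^bsub>M\<^esub> v = \<zero>\<^bsub>M\<^esub>}"
  have "socle A M \<subseteq> ?N"
    unfolding socle_def
  proof (rule mod_span_minimal)
    show "submodule ?N A M"
    proof (rule submoduleI)
      fix c x assume c: "c \<in> carrier A" and x: "x \<in> ?N"
      have "(b \<otimes>\<^bsub>A\<^esub> a) \<odot>\<^bsub>M\<^esub> (c \<odot>\<^bsub>M\<^esub> x) = ((c \<otimes>\<^bsub>A\<^esub> b) \<otimes>\<^bsub>A\<^esub> a) \<odot>\<^bsub>M\<^esub> x" if "b \<in> carrier A" for b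
        using that a c x by (simp add: smult_assoc A.m_assoc)
      then show "c \<odot>\<^bsub>M\<^esub> x \<in> ?N" using c x by (simp add: smult_closed)
    qed (use a in \<open>auto simp: smult_r_distr smult_r_null\<close>)
    show "\<Union>{S. simple_submodule S A M} \<subseteq> ?N"
    proof safe
      fix v S assume S: "simple_submodule S A M" and v: "v \<in> S"
      then have sub: "submodule S A M" by (simp add: simple_submodule_def)
      show vM: "v \<in> carrier M" by (rule submodule_in_carrier[OF sub v])
      fix b assume b: "b \<in> carrier A"
      let ?u = "(b \<otimes>\<^bsub>A\<^esub> a) \<odot>\<^bsub>M\<^esub> v"
      show "?u = \<zero>\<^bsub>M\<^esub>"
      proof (rule ccontr)
        assume u0: "?u \<noteq> \<zero>\<^bsub>M\<^esub>"
        have uS: "?u \<in> S" by (rule submodule_smult[OF sub _ v]) (use a b in simp)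
        have uM: "?u \<in> carrier M" by (rule submodule_in_carrier[OF sub uS])
        let ?T = "{c \<odot>\<^bsub>M\<^esub> ?u | c. c \<in> carrier A}"
        have T: "submodule ?T A M"
        proof (rule submoduleI)
          show "?T \<subseteq> carrier M" using uM by (auto intro: smult_closed)
          have "\<zero>\<^bsub>M\<^esub> = \<zero>\<^bsub>A\<^esub> \<odot>\<^bsub>M\<^esub> ?u" using smult_l_null[OF uM] by simp
          then show "\<zero>\<^bsub>M\<^esub> \<in> ?T" by blast
          fix x y assume "x \<in> ?T" "y \<in> ?T"
          then obtain c d where "c \<in> carrier A" "d \<in> carrier A" "x = c \<odot>\<^bsub>M\<^esub> ?u" "y = d \<odot>\<^bsub>M\<^esub> ?u" by blast
          then show "x \<oplus>\<^bsub>M\<^esub> y \<in> ?T" using smult_l_distr[OF _ _ uM, of c d] by (auto intro!: exI[of _ "c \<oplus>\<^bsub>A\<^esub> d"])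
        next
          fix d x assume "d \<in> carrier A" "x \<in> ?T"
          then obtain c where "c \<in> carrier A" "d \<in> carrier A" "x = c \<odot>\<^bsub>M\<^esub> ?u" by blast
          then show "d \<odot>\<^bsub>M\<^esub> x \<in> ?T" using smult_assoc[OF _ _ uM, of d c] by (auto intro!: exI[of _ "c \<otimes>\<^bsub>A\<^esub> d"])
        qed
        have "?T \<subseteq> S" using submodule_smult[OF sub _ uS] by blast
        then have "?T = {\<zero>\<^bsub>M\<^esub>} \<or> ?T = S"
          using S T unfolding simple_submodule_def by blast
        moreover have "?u \<in> ?T"
        proof -
          have "?u = \<one>\<^bsub>A\<^esub> \<odot>\<^bsub>M\<^esub> ?u" using smult_one[OF uM] by simp
          then show ?thesis using A.one_closed by blast
        qed
        ultimately have "v \<in> ?T" using u0 v by blast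
        then obtain c where c: "c \<in> carrier A" "v = c \<odot>\<^bsub>M\<^esub> ?u" by blast
        then have v_eq: "v = (b \<otimes>\<^bsub>A\<^esub> a \<otimes>\<^bsub>A\<^esub> c) \<odot>\<^bsub>M\<^esub> v" using a b vM by (simp add: smult_assoc)
        obtain t where t: "t \<in> carrier A" "(\<one>\<^bsub>A\<^esub> \<ominus>\<^bsub>A\<^esub> b \<otimes>\<^bsub>A\<^esub> a \<otimes>\<^bsub>A\<^esub> c) \<otimes>\<^bsub>A\<^esub> t = \<one>\<^bsub>A\<^esub>"
          using rad[OF b c(1)] by blast
        have "(\<one>\<^bsub>A\<^esub> \<ominus>\<^bsub>A\<^esub> b \<otimes>\<^bsub>A\<^esub> a \<otimes>\<^bsub>A\<^esub> c) \<odot>\<^bsub>M\<^esub> v = v \<ominus>\<^bsub>M\<^esub> (b \<otimes>\<^bsub>A\<^esub> a \<otimes>\<^bsub>A\<^esub> c) \<odot>\<^bsub>M\<^esub> v"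
          using a b c(1) vM by (simp add: smult_l_diff smult_one)
        also have "\<dots> = \<zero>\<^bsub>M\<^esub>" unfolding v_eq[symmetric] using vM by (simp add: M.minus_eq M.r_neg)
        finally have "t \<odot>\<^bsub>M\<^esub> ((\<one>\<^bsub>A\<^esub> \<ominus>\<^bsub>A\<^esub> b \<otimes>\<^bsub>A\<^esub> a \<otimes>\<^bsub>A\<^esub> c) \<odot>\<^bsub>M\<^esub> v) = \<zero>\<^bsub>M\<^esub>"
          using t(1) by (simp add: smult_r_null)
        then have "v = \<zero>\<^bsub>M\<^esub>" using t a b c(1) vM by (simp add: smult_assoc smult_one)
        then show False using u0 a b by (simp add: smult_r_null)
      qed
    qed
  qed
  then have "(\<one>\<^bsub>A\<^esub> \<otimes>\<^bsub>A\<^esub> a) \<odot>\<^bsub>M\<^esub> w = \<zero>\<^bsub>M\<^esub>" using w by blast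
  then show ?thesis using a by simp
qed

end

section \<open>The right module of a regular sequence\<close>

lemma restrict_scalars_simps [simp]:
  "carrier (restrict_scalars A M) = carrier M" "ring.zero (restrict_scalars A M) = ring.zero M"
  "ring.add (restrict_scalars A M) = ring.add M"
  "smult (restrict_scalars A M) = (\<lambda>r x. (r \<odot>\<^bsub>A\<^esub> \<one>\<^bsub>A\<^esub>) \<odot>\<^bsub>M\<^esub> x)"
  by (simp_all add: restrict_scalars_def)

locale quotient_module = finite_algebra R \<mm> A
  for R :: "('r, 'k) ring_scheme" (structure) and \<mm> and A :: "('r, 'a) module" +
  fixes xs
  assumes xs: "set xs \<subseteq> carrier R"
begin

text \<open>In the notation of the context \<open>J\<close> is the two-sided ideal (x) A and
  \<open>W t\<close> is the submodule V \<mm>^t.\<close>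

abbreviation "J \<equiv> smult_span R (set xs) A"
abbreviation "V \<equiv> quot_right_module R A xs"
abbreviation "\<pi> b \<equiv> J +>\<^bsub>A\<^esub> b"
abbreviation "Vr \<equiv> restrict_scalars A V"
abbreviation "W t \<equiv> smult_span R (ideal_pow R \<mm> t) Vr"

lemma J_submodule: "submodule J R A"
  by (rule L.smult_span_submodule[OF xs])

lemma J_ideal: "ideal J A"
proof (rule idealI[OF A.ring_axioms])
  show "subgroup J (add_monoid A)"
    using submodule_subset[OF J_submodule] submodule_zero[OF J_submodule] submodule_add[OF J_submodule]
      submodule_uminus[OF J_submodule]
    by (intro subgroup.intro) (auto simp flip: a_inv_def)
qed (auto intro: smult_span_mult_left[OF xs] smult_span_mult_right[OF xs])

interpretation J: ideal J A by (rule J_ideal)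

lemma V_simps:
  "carrier V = {\<pi> b | b. b \<in> carrier A}" "ring.zero V = J"
  "\<lbrakk>b \<in> carrier A; c \<in> carrier A\<rbrakk> \<Longrightarrow> \<pi> b \<oplus>\<^bsub>V\<^esub> \<pi> c = \<pi> (b \<oplus>\<^bsub>A\<^esub> c)"
  "\<lbrakk>a \<in> carrier A; b \<in> carrier A\<rbrakk> \<Longrightarrow> a \<odot>\<^bsub>V\<^esub> \<pi> b = \<pi> (b \<otimes>\<^bsub>A\<^esub> a)"
  by (auto simp: quot_right_module_def Let_def FactRing_def A_RCOSETS_def' J.rcoset_mult_add J.a_rcos_sum)

lemma pi_in_V: "b \<in> carrier A \<Longrightarrow> \<pi> b \<in> carrier V"
  by (auto simp: V_simps)

lemma pi_zero: "b \<in> J \<Longrightarrow> \<pi> b = \<zero>\<^bsub>V\<^esub>"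
  unfolding V_simps(2) using J.a_rcos_const by blast

lemma V_abelian_group: "abelian_group V"
proof -
  interpret Q: ring "A Quot J" by (rule J.quotient_is_ring)
  show ?thesis
    by (rule abelian_group_cong[OF Q.abelian_group_axioms])
      (simp_all add: quot_right_module_def Let_def)
qed

lemma V_right_module: "right_module R A V"
proof (intro right_module.intro right_module_axioms.intro A.plain_algebra_axioms V_abelian_group)
qed (auto simp: V_simps A.r_distr A.l_distr A.m_assoc)

sublocale V: right_module R A V by (rule V_right_module)

lemma Vr_smult: "\<lbrakk>r \<in> carrier R; b \<in> carrier A\<rbrakk> \<Longrightarrow> r \<odot>\<^bsub>Vr\<^esub> \<pi> b = \<pi> (r \<odot>\<^bsub>A\<^esub> b)"
  by (simp add: V_simps A.smult_mult_right)

lemma Vr_left_module: "left_module R Vr"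
proof (intro left_module.intro left_module_axioms.intro ring_axioms
    abelian_group_cong[OF V_abelian_group])
  fix a b v w assume a: "a \<in> carrier R" and v: "v \<in> carrier Vr"
  then obtain x where x: "x \<in> carrier A" "v = \<pi> x" by (auto simp: V_simps)
  show "a \<odot>\<^bsub>Vr\<^esub> v \<in> carrier Vr" unfolding x(2) Vr_smult[OF a x(1)] using pi_in_V a x by simp
  {
    assume b: "b \<in> carrier R"
    show "(a \<oplus> b) \<odot>\<^bsub>Vr\<^esub> v = a \<odot>\<^bsub>Vr\<^esub> v \<oplus>\<^bsub>Vr\<^esub> b \<odot>\<^bsub>Vr\<^esub> v"
      "(a \<otimes> b) \<odot>\<^bsub>Vr\<^esub> v = a \<odot>\<^bsub>Vr\<^esub> (b \<odot>\<^bsub>Vr\<^esub> v)"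
      unfolding x(2) using a b x(1)
      by (simp_all del: restrict_scalars_simps(4) add: Vr_smult V_simps(3) L.smult_l_distr L.smult_assoc)
  }
  assume w: "w \<in> carrier Vr"
  then obtain y where y: "y \<in> carrier A" "w = \<pi> y" by (auto simp: V_simps)
  show "a \<odot>\<^bsub>Vr\<^esub> (v \<oplus>\<^bsub>Vr\<^esub> w) = a \<odot>\<^bsub>Vr\<^esub> v \<oplus>\<^bsub>Vr\<^esub> a \<odot>\<^bsub>Vr\<^esub> w"
    unfolding x(2) y(2) using a x(1) y(1)
    by (simp del: restrict_scalars_simps(4) add: Vr_smult V_simps(3) L.smult_r_distr)
next
  fix v assume "v \<in> carrier Vr"
  then obtain x where x: "x \<in> carrier A" "v = \<pi> x" by (auto simp: V_simps)
  then show "\<one> \<odot>\<^bsub>Vr\<^esub> v = v" by (simp del: restrict_scalars_simps(4) add: Vr_smult)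
qed simp_all

lemma pi_lin: "(\<lambda>b. \<pi> b) \<in> lin_maps R A Vr"
  by (rule lin_mapsI) (simp_all del: restrict_scalars_simps(4) add: pi_in_V Vr_smult V_simps(3))

lemma pi_W: "b \<in> K t \<Longrightarrow> \<pi> b \<in> W t"
  by (rule lin_maps_smult_span[OF left_module_R Vr_left_module pi_lin ideal_pow_subset])

lemma noetherian_Vr: "noetherian_module R Vr"
proof (rule noetherian_if_fin_gen[OF Vr_left_module])
  obtain Z where Z: "finite Z" "Z \<subseteq> carrier A" "mod_span R A Z = carrier A"
    using fin_gen unfolding fin_gen_def by blast
  interpret Vr: left_module R Vr by (rule Vr_left_module)
  let ?Z = "(\<lambda>b. \<pi> b) ` Z"
  have Zc: "?Z \<subseteq> carrier Vr" using Z(2) pi_in_V by auto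
  note sub = Vr.mod_span_submodule[OF Zc]
  have "mod_span R A Z \<subseteq> {b \<in> carrier A. \<pi> b \<in> mod_span R Vr ?Z}"
  proof (rule mod_span_minimal[OF lin_maps_vimage_submodule[OF left_module_R Vr_left_module pi_lin sub]])
    have "\<pi> z \<in> mod_span R Vr ?Z" if "z \<in> Z" for z
      by (rule subsetD[OF mod_span_superset]) (use that in blast)
    then show "Z \<subseteq> {b \<in> carrier A. \<pi> b \<in> mod_span R Vr ?Z}" using Z(2) by blast
  qed
  then have "carrier Vr \<subseteq> mod_span R Vr ?Z" unfolding Z(3) by (auto simp: V_simps)
  then show "fin_gen R Vr"
    unfolding fin_gen_def using Z(1) Zc submodule_subset[OF sub] by (intro exI[of _ ?Z]) auto
qed

lemma W_submodule: "submodule (W t) R Vr"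
  by (rule left_module.smult_span_submodule[OF Vr_left_module ideal_pow_subset])

lemma W_subgroup: "subgroup (W t) (add_monoid V)"
proof -
  have "a_inv Vr = a_inv V" by (rule a_inv_cong) simp_all
  then show ?thesis
    using submodule_subset[OF W_submodule] submodule_zero[OF W_submodule] submodule_add[OF W_submodule]
      submodule_uminus[OF W_submodule]
    by (intro subgroup.intro) (auto simp flip: a_inv_def)
qed

lemma W_smult:
  assumes a: "a \<in> carrier A" and w: "w \<in> W t"
  shows "a \<odot>\<^bsub>V\<^esub> w \<in> W t"
proof -
  interpret Vr: left_module R Vr by (rule Vr_left_module)
  have comm: "a \<odot>\<^bsub>V\<^esub> (r \<odot>\<^bsub>Vr\<^esub> v) = r \<odot>\<^bsub>Vr\<^esub> (a \<odot>\<^bsub>V\<^esub> v)" if r: "r \<in> carrier R" and v: "v \<in> carrier V" for r v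
  proof -
    obtain x where x: "x \<in> carrier A" "v = \<pi> x" using v by (auto simp: V_simps)
    show ?thesis
      unfolding x(2) using a r x(1)
      by (simp del: restrict_scalars_simps(4) add: Vr_smult V_simps(4) A.smult_mult_left)
  qed
  have "W t \<subseteq> {v \<in> carrier Vr. a \<odot>\<^bsub>V\<^esub> v \<in> W t}"
  proof (rule smult_span_minimal)
    show "submodule {v \<in> carrier Vr. a \<odot>\<^bsub>V\<^esub> v \<in> W t} R Vr"
    proof (rule Vr.submoduleI)
      fix r v assume "r \<in> carrier R" "v \<in> {v \<in> carrier Vr. a \<odot>\<^bsub>V\<^esub> v \<in> W t}"
      then show "r \<odot>\<^bsub>Vr\<^esub> v \<in> {v \<in> carrier Vr. a \<odot>\<^bsub>V\<^esub> v \<in> W t}"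
        using comm[of r v] submodule_smult[OF W_submodule, of r] Vr.smult_closed[of r v]
        by (simp del: restrict_scalars_simps(4))
    next
      show "\<zero>\<^bsub>Vr\<^esub> \<in> {v \<in> carrier Vr. a \<odot>\<^bsub>V\<^esub> v \<in> W t}"
        using V.smult_r_null[OF a] submodule_zero[OF W_submodule] Vr.M.zero_closed by simp
      fix x y assume "x \<in> {v \<in> carrier Vr. a \<odot>\<^bsub>V\<^esub> v \<in> W t}" "y \<in> {v \<in> carrier Vr. a \<odot>\<^bsub>V\<^esub> v \<in> W t}"
      then show "x \<oplus>\<^bsub>Vr\<^esub> y \<in> {v \<in> carrier Vr. a \<odot>\<^bsub>V\<^esub> v \<in> W t}"
        using V.smult_r_distr[OF a] submodule_add[OF W_submodule] Vr.M.a_closed[of x y] by simp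
    qed auto
    fix r v assume rv: "r \<in> ideal_pow R \<mm> t" "v \<in> carrier Vr"
    then have rc: "r \<in> carrier R" using ideal_pow_subset by blast
    have "r \<odot>\<^bsub>Vr\<^esub> (a \<odot>\<^bsub>V\<^esub> v) \<in> W t"
      by (rule smult_span_memI[OF rv(1)]) (use V.smult_closed[OF a] rv(2) in simp)
    then show "r \<odot>\<^bsub>Vr\<^esub> v \<in> {v \<in> carrier Vr. a \<odot>\<^bsub>V\<^esub> v \<in> W t}"
      using comm[OF rc] rv(2) Vr.smult_closed[OF rc rv(2)] by (simp del: restrict_scalars_simps(4))
  qed
  then show ?thesis using w by blast
qed

text \<open>Admissibility gives an element of Soc(V) e different from 0, which by Krull's
  intersection theorem avoids some V \<mm>^t. Hence the set defining s_I is nonempty and its infimum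
  is a member of it; enlarging the exponent to s shrinks V \<mm>^t further.\<close>

lemma socle_witness:
  assumes e: "e \<in> carrier A" "e \<otimes>\<^bsub>A\<^esub> e = e"
    and adm: "carrier (tensor A (V\<lparr>carrier := socle A V\<rparr>) (left_ideal_module A e)) \<noteq>
      {\<one>\<^bsub>tensor A (V\<lparr>carrier := socle A V\<rparr>) (left_ideal_module A e)\<^esub>}"
    and s: "Inf {t. t \<ge> 1 \<and> \<not> tensor_image A V (left_ideal_module A e) (socle A V)
      \<subseteq> tensor_image A V (left_ideal_module A e) (W t)} \<le> s"
  shows "\<exists>w\<in>socle A V. e \<odot>\<^bsub>V\<^esub> w \<notin> W s"
proof -
  let ?P = "left_ideal_module A e" and ?S = "socle A V"
  let ?T = "{t. t \<ge> 1 \<and> \<not> tensor_image A V ?P ?S \<subseteq> tensor_image A V ?P (W t)}"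
  note S = V.submodule_socle
  have iff: "tensor_image A V ?P ?S \<subseteq> tensor_image A V ?P (W t) \<longleftrightarrow> (\<forall>v\<in>?S. e \<odot>\<^bsub>V\<^esub> v \<in> W t)" for t
    by (rule V.tensor_image_subset_iff[OF e submodule_subset[OF S] submodule_smult[OF S] W_subgroup W_smult])
  have mono: "W t \<subseteq> W u" if "u \<le> t" for u t
    by (rule smult_span_mono[OF ideal_pow_mono[OF that]])
  interpret T: idempotent_tensor R A V e ?S
    by unfold_locales (use e submodule_subset[OF S] submodule_zero[OF S] submodule_add[OF S]
      submodule_smult[OF S] in auto)
  obtain w where w: "w \<in> ?S" "e \<odot>\<^bsub>V\<^esub> w \<noteq> \<zero>\<^bsub>V\<^esub>"
    using T.tensor_trivial adm by blast
  obtain t where t: "e \<odot>\<^bsub>V\<^esub> w \<notin> W t"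
    using krull_intersection[OF noetherian_Vr, of "e \<odot>\<^bsub>V\<^esub> w"] w(2) by auto
  \<comment> \<open>The successor guarantees the side condition t \<ge> 1.\<close>
  then have "e \<odot>\<^bsub>V\<^esub> w \<notin> W (Suc t)" using mono[of t "Suc t"] by auto
  then have "Suc t \<in> ?T" using iff w(1) by auto
  then have "Inf ?T \<in> ?T" by (intro Inf_nat_def1) blast
  then obtain v where v: "v \<in> ?S" "e \<odot>\<^bsub>V\<^esub> v \<notin> W (Inf ?T)" using iff by auto
  then show ?thesis using mono[OF s] by blast
qed

end

section \<open>Exact complexes modulo a regular sequence\<close>

lemma smult_span_insert:
  assumes M: "left_module R M" and R: "cring R" and x: "x \<in> carrier R" and S: "S \<subseteq> carrier R"
    and u: "u \<in> smult_span R (insert x S) M"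
  obtains v y where "v \<in> carrier M" "y \<in> smult_span R S M" "u = x \<odot>\<^bsub>M\<^esub> v \<oplus>\<^bsub>M\<^esub> y"
proof -
  interpret M: left_module R M by fact
  interpret R: cring R by fact
  let ?P = "{x \<odot>\<^bsub>M\<^esub> v | v. v \<in> carrier M}"
  have P: "submodule ?P R M"
  proof (rule M.submoduleI)
    show "?P \<subseteq> carrier M" using x by auto
    have "\<zero>\<^bsub>M\<^esub> = x \<odot>\<^bsub>M\<^esub> \<zero>\<^bsub>M\<^esub>" using x by simp
    then show "\<zero>\<^bsub>M\<^esub> \<in> ?P" by blast
    fix a b assume "a \<in> ?P" "b \<in> ?P"
    then obtain v w where "v \<in> carrier M" "w \<in> carrier M" "a = x \<odot>\<^bsub>M\<^esub> v" "b = x \<odot>\<^bsub>M\<^esub> w" by blast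
    then show "a \<oplus>\<^bsub>M\<^esub> b \<in> ?P" using x M.smult_r_distr[of x v w] by (auto intro!: exI[of _ "v \<oplus>\<^bsub>M\<^esub> w"])
  next
    fix r a assume r: "r \<in> carrier R" and "a \<in> ?P"
    then obtain v where v: "v \<in> carrier M" "a = x \<odot>\<^bsub>M\<^esub> v" by blast
    have "r \<odot>\<^bsub>M\<^esub> a = x \<odot>\<^bsub>M\<^esub> (r \<odot>\<^bsub>M\<^esub> v)"
      unfolding v(2) using x r v(1) by (simp add: R.m_comm flip: M.smult_assoc)
    then show "r \<odot>\<^bsub>M\<^esub> a \<in> ?P" using r v(1) by blast
  qed
  note Q = M.smult_span_submodule[OF S]
  have "smult_span R (insert x S) M \<subseteq> ?P <+>\<^bsub>M\<^esub> smult_span R S M"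
  proof (rule smult_span_minimal[OF M.submodule_set_add[OF P Q]])
    fix s v assume sv: "s \<in> insert x S" "v \<in> carrier M"
    then have "s \<odot>\<^bsub>M\<^esub> v \<in> ?P \<or> s \<odot>\<^bsub>M\<^esub> v \<in> smult_span R S M"
      using sv by (auto intro: smult_span_memI)
    then show "s \<odot>\<^bsub>M\<^esub> v \<in> ?P <+>\<^bsub>M\<^esub> smult_span R S M"
      using M.subset_set_add[OF P Q] by blast
  qed
  then have "u \<in> ?P <+>\<^bsub>M\<^esub> smult_span R S M" using u by blast
  then show ?thesis using that by (auto elim!: M.set_add_memE)
qed

lemma smult_span_empty: "left_module R M \<Longrightarrow> smult_span R {} M = {\<zero>\<^bsub>M\<^esub>}"
  unfolding smult_span_def by (simp add: left_module.mod_span_empty)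

text \<open>
  This replaces the vanishing of \<open>Tor\<close> beyond degree \<open>r\<close>: dividing by one element that is regular
  on all terms costs one degree of exactness.
\<close>

theorem exact_mod_regular:
  fixes C :: "nat \<Rightarrow> ('r, 'c) module"
  assumes R: "cring R" and C: "\<And>j. left_module R (C j)"
    and D: "\<And>j. D (Suc j) \<in> lin_maps R (C (Suc j)) (C j)"
    and DD: "\<And>j u. u \<in> carrier (C (Suc (Suc j))) \<Longrightarrow> D (Suc j) (D (Suc (Suc j)) u) = \<zero>\<^bsub>C j\<^esub>"
    and exact: "\<And>j u. \<lbrakk>u \<in> carrier (C (Suc j)); D (Suc j) u = \<zero>\<^bsub>C j\<^esub>\<rbrakk> \<Longrightarrow>
      \<exists>w\<in>carrier (C (Suc (Suc j))). u = D (Suc (Suc j)) w"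
    and xs: "set xs \<subseteq> carrier R"
    and reg: "\<And>i j y. \<lbrakk>i < length xs; a \<le> j; j \<le> b; y \<in> carrier (C j);
      (xs ! i) \<odot>\<^bsub>C j\<^esub> y \<in> smult_span R (set (take i xs)) (C j)\<rbrakk> \<Longrightarrow> y \<in> smult_span R (set (take i xs)) (C j)"
    and k: "i \<le> length xs" "a + i \<le> k" "k \<le> b" "u \<in> carrier (C (Suc k))"
      "D (Suc k) u \<in> smult_span R (set (take i xs)) (C k)"
  shows "\<exists>v\<in>smult_span R (set (take i xs)) (C (Suc k)). \<exists>w\<in>carrier (C (Suc (Suc k))).
    u = v \<oplus>\<^bsub>C (Suc k)\<^esub> D (Suc (Suc k)) w"
  using k
proof (induction i arbitrary: k u)
  case 0
  interpret Ck: left_module R "C (Suc k)" by (rule C)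
  have "D (Suc k) u = \<zero>\<^bsub>C k\<^esub>" using 0 by (simp add: smult_span_empty[OF C])
  then obtain w where w: "w \<in> carrier (C (Suc (Suc k)))" "u = D (Suc (Suc k)) w" using exact 0 by blast
  then show ?case using 0 by (intro bexI[of _ "\<zero>\<^bsub>C (Suc k)\<^esub>"] bexI[of _ w]) (simp_all add: smult_span_empty[OF C])
next
  case (Suc i)
  obtain k' where k': "k = Suc k'" using Suc.prems(2) by (cases k) auto
  interpret C0: left_module R "C k'" by (rule C)
  interpret C1: left_module R "C k" by (rule C)
  interpret C2: left_module R "C (Suc k)" by (rule C)
  let ?S = "set (take i xs)"
  have S: "?S \<subseteq> carrier R" using xs set_take_subset[of i xs] by blast
  have i: "i < length xs" using Suc.prems(1) by simp
  have x: "xs ! i \<in> carrier R" using xs i nth_mem by blast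
  have ins: "set (take (Suc i) xs) = insert (xs ! i) ?S" using i by (simp add: take_Suc_conv_app_nth)
  let ?x = "xs ! i"
  note sub = C0.smult_span_submodule[OF S] C1.smult_span_submodule[OF S] C2.smult_span_submodule[OF S]
  have D1: "D k \<in> lin_maps R (C k) (C k')" unfolding k' by (rule D)
  note D2 = D[of k]
  have Dspan: "D k y \<in> smult_span R ?S (C k')" if "y \<in> smult_span R ?S (C k)" for y
    by (rule lin_maps_smult_span[OF C C D1 S that])
  obtain v y where v: "v \<in> carrier (C k)" and y: "y \<in> smult_span R ?S (C k)"
    and Du: "D (Suc k) u = ?x \<odot>\<^bsub>C k\<^esub> v \<oplus>\<^bsub>C k\<^esub> y"
    using smult_span_insert[OF C R x S] Suc.prems(5) unfolding ins by blast
  have yc: "y \<in> carrier (C k)" by (rule submodule_in_carrier[OF sub(2) y])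
  \<comment> \<open>Applying the differential to D u = x v + y shows that x D v lies in the span of
    the earlier elements, and regularity removes x. The induction hypothesis then applies to v, one
    degree lower.\<close>
  have "\<zero>\<^bsub>C k'\<^esub> = D k (D (Suc k) u)" using DD[of u k'] Suc.prems(4) unfolding k' by simp
  also have "\<dots> = ?x \<odot>\<^bsub>C k'\<^esub> D k v \<oplus>\<^bsub>C k'\<^esub> D k y"
    unfolding Du using x v yc by (simp add: lin_maps_add[OF D1] lin_maps_smult[OF D1])
  finally have "?x \<odot>\<^bsub>C k'\<^esub> D k v = \<ominus>\<^bsub>C k'\<^esub> D k y"
    using x v yc lin_maps_closed[OF D1] by (intro C0.M.minus_equality[symmetric]) auto
  then have "?x \<odot>\<^bsub>C k'\<^esub> D k v \<in> smult_span R ?S (C k')"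
    using submodule_uminus[OF sub(1) Dspan[OF y]] by simp
  then have Dv: "D k v \<in> smult_span R ?S (C k')"
    using Suc.prems(2,3) k' by (intro reg[OF i _ _ lin_maps_closed[OF D1 v]]) auto
  have "\<exists>y'\<in>smult_span R ?S (C (Suc k')). \<exists>w\<in>carrier (C (Suc (Suc k'))). v = y' \<oplus>\<^bsub>C (Suc k')\<^esub> D (Suc (Suc k')) w"
    using Suc.prems v Dv unfolding k' by (intro Suc.IH) auto
  then obtain y' w where y': "y' \<in> smult_span R ?S (C k)" and w: "w \<in> carrier (C (Suc k))"
    and v_eq: "v = y' \<oplus>\<^bsub>C k\<^esub> D (Suc k) w" unfolding k' by blast
  have y'c: "y' \<in> carrier (C k)" by (rule submodule_in_carrier[OF sub(2) y'])
  have Dw: "D (Suc k) w \<in> carrier (C k)" by (rule lin_maps_closed[OF D2 w])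
  \<comment> \<open>Once v is a boundary D w up to the earlier elements, subtracting x w from u
    removes the contribution of x from D u. This leaves a case for the induction hypothesis in the
    original degree.\<close>
  let ?u = "u \<ominus>\<^bsub>C (Suc k)\<^esub> ?x \<odot>\<^bsub>C (Suc k)\<^esub> w"
  have uc: "u \<in> carrier (C (Suc k))" by (rule Suc.prems(4))
  have xw: "?x \<odot>\<^bsub>C (Suc k)\<^esub> w \<in> carrier (C (Suc k))" using x w by simp
  have "D (Suc k) ?u = D (Suc k) u \<ominus>\<^bsub>C k\<^esub> ?x \<odot>\<^bsub>C k\<^esub> D (Suc k) w"
    using lin_maps_minus[OF C C D2 uc xw] lin_maps_smult[OF D2 x w] by simp
  also have "\<dots> = ?x \<odot>\<^bsub>C k\<^esub> y' \<oplus>\<^bsub>C k\<^esub> y"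
    unfolding Du v_eq using x y'c Dw yc
    by (simp add: C1.smult_r_distr C1.M.minus_eq C1.M.a_ac C1.M.r_neg1 C1.M.r_neg2 C1.M.r_neg C1.M.add_add_minus_cancel)
  also have "\<dots> \<in> smult_span R ?S (C k)"
    by (intro submodule_add[OF sub(2)] submodule_smult[OF sub(2) x y'] y)
  finally have "\<exists>v'\<in>smult_span R ?S (C (Suc k)). \<exists>w'\<in>carrier (C (Suc (Suc k))). ?u = v' \<oplus>\<^bsub>C (Suc k)\<^esub> D (Suc (Suc k)) w'"
    using Suc.prems uc xw by (intro Suc.IH) auto
  then obtain v' w' where v': "v' \<in> smult_span R ?S (C (Suc k))" and w': "w' \<in> carrier (C (Suc (Suc k)))"
    and u_eq: "?u = v' \<oplus>\<^bsub>C (Suc k)\<^esub> D (Suc (Suc k)) w'" by blast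
  have v'c: "v' \<in> carrier (C (Suc k))" by (rule submodule_in_carrier[OF sub(3) v'])
  have Dw': "D (Suc (Suc k)) w' \<in> carrier (C (Suc k))" by (rule lin_maps_closed[OF D w'])
  have "u = ?u \<oplus>\<^bsub>C (Suc k)\<^esub> ?x \<odot>\<^bsub>C (Suc k)\<^esub> w"
    using uc xw by (simp add: C2.M.minus_eq C2.M.a_assoc C2.M.l_neg)
  also have "\<dots> = (?x \<odot>\<^bsub>C (Suc k)\<^esub> w \<oplus>\<^bsub>C (Suc k)\<^esub> v') \<oplus>\<^bsub>C (Suc k)\<^esub> D (Suc (Suc k)) w'"
    unfolding u_eq using v'c Dw' xw by (simp add: C2.M.a_ac)
  finally have "u = \<dots>" .
  moreover have "?x \<odot>\<^bsub>C (Suc k)\<^esub> w \<oplus>\<^bsub>C (Suc k)\<^esub> v' \<in> smult_span R (insert ?x ?S) (C (Suc k))"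
  proof (rule submodule_add)
    show "submodule (smult_span R (insert ?x ?S) (C (Suc k))) R (C (Suc k))"
      by (rule C2.smult_span_submodule) (use x S in blast)
    show "?x \<odot>\<^bsub>C (Suc k)\<^esub> w \<in> smult_span R (insert ?x ?S) (C (Suc k))"
      by (rule smult_span_memI) (use w in auto)
    show "v' \<in> smult_span R (insert ?x ?S) (C (Suc k))"
      by (rule subsetD[OF smult_span_mono v']) blast
  qed
  ultimately show ?case unfolding ins using w' by blast
qed

section \<open>Finite generation\<close>

text \<open>Finite generation alone does not say where the generators lie. Here they are found
  inside a prescribed set, which is applied to the elements fixed by an idempotent.\<close>

lemma noetherian_finite_span:
  assumes M: "noetherian_module A M" and Y: "Y \<subseteq> carrier M"
  obtains Z where "finite Z" "Z \<subseteq> Y" "mod_span A M Z = mod_span A M Y"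
proof -
  interpret M: left_module A M using M unfolding noetherian_module_def by blast
  let ?F = "{mod_span A M Z | Z. finite Z \<and> Z \<subseteq> Y}"
  have F: "?F \<noteq> {}" by auto
  have F': "submodule N A M" if "N \<in> ?F" for N
  proof -
    from that obtain Z where "N = mod_span A M Z" "Z \<subseteq> Y" by blast
    then show ?thesis using M.mod_span_submodule[OF subset_trans[OF _ Y]] by simp
  qed
  obtain K where K: "K \<in> ?F" "\<And>N. \<lbrakk>N \<in> ?F; K \<subseteq> N\<rbrakk> \<Longrightarrow> N = K"
    using noetherian_module_maximal[OF M F F'] by blast
  then obtain Z where Z: "K = mod_span A M Z" "finite Z" "Z \<subseteq> Y" by blast
  have "Y \<subseteq> K"
  proof
    fix x assume x: "x \<in> Y"
    then have "mod_span A M (insert x Z) \<in> ?F" using Z(2,3) by blast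
    moreover have "K \<subseteq> mod_span A M (insert x Z)" unfolding Z(1) by (rule mod_span_mono) blast
    ultimately have "mod_span A M (insert x Z) = K" by (rule K(2))
    then show "x \<in> K" using mod_span_superset[of "insert x Z" A M] by blast
  qed
  moreover have "submodule K A M" unfolding Z(1) by (rule M.mod_span_submodule) (use Z(3) Y in blast)
  ultimately have "mod_span A M Y \<subseteq> K" by (rule mod_span_minimal[rotated])
  then have "mod_span A M Z = mod_span A M Y"
    using Z(1) mod_span_mono[OF Z(3), of A M] by blast
  then show ?thesis using that Z(2,3) by blast
qed

lemma fin_gen_if_superfluous_kernel:
  assumes P: "left_module A P" and M: "left_module A M" and f: "f \<in> lin_maps A P M"
    and sup: "superfluous A P (a_kernel P M f)"
    and Y: "finite Y" "mod_span A M Y = f ` carrier P"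
  shows "fin_gen A P"
proof -
  interpret P: left_module A P by fact
  interpret M: left_module A M by fact
  have "Y \<subseteq> f ` carrier P" unfolding Y(2)[symmetric] by (rule mod_span_superset)
  then obtain Z where Z: "Z \<subseteq> carrier P" "finite Z" "Y = f ` Z"
    using finite_subset_image[OF Y(1)] by metis
  let ?S = "mod_span A P Z"
  have S: "submodule ?S A P" by (rule P.mod_span_submodule[OF Z(1)])
  have K: "submodule (a_kernel P M f) A P" using sup unfolding superfluous_def by blast
  have im: "submodule (f ` ?S) A M"
  proof (rule M.submoduleI)
    note c = submodule_in_carrier[OF S]
    show "f ` ?S \<subseteq> carrier M" using lin_maps_closed[OF f c] by blast
    show "\<zero>\<^bsub>M\<^esub> \<in> f ` ?S"
      using lin_maps_zero[OF P M f] submodule_zero[OF S] by (metis imageI)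
    show "x \<oplus>\<^bsub>M\<^esub> y \<in> f ` ?S" if "x \<in> f ` ?S" "y \<in> f ` ?S" for x y
      using that c submodule_add[OF S] by (auto simp flip: lin_maps_add[OF f])
    show "a \<odot>\<^bsub>M\<^esub> x \<in> f ` ?S" if "a \<in> carrier A" "x \<in> f ` ?S" for a x
      using that c submodule_smult[OF S] by (auto simp flip: lin_maps_smult[OF f])
  qed
  have "f ` carrier P \<subseteq> f ` ?S"
    unfolding Y(2)[symmetric] by (rule mod_span_minimal[OF im]) (use Z(3) mod_span_superset[of Z A P] in blast)
  have "carrier P \<subseteq> a_kernel P M f <+>\<^bsub>P\<^esub> ?S"
  proof
    fix p assume p: "p \<in> carrier P"
    then obtain s where s: "s \<in> ?S" "f p = f s" using \<open>f ` carrier P \<subseteq> f ` ?S\<close> by blast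
    have sc: "s \<in> carrier P" by (rule submodule_in_carrier[OF S s(1)])
    have "f (p \<ominus>\<^bsub>P\<^esub> s) = \<zero>\<^bsub>M\<^esub>"
      using lin_maps_minus[OF P M f p sc] s(2) lin_maps_closed[OF f sc] by (simp add: M.M.minus_eq M.M.r_neg)
    then have "p \<ominus>\<^bsub>P\<^esub> s \<in> a_kernel P M f" using p sc by (intro a_kernel_memI) auto
    then have "(p \<ominus>\<^bsub>P\<^esub> s) \<oplus>\<^bsub>P\<^esub> s \<in> a_kernel P M f <+>\<^bsub>P\<^esub> ?S" using s(1) by (rule P.set_add_memI)
    then show "p \<in> a_kernel P M f <+>\<^bsub>P\<^esub> ?S" using p sc by (simp add: P.M.minus_eq P.M.a_assoc P.M.l_neg)
  qed
  then have "a_kernel P M f <+>\<^bsub>P\<^esub> ?S = carrier P"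
    using submodule_subset[OF P.submodule_set_add[OF K S]] by blast
  then have "?S = carrier P" using sup S unfolding superfluous_def by blast
  then show ?thesis unfolding fin_gen_def using Z(1,2) by blast
qed

text \<open>Left ideals of A are R-submodules of the Noetherian R-module A, and generators over R
  also generate over A.\<close>

lemma (in finite_algebra) noetherian_if_fin_gen_algebra:
  assumes "left_module A M" "fin_gen A M"
  shows "noetherian_module A M"
proof (rule fin_gen_noetherian[OF _ assms])
  interpret reg: left_module A "reg_module A" by (rule A.reg_left_module)
  have toR: "submodule N R A" if N: "submodule N A (reg_module A)" for N
  proof (rule L.submoduleI)
    fix r x assume r: "r \<in> carrier R" and x: "x \<in> N"
    then have xc: "x \<in> carrier A" using submodule_in_carrier[OF N] by simp
    have "(r \<odot>\<^bsub>A\<^esub> \<one>\<^bsub>A\<^esub>) \<otimes>\<^bsub>A\<^esub> x \<in> N" using submodule_smult[OF N _ x] r by simp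
    then show "r \<odot>\<^bsub>A\<^esub> x \<in> N" using r xc by (simp add: A.smult_mult_left)
  qed (use submodule_subset[OF N] submodule_zero[OF N] submodule_add[OF N] in auto)
  show "noetherian_module A (reg_module A)"
    unfolding noetherian_module_def
  proof (intro conjI allI impI A.reg_left_module)
    fix N assume N: "submodule N A (reg_module A)"
    obtain Z where Z: "finite Z" "Z \<subseteq> N" "mod_span R A Z = N"
      using noetherian_A toR[OF N] unfolding noetherian_module_def by blast
    have "Z \<subseteq> carrier (reg_module A)" using Z(2) submodule_subset[OF N] by blast
    then have "N \<subseteq> mod_span A (reg_module A) Z"
      unfolding Z(3)[symmetric] by (intro mod_span_minimal toR reg.mod_span_submodule mod_span_superset)
    then show "\<exists>Z. finite Z \<and> Z \<subseteq> N \<and> mod_span A (reg_module A) Z = N"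
      using Z(1,2) mod_span_minimal[OF N Z(2)] by blast
  qed
qed

section \<open>Removing one projective summand\<close>

text \<open>Expresses P = A g P for a finitely generated P. For g = e_I it records that only the
  projectives \<Lambda> e_i with i in I occur in P, without decomposing P into
  indecomposables.\<close>

definition gen_by :: "('a, 'k) ring_scheme \<Rightarrow> ('a, 'p) module \<Rightarrow> 'a \<Rightarrow> bool" where
  "gen_by A P g \<longleftrightarrow>
     (\<exists>Z. finite Z \<and> Z \<subseteq> {z \<in> carrier P. g \<odot>\<^bsub>P\<^esub> z = z} \<and> mod_span A P Z = carrier P)"

lemma gen_byE:
  assumes "gen_by A P g"
  obtains Z where "finite Z" "Z \<subseteq> carrier P" "mod_span A P Z = carrier P" "\<And>z. z \<in> Z \<Longrightarrow> g \<odot>\<^bsub>P\<^esub> z = z"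
  using assms unfolding gen_by_def by blast

text \<open>The substitute for coordinates on P = A g P: a property stable under addition has to be
  checked only on terms f(p) z with z in g P.\<close>

lemma dual_basis_gen_by:
  fixes P :: "('a, 'p) module"
  assumes P: "projective A P" and g: "gen_by A P g" and p: "p \<in> carrier P"
    and H: "H \<subseteq> carrier P" "\<zero>\<^bsub>P\<^esub> \<in> H" "\<And>x y. \<lbrakk>x \<in> H; y \<in> H\<rbrakk> \<Longrightarrow> x \<oplus>\<^bsub>P\<^esub> y \<in> H"
    and fz: "\<And>f z. \<lbrakk>f \<in> lin_maps A P (reg_module A); z \<in> carrier P; g \<odot>\<^bsub>P\<^esub> z = z\<rbrakk> \<Longrightarrow> f p \<odot>\<^bsub>P\<^esub> z \<in> H"
  shows "p \<in> H"
proof -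
  obtain Z where Z: "finite Z" "Z \<subseteq> carrier P" "mod_span A P Z = carrier P" "\<And>z. z \<in> Z \<Longrightarrow> g \<odot>\<^bsub>P\<^esub> z = z"
    by (rule gen_byE[OF g]) blast
  show ?thesis
    by (rule projective_dual_basis[OF P Z(1-3) p H]) (use fz Z(2,4) in auto)
qed

lemma superfluous_form:
  fixes P :: "('a, 'p) module"
  assumes A: "ring A" and P: "left_module A P" and K: "superfluous A P K"
    and f: "f \<in> lin_maps A P (reg_module A)" and k: "k \<in> K" and c: "c \<in> carrier A"
  shows "\<exists>t\<in>carrier A. t \<otimes>\<^bsub>A\<^esub> (\<one>\<^bsub>A\<^esub> \<ominus>\<^bsub>A\<^esub> c \<otimes>\<^bsub>A\<^esub> f k) = \<one>\<^bsub>A\<^esub>"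
proof -
  interpret P: left_module A P by fact
  have reg: "left_module A (reg_module A)" by (rule P.A.reg_left_module)
  have subK: "submodule K A P" using K unfolding superfluous_def by blast
  have kc: "k \<in> carrier P" by (rule submodule_in_carrier[OF subK k])
  have fk: "f k \<in> carrier A" using lin_maps_closed[OF f kc] by simp
  have fc: "f p \<in> carrier A" if "p \<in> carrier P" for p using lin_maps_closed[OF f that] by simp
  let ?u = "\<one>\<^bsub>A\<^esub> \<ominus>\<^bsub>A\<^esub> c \<otimes>\<^bsub>A\<^esub> f k"
  have u: "?u \<in> carrier A" using c fk by simp
  let ?L = "{a \<odot>\<^bsub>reg_module A\<^esub> ?u | a. a \<in> carrier A}"
  have L: "submodule ?L A (reg_module A)"
    using left_module.cyclic_submodule[OF reg, of ?u] u by simp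
  let ?N = "{p \<in> carrier P. f p \<in> ?L}"
  have N: "submodule ?N A P" by (rule lin_maps_vimage_submodule[OF P reg f L])
  have "carrier P \<subseteq> K <+>\<^bsub>P\<^esub> ?N"
  proof
    fix p assume p: "p \<in> carrier P"
    let ?a = "f p \<otimes>\<^bsub>A\<^esub> c"
    have a: "?a \<in> carrier A" using fc[OF p] c by simp
    let ?q = "p \<ominus>\<^bsub>P\<^esub> ?a \<odot>\<^bsub>P\<^esub> k"
    have ak: "?a \<odot>\<^bsub>P\<^esub> k \<in> carrier P" using a kc by simp
    have "a_minus (reg_module A) = a_minus A" by (rule a_minus_cong) simp_all
    then have "f ?q = f p \<ominus>\<^bsub>A\<^esub> ?a \<otimes>\<^bsub>A\<^esub> f k"
      using lin_maps_minus[OF P reg f p ak] lin_maps_smult[OF f a kc] by simp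
    also have "\<dots> = f p \<otimes>\<^bsub>A\<^esub> ?u"
      using fc[OF p] c fk by (simp add: P.A.minus_eq P.A.r_distr P.A.r_minus P.A.m_assoc)
    finally have "?q \<in> ?N" using p ak fc[OF p] by auto
    moreover have "?a \<odot>\<^bsub>P\<^esub> k \<in> K" by (rule submodule_smult[OF subK a k])
    ultimately have "?a \<odot>\<^bsub>P\<^esub> k \<oplus>\<^bsub>P\<^esub> ?q \<in> K <+>\<^bsub>P\<^esub> ?N" by (intro P.set_add_memI)
    moreover have "?a \<odot>\<^bsub>P\<^esub> k \<oplus>\<^bsub>P\<^esub> ?q = p"
      using p ak by (simp add: P.M.minus_eq P.M.add_add_minus_cancel)
    ultimately show "p \<in> K <+>\<^bsub>P\<^esub> ?N" by simp
  qed
  then have "K <+>\<^bsub>P\<^esub> ?N = carrier P"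
    using submodule_subset[OF P.submodule_set_add[OF subK N]] by blast
  then have "?N = carrier P" using K N unfolding superfluous_def by blast
  then have "f k \<in> ?L" using kc by blast
  then obtain a where a: "a \<in> carrier A" "f k = a \<otimes>\<^bsub>A\<^esub> ?u" by auto
  have "(\<one>\<^bsub>A\<^esub> \<oplus>\<^bsub>A\<^esub> c \<otimes>\<^bsub>A\<^esub> a) \<otimes>\<^bsub>A\<^esub> ?u = ?u \<oplus>\<^bsub>A\<^esub> c \<otimes>\<^bsub>A\<^esub> (a \<otimes>\<^bsub>A\<^esub> ?u)"
    using a(1) c u by (simp add: P.A.l_distr P.A.m_assoc)
  also have "\<dots> = ?u \<oplus>\<^bsub>A\<^esub> c \<otimes>\<^bsub>A\<^esub> f k" unfolding a(2)[symmetric] ..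
  also have "\<dots> = \<one>\<^bsub>A\<^esub>" using c fk by (simp add: P.A.minus_add_cancel)
  finally show ?thesis using a(1) c by (intro bexI[of _ "\<one>\<^bsub>A\<^esub> \<oplus>\<^bsub>A\<^esub> c \<otimes>\<^bsub>A\<^esub> a"]) auto
qed

text \<open>The R-module g P, for an idempotent g described by fixed points. The complex g P is
  treated over the commutative ring R only; the action of B enters through individual
  multiplications.\<close>

definition fixed_part :: "('r, 'a) module \<Rightarrow> ('a, 'p) module \<Rightarrow> 'a \<Rightarrow> ('r, 'p) module" where
  "fixed_part A P g = (restrict_scalars A P)\<lparr>carrier := {z \<in> carrier P. g \<odot>\<^bsub>P\<^esub> z = z}\<rparr>"

lemma fixed_part_simps [simp]:
  "carrier (fixed_part A P g) = {z \<in> carrier P. g \<odot>\<^bsub>P\<^esub> z = z}"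
  "ring.zero (fixed_part A P g) = ring.zero P" "ring.add (fixed_part A P g) = ring.add P"
  "smult (fixed_part A P g) = (\<lambda>r x. (r \<odot>\<^bsub>A\<^esub> \<one>\<^bsub>A\<^esub>) \<odot>\<^bsub>P\<^esub> x)"
  by (simp_all add: fixed_part_def restrict_scalars_def)

context finite_algebra
begin

lemma left_module_restrict_scalars:
  assumes P: "left_module A P"
  shows "left_module R (restrict_scalars A P)"
proof -
  interpret P: left_module A P by fact
  show ?thesis
  proof (intro left_module.intro left_module_axioms.intro ring_axioms abelian_group_cong[OF P.M.abelian_group_axioms])
    fix a b x assume a: "a \<in> carrier R" and b: "b \<in> carrier R" and x: "x \<in> carrier (restrict_scalars A P)"
    have "(a \<otimes> b) \<odot>\<^bsub>A\<^esub> \<one>\<^bsub>A\<^esub> = (a \<odot>\<^bsub>A\<^esub> \<one>\<^bsub>A\<^esub>) \<otimes>\<^bsub>A\<^esub> (b \<odot>\<^bsub>A\<^esub> \<one>\<^bsub>A\<^esub>)"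
      using a b by (simp add: A.smult_mult_left L.smult_assoc)
    then show "(a \<otimes> b) \<odot>\<^bsub>restrict_scalars A P\<^esub> x = a \<odot>\<^bsub>restrict_scalars A P\<^esub> (b \<odot>\<^bsub>restrict_scalars A P\<^esub> x)"
      using a b x by (simp add: P.smult_assoc)
  qed (simp_all add: L.smult_l_distr P.smult_l_distr P.smult_r_distr)
qed

lemma scalar_comm:
  assumes P: "left_module A P" and "r \<in> carrier R" "a \<in> carrier A" "x \<in> carrier P"
  shows "a \<odot>\<^bsub>P\<^esub> ((r \<odot>\<^bsub>A\<^esub> \<one>\<^bsub>A\<^esub>) \<odot>\<^bsub>P\<^esub> x) = (r \<odot>\<^bsub>A\<^esub> \<one>\<^bsub>A\<^esub>) \<odot>\<^bsub>P\<^esub> (a \<odot>\<^bsub>P\<^esub> x)"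
proof -
  interpret P: left_module A P by fact
  show ?thesis using assms by (simp add: A.smult_mult_left A.smult_mult_right flip: P.smult_assoc)
qed

lemma left_module_fixed_part:
  assumes P: "left_module A P" and g: "g \<in> carrier A"
  shows "left_module R (fixed_part A P g)"
proof -
  interpret P: left_module A P by fact
  interpret Pr: left_module R "restrict_scalars A P" by (rule left_module_restrict_scalars[OF P])
  have ab: "abelian_group (fixed_part A P g)"
  proof (rule abelian_groupI)
    fix x assume x: "x \<in> carrier (fixed_part A P g)"
    then show "\<exists>y\<in>carrier (fixed_part A P g). y \<oplus>\<^bsub>fixed_part A P g\<^esub> x = \<zero>\<^bsub>fixed_part A P g\<^esub>"
      using g by (intro bexI[of _ "\<ominus>\<^bsub>P\<^esub> x"]) (auto simp: P.smult_r_minus P.M.l_neg)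
  qed (use g in \<open>auto simp: P.smult_r_distr P.M.a_assoc intro: P.M.a_comm\<close>)
  show ?thesis
  proof (intro left_module.intro left_module_axioms.intro ring_axioms ab)
    fix a b x y assume a: "a \<in> carrier R" and x: "x \<in> carrier (fixed_part A P g)"
    then have xP: "x \<in> carrier P" "g \<odot>\<^bsub>P\<^esub> x = x" by auto
    show "a \<odot>\<^bsub>fixed_part A P g\<^esub> x \<in> carrier (fixed_part A P g)"
      using scalar_comm[OF P a g xP(1)] a xP by simp
    show "(a \<oplus> b) \<odot>\<^bsub>fixed_part A P g\<^esub> x = a \<odot>\<^bsub>fixed_part A P g\<^esub> x \<oplus>\<^bsub>fixed_part A P g\<^esub> b \<odot>\<^bsub>fixed_part A P g\<^esub> x"
      "(a \<otimes> b) \<odot>\<^bsub>fixed_part A P g\<^esub> x = a \<odot>\<^bsub>fixed_part A P g\<^esub> (b \<odot>\<^bsub>fixed_part A P g\<^esub> x)"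
      if "b \<in> carrier R"
      using Pr.smult_l_distr[OF a that, of x] Pr.smult_assoc[OF a that, of x] xP by simp_all
    show "a \<odot>\<^bsub>fixed_part A P g\<^esub> (x \<oplus>\<^bsub>fixed_part A P g\<^esub> y)
        = a \<odot>\<^bsub>fixed_part A P g\<^esub> x \<oplus>\<^bsub>fixed_part A P g\<^esub> a \<odot>\<^bsub>fixed_part A P g\<^esub> y"
      if "y \<in> carrier (fixed_part A P g)"
      using Pr.smult_r_distr[OF a, of x y] xP that by simp
  next
    fix x assume "x \<in> carrier (fixed_part A P g)"
    then show "\<one> \<odot>\<^bsub>fixed_part A P g\<^esub> x = x" using Pr.smult_one[of x] by simp
  qed
qed

lemma fixed_part_lin_map:
  assumes P: "left_module A P" and Q: "left_module A Q" and f: "f \<in> lin_maps A P Q" and g: "g \<in> carrier A"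
  shows "f \<in> lin_maps R (fixed_part A P g) (fixed_part A Q g)"
proof (rule lin_mapsI)
  fix x assume x: "x \<in> carrier (fixed_part A P g)"
  then show "f x \<in> carrier (fixed_part A Q g)"
    using lin_maps_closed[OF f, of x] lin_maps_smult[OF f g, of x] by auto
qed (auto simp: lin_maps_add[OF f] lin_maps_smult[OF f])

end

declare corner_simps(1) [simp del] left_ideal_module_simps(1) [simp del]

text \<open>The data of a single step: \<open>g\<close> = e_I, \<open>u\<close> = e_i for the index
  to be removed, \<open>g'\<close> the sum of the others, and [a, b] the range of degrees in which
  P_j = \<Lambda> g P_j is known. The element \<open>w\<close> of the socle with w u outside V
  \<mm>^s is what remains of the definition of s_I.\<close>

locale summand_step = finite_algebra R \<mm> A
  for R :: "('r, 'k) ring_scheme" (structure) and \<mm> and A :: "('r, 'a) module" +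
  fixes P :: "nat \<Rightarrow> ('a, 'p) module" and \<delta> :: "nat \<Rightarrow> 'p \<Rightarrow> 'p"
    and g g' u :: 'a and xs :: "'r list" and w :: "'a set" and s a b :: nat
  assumes proj: "\<And>j. projective A (P j)" and fg: "\<And>j. fin_gen A (P j)"
    and dlin: "\<And>j. \<delta> (Suc j) \<in> lin_maps A (P (Suc j)) (P j)"
    and exact: "\<And>j. \<delta> (Suc (Suc j)) ` carrier (P (Suc (Suc j))) = a_kernel (P (Suc j)) (P j) (\<delta> (Suc j))"
    and sup: "\<And>j. superfluous A (P j) (\<delta> (Suc j) ` carrier (P (Suc j)))"
    and g: "g \<in> carrier A" "g \<otimes>\<^bsub>A\<^esub> g = g"
    and g': "g' \<in> carrier A" "g' \<otimes>\<^bsub>A\<^esub> g' = g'"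
    and u: "primitive_idempotent A u"
    and orth: "g' \<otimes>\<^bsub>A\<^esub> u = \<zero>\<^bsub>A\<^esub>" "u \<otimes>\<^bsub>A\<^esub> g' = \<zero>\<^bsub>A\<^esub>" "g = g' \<oplus>\<^bsub>A\<^esub> u"
    and gen: "\<And>j. \<lbrakk>a \<le> j; j \<le> b\<rbrakk> \<Longrightarrow> gen_by A (P j) g"
    and xs: "set xs \<subseteq> carrier R" and reg: "regular_seq R (corner A g) xs"
    and small: "\<And>j. j \<le> b \<Longrightarrow> \<delta> (Suc j) ` carrier (P (Suc j))
      \<subseteq> smult_span R (ideal_pow R \<mm> s) (restrict_scalars A (P j))"
    and w: "w \<in> socle (corner A g) (quot_right_module R (corner A g) xs)"
    and uw: "u \<odot>\<^bsub>quot_right_module R (corner A g) xs\<^esub> w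
      \<notin> smult_span R (ideal_pow R \<mm> s) (restrict_scalars (corner A g) (quot_right_module R (corner A g) xs))"
begin

abbreviation "B \<equiv> corner A g"
abbreviation "C j \<equiv> fixed_part A (P j) g"

sublocale Q: quotient_module R \<mm> "corner A g" xs
  by (intro quotient_module.intro quotient_module_axioms.intro corner_finite_algebra g xs)

lemma Pmod: "left_module A (P j)"
  using proj unfolding projective_def by blast

lemma u1: "u \<in> carrier A" "u \<otimes>\<^bsub>A\<^esub> u = u"
  using u unfolding primitive_idempotent_def by auto

lemma gu: "g \<otimes>\<^bsub>A\<^esub> u = u" "u \<otimes>\<^bsub>A\<^esub> g = u" "g \<otimes>\<^bsub>A\<^esub> g' = g'" "g' \<otimes>\<^bsub>A\<^esub> g = g'"
  using orth u1 g' by (simp_all add: A.l_distr A.r_distr)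

lemmas BD = A.corner_memD[OF g]
lemmas BI = A.corner_memI[OF g]

lemma uB: "u \<in> carrier B"
  by (rule BI) (use gu u1 in auto)

lemma form_closed: "\<lbrakk>f \<in> lin_maps A (P j) (reg_module A); y \<in> carrier (P j)\<rbrakk> \<Longrightarrow> f y \<in> carrier A"
  using lin_maps_closed by fastforce

lemma form_smult: "\<lbrakk>f \<in> lin_maps A (P j) (reg_module A); c \<in> carrier A; y \<in> carrier (P j)\<rbrakk> \<Longrightarrow>
    f (c \<odot>\<^bsub>P j\<^esub> y) = c \<otimes>\<^bsub>A\<^esub> f y"
  using lin_maps_smult[of f A "P j" "reg_module A" c y] by simp

lemma form_add: "\<lbrakk>f \<in> lin_maps A (P j) (reg_module A); x \<in> carrier (P j); y \<in> carrier (P j)\<rbrakk> \<Longrightarrow>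
    f (x \<oplus>\<^bsub>P j\<^esub> y) = f x \<oplus>\<^bsub>A\<^esub> f y"
  using lin_maps_add[of f A "P j" "reg_module A" x y] by simp

lemma scalar_mult: "\<lbrakk>r \<in> carrier R; c \<in> carrier A\<rbrakk> \<Longrightarrow> (r \<odot>\<^bsub>A\<^esub> \<one>\<^bsub>A\<^esub>) \<otimes>\<^bsub>A\<^esub> c = r \<odot>\<^bsub>A\<^esub> c"
  by (simp add: A.smult_mult_left)

lemma sandwich_B: "c \<in> carrier A \<Longrightarrow> g \<otimes>\<^bsub>A\<^esub> c \<otimes>\<^bsub>A\<^esub> g \<in> carrier B"
  unfolding corner_simps(1) by blast

text \<open>Together with \<open>act_lin\<close> this exhibits g P_j as a direct summand of a power
  of B: forms cut down to g A g lead into B, and multiplication of elements z of g P_j leads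
  back.\<close>

lemma sandwich_lin:
  assumes f: "f \<in> lin_maps A (P j) (reg_module A)"
  shows "(\<lambda>y. g \<otimes>\<^bsub>A\<^esub> f y \<otimes>\<^bsub>A\<^esub> g) \<in> lin_maps R (restrict_scalars A (P j)) B"
    "(\<lambda>y. g \<otimes>\<^bsub>A\<^esub> f y \<otimes>\<^bsub>A\<^esub> g) \<in> lin_maps R (C j) B"
proof -
  interpret P: left_module A "P j" by (rule Pmod)
  have smult: "g \<otimes>\<^bsub>A\<^esub> f ((r \<odot>\<^bsub>A\<^esub> \<one>\<^bsub>A\<^esub>) \<odot>\<^bsub>P j\<^esub> y) \<otimes>\<^bsub>A\<^esub> g = r \<odot>\<^bsub>A\<^esub> (g \<otimes>\<^bsub>A\<^esub> f y \<otimes>\<^bsub>A\<^esub> g)"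
    if "r \<in> carrier R" "y \<in> carrier (P j)" for r y
    using that g form_closed[OF f that(2)]
    by (simp add: form_smult[OF f] scalar_mult A.smult_mult_left A.smult_mult_right)
  have add: "g \<otimes>\<^bsub>A\<^esub> f (x \<oplus>\<^bsub>P j\<^esub> y) \<otimes>\<^bsub>A\<^esub> g = (g \<otimes>\<^bsub>A\<^esub> f x \<otimes>\<^bsub>A\<^esub> g) \<oplus>\<^bsub>A\<^esub> (g \<otimes>\<^bsub>A\<^esub> f y \<otimes>\<^bsub>A\<^esub> g)"
    if "x \<in> carrier (P j)" "y \<in> carrier (P j)" for x y
    using that g form_closed[OF f] by (simp add: form_add[OF f] A.r_distr A.l_distr)
  show "(\<lambda>y. g \<otimes>\<^bsub>A\<^esub> f y \<otimes>\<^bsub>A\<^esub> g) \<in> lin_maps R (restrict_scalars A (P j)) B"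
    "(\<lambda>y. g \<otimes>\<^bsub>A\<^esub> f y \<otimes>\<^bsub>A\<^esub> g) \<in> lin_maps R (C j) B"
    using smult add sandwich_B form_closed[OF f] by (auto intro!: lin_mapsI)
qed

lemma act_lin:
  assumes z: "z \<in> carrier (C j)"
  shows "(\<lambda>c. c \<odot>\<^bsub>P j\<^esub> z) \<in> lin_maps R B (C j)"
proof -
  interpret P: left_module A "P j" by (rule Pmod)
  have zP: "z \<in> carrier (P j)" using z by simp
  show ?thesis
  proof (rule lin_mapsI)
    fix c assume c: "c \<in> carrier B"
    note cD = BD[OF c]
    show "c \<odot>\<^bsub>P j\<^esub> z \<in> carrier (C j)" using cD g(1) zP by (simp flip: P.smult_assoc)
    show "(c \<oplus>\<^bsub>B\<^esub> d) \<odot>\<^bsub>P j\<^esub> z = c \<odot>\<^bsub>P j\<^esub> z \<oplus>\<^bsub>C j\<^esub> d \<odot>\<^bsub>P j\<^esub> z" if "d \<in> carrier B" for d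
      using P.smult_l_distr[OF cD(1) BD(1)[OF that] zP] by simp
    show "(r \<odot>\<^bsub>B\<^esub> c) \<odot>\<^bsub>P j\<^esub> z = r \<odot>\<^bsub>C j\<^esub> (c \<odot>\<^bsub>P j\<^esub> z)" if "r \<in> carrier R" for r
      using P.smult_assoc[of "r \<odot>\<^bsub>A\<^esub> \<one>\<^bsub>A\<^esub>" c z] that cD(1) zP by (simp add: scalar_mult)
  qed
qed

lemma Cmod: "left_module R (C j)"
  by (rule left_module_fixed_part[OF Pmod g(1)])

lemma Xset: "set (take i xs) \<subseteq> carrier R"
  using xs set_take_subset[of i xs] by blast

text \<open>Regularity passes from B to its summands. For y in g P_j the values g f(y) g inherit the
  relation from y, regularity on B applies to them, and the dual basis reassembles y from the terms
  g f(y) g z.\<close>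

lemma regular_on_C:
  assumes i: "i < length xs" and j: "a \<le> j" "j \<le> b" and y: "y \<in> carrier (C j)"
    and xy: "(xs ! i) \<odot>\<^bsub>C j\<^esub> y \<in> smult_span R (set (take i xs)) (C j)"
  shows "y \<in> smult_span R (set (take i xs)) (C j)"
proof (rule dual_basis_gen_by[OF proj gen[OF j]])
  interpret P: left_module A "P j" by (rule Pmod)
  interpret Cj: left_module R "C j" by (rule Cmod)
  let ?S = "set (take i xs)"
  note sub = Cj.smult_span_submodule[OF Xset[of i]]
  show yP: "y \<in> carrier (P j)" using y by simp
  show "smult_span R ?S (C j) \<subseteq> carrier (P j)" using submodule_subset[OF sub] by auto
  show "\<zero>\<^bsub>P j\<^esub> \<in> smult_span R ?S (C j)" using submodule_zero[OF sub] by simp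
  show "v \<oplus>\<^bsub>P j\<^esub> v' \<in> smult_span R ?S (C j)"
    if "v \<in> smult_span R ?S (C j)" "v' \<in> smult_span R ?S (C j)" for v v'
    using submodule_add[OF sub that] by simp
  fix f z assume f: "f \<in> lin_maps A (P j) (reg_module A)" and z: "z \<in> carrier (P j)" "g \<odot>\<^bsub>P j\<^esub> z = z"
  have x: "xs ! i \<in> carrier R" using xs i nth_mem by blast
  let ?\<phi> = "\<lambda>y. g \<otimes>\<^bsub>A\<^esub> f y \<otimes>\<^bsub>A\<^esub> g"
  note \<phi> = sandwich_lin(2)[OF f]
  have "?\<phi> ((xs ! i) \<odot>\<^bsub>C j\<^esub> y) \<in> smult_span R ?S B"
    by (rule lin_maps_smult_span[OF Cmod Q.left_module_R \<phi> Xset xy])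
  then have "(xs ! i) \<odot>\<^bsub>B\<^esub> ?\<phi> y \<in> smult_span R ?S B"
    using lin_maps_smult[OF \<phi> x y] by simp
  then have "?\<phi> y \<in> smult_span R ?S B"
    using reg i lin_maps_closed[OF \<phi> y] unfolding regular_seq_def by blast
  then have "?\<phi> y \<odot>\<^bsub>P j\<^esub> z \<in> smult_span R ?S (C j)"
    using z by (intro lin_maps_smult_span[OF Q.left_module_R Cmod act_lin Xset]) auto
  moreover have "?\<phi> y \<odot>\<^bsub>P j\<^esub> z = f y \<odot>\<^bsub>P j\<^esub> z"
  proof -
    have "g \<otimes>\<^bsub>A\<^esub> f y = f y" using form_smult[OF f g(1) yP] y by simp
    then show ?thesis using form_closed[OF f yP] g(1) z by (simp add: P.smult_assoc)
  qed
  ultimately show "f y \<odot>\<^bsub>P j\<^esub> z \<in> smult_span R ?S (C j)" by simp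
qed

lemma socle_kills_radical:
  assumes q: "q \<in> \<delta> (Suc k) ` carrier (P (Suc k))" and f: "f \<in> lin_maps A (P k) (reg_module A)"
  shows "(u \<otimes>\<^bsub>A\<^esub> f q \<otimes>\<^bsub>A\<^esub> g) \<odot>\<^bsub>Q.V\<^esub> w = \<zero>\<^bsub>Q.V\<^esub>"
proof (rule Q.V.socle_annihilated[OF _ _ w])
  have qP: "q \<in> carrier (P k)" using q lin_maps_closed[OF dlin] by blast
  have fq: "f q \<in> carrier A" by (rule form_closed[OF f qP])
  let ?a = "u \<otimes>\<^bsub>A\<^esub> f q \<otimes>\<^bsub>A\<^esub> g"
  have "g \<otimes>\<^bsub>A\<^esub> (u \<otimes>\<^bsub>A\<^esub> f q) = u \<otimes>\<^bsub>A\<^esub> f q"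
    using gu(1) g(1) u1(1) fq by (simp flip: A.m_assoc)
  then show "?a \<in> carrier B" using sandwich_B[of "u \<otimes>\<^bsub>A\<^esub> f q"] u1(1) fq by simp
  fix b' c' assume b': "b' \<in> carrier B" and c': "c' \<in> carrier B"
  note bD = BD[OF b'] and cD = BD[OF c']
  let ?x = "b' \<otimes>\<^bsub>A\<^esub> u \<otimes>\<^bsub>A\<^esub> f q"
  have xA: "?x \<in> carrier A" using bD u1 fq by simp
  have "\<exists>t\<in>carrier A. (\<one>\<^bsub>A\<^esub> \<ominus>\<^bsub>A\<^esub> ?x \<otimes>\<^bsub>A\<^esub> c') \<otimes>\<^bsub>A\<^esub> t = \<one>\<^bsub>A\<^esub>"
  proof (rule A.right_invertible_if_left_radical[OF xA _ cD(1)])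
    fix y assume y: "y \<in> carrier A"
    have "\<exists>t\<in>carrier A. t \<otimes>\<^bsub>A\<^esub> (\<one>\<^bsub>A\<^esub> \<ominus>\<^bsub>A\<^esub> (y \<otimes>\<^bsub>A\<^esub> b' \<otimes>\<^bsub>A\<^esub> u) \<otimes>\<^bsub>A\<^esub> f q) = \<one>\<^bsub>A\<^esub>"
      by (rule superfluous_form[OF A.ring_axioms Pmod sup f q]) (use y bD u1 in simp)
    then show "\<exists>t\<in>carrier A. t \<otimes>\<^bsub>A\<^esub> (\<one>\<^bsub>A\<^esub> \<ominus>\<^bsub>A\<^esub> y \<otimes>\<^bsub>A\<^esub> ?x) = \<one>\<^bsub>A\<^esub>"
      using y bD(1) u1(1) fq by (simp add: A.m_assoc)
  qed
  then obtain t where t: "t \<in> carrier A" "(\<one>\<^bsub>A\<^esub> \<ominus>\<^bsub>A\<^esub> ?x \<otimes>\<^bsub>A\<^esub> c') \<otimes>\<^bsub>A\<^esub> t = \<one>\<^bsub>A\<^esub>" by blast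
  let ?d = "?x \<otimes>\<^bsub>A\<^esub> c'"
  have dA: "?d \<in> carrier A" using xA cD by simp
  have gd: "g \<otimes>\<^bsub>A\<^esub> ?d = ?d" using bD g(1) u1(1) fq cD(1) by (simp flip: A.m_assoc)
  have dg: "?d \<otimes>\<^bsub>A\<^esub> g = ?d" using cD g(1) xA by (simp add: A.m_assoc)
  have dB: "?d \<in> carrier B" by (rule BI[OF gd dg dA])
  have gc: "g \<otimes>\<^bsub>A\<^esub> c' = c'" by (rule cD(2))
  have prod: "b' \<otimes>\<^bsub>B\<^esub> ?a \<otimes>\<^bsub>B\<^esub> c' = ?d"
    using bD(1) cD(1) u1(1) fq g(1) gc by (simp add: A.m_assoc)
  have gB: "g \<in> carrier B" by (rule BI[OF g(2) g(2) g(1)])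
  have diff: "\<one>\<^bsub>B\<^esub> \<ominus>\<^bsub>B\<^esub> ?d = g \<ominus>\<^bsub>A\<^esub> ?d" using A.corner_minus[OF g gB dB] by simp
  have gm: "g \<ominus>\<^bsub>A\<^esub> ?d \<in> carrier A" using g(1) dA by simp
  have l: "(g \<ominus>\<^bsub>A\<^esub> ?d) \<otimes>\<^bsub>A\<^esub> g = g \<ominus>\<^bsub>A\<^esub> ?d"
    using g dA dg by (simp add: A.minus_eq A.l_distr A.l_minus)
  have r: "g \<ominus>\<^bsub>A\<^esub> ?d = g \<otimes>\<^bsub>A\<^esub> (\<one>\<^bsub>A\<^esub> \<ominus>\<^bsub>A\<^esub> ?d)"
    using g(1) dA gd by (simp add: A.minus_eq A.r_distr A.r_minus)
  \<comment> \<open>A right inverse t of 1 - d in \<Lambda> compresses to the right inverse g t g of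
    g - d in B, because d is in g \<Lambda> g.\<close>
  have "(g \<ominus>\<^bsub>A\<^esub> ?d) \<otimes>\<^bsub>A\<^esub> (g \<otimes>\<^bsub>A\<^esub> t \<otimes>\<^bsub>A\<^esub> g) = ((g \<ominus>\<^bsub>A\<^esub> ?d) \<otimes>\<^bsub>A\<^esub> g) \<otimes>\<^bsub>A\<^esub> (t \<otimes>\<^bsub>A\<^esub> g)"
    using gm g(1) t(1) by (simp add: A.m_assoc)
  also have "\<dots> = (g \<ominus>\<^bsub>A\<^esub> ?d) \<otimes>\<^bsub>A\<^esub> (t \<otimes>\<^bsub>A\<^esub> g)" by (simp only: l)
  also have "\<dots> = (g \<otimes>\<^bsub>A\<^esub> (\<one>\<^bsub>A\<^esub> \<ominus>\<^bsub>A\<^esub> ?d)) \<otimes>\<^bsub>A\<^esub> (t \<otimes>\<^bsub>A\<^esub> g)" by (simp only: r[symmetric])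
  also have "\<dots> = g \<otimes>\<^bsub>A\<^esub> ((\<one>\<^bsub>A\<^esub> \<ominus>\<^bsub>A\<^esub> ?d) \<otimes>\<^bsub>A\<^esub> t) \<otimes>\<^bsub>A\<^esub> g"
    using g(1) dA t(1) by (simp add: A.m_assoc)
  also have "\<dots> = g" unfolding t(2) using g by simp
  finally have "(\<one>\<^bsub>B\<^esub> \<ominus>\<^bsub>B\<^esub> b' \<otimes>\<^bsub>B\<^esub> ?a \<otimes>\<^bsub>B\<^esub> c') \<otimes>\<^bsub>B\<^esub> (g \<otimes>\<^bsub>A\<^esub> t \<otimes>\<^bsub>A\<^esub> g) = \<one>\<^bsub>B\<^esub>"
    unfolding prod diff by simp
  then show "\<exists>t\<in>carrier B. (\<one>\<^bsub>B\<^esub> \<ominus>\<^bsub>B\<^esub> b' \<otimes>\<^bsub>B\<^esub> ?a \<otimes>\<^bsub>B\<^esub> c') \<otimes>\<^bsub>B\<^esub> t = \<one>\<^bsub>B\<^esub>"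
    using sandwich_B[OF t(1)] by blast
qed

end

context summand_step
begin

text \<open>The element y = \<beta> u p of g P_(k+1) stands for w \<otimes> u p. Its differential
  vanishes modulo (x) because radical values kill w. Exactness modulo (x) makes y a boundary up to
  (x), and boundaries lie in \<mm>^s P. Applying the form gives the assertion in V = B / (x)
  B.\<close>

lemma socle_times_form:
  assumes k: "a + length xs \<le> k" "Suc k \<le> b" and p: "p \<in> carrier (P (Suc k))"
    and f: "f \<in> lin_maps A (P (Suc k)) (reg_module A)"
  shows "(u \<otimes>\<^bsub>A\<^esub> f p \<otimes>\<^bsub>A\<^esub> g) \<odot>\<^bsub>Q.V\<^esub> w \<in> Q.W s"
proof -
  interpret P0: left_module A "P k" by (rule Pmod)
  interpret P1: left_module A "P (Suc k)" by (rule Pmod)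
  interpret C0: left_module R "C k" by (rule Cmod)
  interpret C1: left_module R "C (Suc k)" by (rule Cmod)
  interpret J: ideal Q.J B by (rule Q.J_ideal)
  let ?S = "set xs"
  have "w \<in> carrier Q.V" by (rule submodule_in_carrier[OF Q.V.submodule_socle w])
  then obtain \<beta> where \<beta>: "\<beta> \<in> carrier B" "w = Q.\<pi> \<beta>" by (auto simp: Q.V_simps)
  note \<beta>D = BD[OF \<beta>(1)]
  let ?c = "\<beta> \<otimes>\<^bsub>A\<^esub> u"
  have c: "?c \<in> carrier A" "g \<otimes>\<^bsub>A\<^esub> ?c = ?c"
    using \<beta>D u1 g(1) by (simp_all flip: A.m_assoc)
  let ?q = "\<delta> (Suc k) p"
  have q: "?q \<in> \<delta> (Suc k) ` carrier (P (Suc k))" using p by blast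
  have qP: "?q \<in> carrier (P k)" by (rule lin_maps_closed[OF dlin p])
  note sub0 = C0.smult_span_submodule[OF xs] and sub1 = C1.smult_span_submodule[OF xs]
  \<comment> \<open>Each term c h(q) z of c q equals (\<beta> u h(q) g) z. The factor in parentheses
    lies in (x) B, since its class in V is w u h(q) g = 0.\<close>
  have dual: "?q \<in> {y \<in> carrier (P k). ?c \<odot>\<^bsub>P k\<^esub> y \<in> smult_span R ?S (C k)}"
  proof (rule dual_basis_gen_by[OF proj gen qP])
    show "a \<le> k" "k \<le> b" using k by auto
    show "\<zero>\<^bsub>P k\<^esub> \<in> {y \<in> carrier (P k). ?c \<odot>\<^bsub>P k\<^esub> y \<in> smult_span R ?S (C k)}"
      using c submodule_zero[OF sub0] by simp
    show "x \<oplus>\<^bsub>P k\<^esub> y \<in> {y \<in> carrier (P k). ?c \<odot>\<^bsub>P k\<^esub> y \<in> smult_span R ?S (C k)}"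
      if "x \<in> {y \<in> carrier (P k). ?c \<odot>\<^bsub>P k\<^esub> y \<in> smult_span R ?S (C k)}"
        "y \<in> {y \<in> carrier (P k). ?c \<odot>\<^bsub>P k\<^esub> y \<in> smult_span R ?S (C k)}" for x y
      using that c(1) submodule_add[OF sub0, of "?c \<odot>\<^bsub>P k\<^esub> x" "?c \<odot>\<^bsub>P k\<^esub> y"] by (simp add: P0.smult_r_distr)
    fix h z assume h: "h \<in> lin_maps A (P k) (reg_module A)" and z: "z \<in> carrier (P k)" "g \<odot>\<^bsub>P k\<^esub> z = z"
    have hq: "h ?q \<in> carrier A" by (rule form_closed[OF h qP])
    let ?a = "u \<otimes>\<^bsub>A\<^esub> h ?q \<otimes>\<^bsub>A\<^esub> g"
    have "g \<otimes>\<^bsub>A\<^esub> (u \<otimes>\<^bsub>A\<^esub> h ?q) = u \<otimes>\<^bsub>A\<^esub> h ?q" using gu(1) g(1) u1(1) hq by (simp flip: A.m_assoc)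
    then have aB: "?a \<in> carrier B" using sandwich_B[of "u \<otimes>\<^bsub>A\<^esub> h ?q"] u1(1) hq by simp
    have bB: "\<beta> \<otimes>\<^bsub>B\<^esub> ?a \<in> carrier B" by (rule Q.A.m_closed[OF \<beta>(1) aB])
    have "Q.\<pi> (\<beta> \<otimes>\<^bsub>B\<^esub> ?a) = ?a \<odot>\<^bsub>Q.V\<^esub> w" unfolding \<beta>(2) by (rule Q.V_simps(4)[OF aB \<beta>(1), symmetric])
    also have "\<dots> = Q.J" using socle_kills_radical[OF q h] by (simp add: Q.V_simps(2))
    finally have "\<beta> \<otimes>\<^bsub>B\<^esub> ?a \<in> Q.J" using J.a_rcos_self[OF bB] by simp
    then have "(\<beta> \<otimes>\<^bsub>B\<^esub> ?a) \<odot>\<^bsub>P k\<^esub> z \<in> smult_span R ?S (C k)"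
      using z by (intro lin_maps_smult_span[OF Q.left_module_R Cmod act_lin xs]) auto
    moreover have "(\<beta> \<otimes>\<^bsub>B\<^esub> ?a) \<odot>\<^bsub>P k\<^esub> z = ?c \<odot>\<^bsub>P k\<^esub> (h ?q \<odot>\<^bsub>P k\<^esub> z)"
    proof -
      have "(\<beta> \<otimes>\<^bsub>B\<^esub> ?a) \<odot>\<^bsub>P k\<^esub> z = ((?c \<otimes>\<^bsub>A\<^esub> h ?q) \<otimes>\<^bsub>A\<^esub> g) \<odot>\<^bsub>P k\<^esub> z"
        using \<beta>D(1) u1(1) hq g(1) by (simp add: A.m_assoc)
      also have "\<dots> = (?c \<otimes>\<^bsub>A\<^esub> h ?q) \<odot>\<^bsub>P k\<^esub> (g \<odot>\<^bsub>P k\<^esub> z)"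
        by (rule P0.smult_assoc) (use c hq g(1) z in auto)
      also have "\<dots> = ?c \<odot>\<^bsub>P k\<^esub> (h ?q \<odot>\<^bsub>P k\<^esub> z)"
        unfolding z(2) by (rule P0.smult_assoc[OF c(1) hq z(1)])
      finally show ?thesis .
    qed
    ultimately show "h ?q \<odot>\<^bsub>P k\<^esub> z \<in> {y \<in> carrier (P k). ?c \<odot>\<^bsub>P k\<^esub> y \<in> smult_span R ?S (C k)}"
      using hq z by simp
  qed auto
  let ?y = "?c \<odot>\<^bsub>P (Suc k)\<^esub> p"
  have yC: "?y \<in> carrier (C (Suc k))"
    using c p g(1) P1.smult_assoc[OF g(1) c(1) p] by simp
  have \<delta>y: "\<delta> (Suc k) ?y \<in> smult_span R ?S (C k)"
    using dual lin_maps_smult[OF dlin c(1) p] by simp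
  have DD: "\<delta> (Suc j) (\<delta> (Suc (Suc j)) v) = \<zero>\<^bsub>C j\<^esub>" if "v \<in> carrier (C (Suc (Suc j)))" for j v
  proof -
    have "\<delta> (Suc (Suc j)) v \<in> a_kernel (P (Suc j)) (P j) (\<delta> (Suc j))"
      unfolding exact[symmetric] using that by simp
    then show ?thesis using a_kernel_memD by fastforce
  qed
  \<comment> \<open>Exactness survives the passage to g P: a preimage may be multiplied by
    g.\<close>
  have exC: "\<exists>v\<in>carrier (C (Suc (Suc j))). y = \<delta> (Suc (Suc j)) v"
    if y: "y \<in> carrier (C (Suc j))" "\<delta> (Suc j) y = \<zero>\<^bsub>C j\<^esub>" for j y
  proof -
    interpret P2: left_module A "P (Suc (Suc j))" by (rule Pmod)
    have "y \<in> a_kernel (P (Suc j)) (P j) (\<delta> (Suc j))" using y by (intro a_kernel_memI) simp_all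
    then obtain v where v: "v \<in> carrier (P (Suc (Suc j)))" "y = \<delta> (Suc (Suc j)) v"
      unfolding exact[symmetric] by blast
    have "\<delta> (Suc (Suc j)) (g \<odot>\<^bsub>P (Suc (Suc j))\<^esub> v) = y"
      using lin_maps_smult[OF dlin g(1) v(1)] v(2) y(1) by simp
    moreover have "g \<odot>\<^bsub>P (Suc (Suc j))\<^esub> v \<in> carrier (C (Suc (Suc j)))"
      using v(1) g by (simp flip: P2.smult_assoc)
    ultimately show ?thesis by blast
  qed
  have "\<exists>v\<in>smult_span R (set (take (length xs) xs)) (C (Suc k)). \<exists>v'\<in>carrier (C (Suc (Suc k))).
      ?y = v \<oplus>\<^bsub>C (Suc k)\<^esub> \<delta> (Suc (Suc k)) v'"
  proof (rule exact_mod_regular[where D = \<delta> and a = a and b = b])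
    show "cring R" by (rule is_cring)
    show "\<delta> (Suc j) \<in> lin_maps R (C (Suc j)) (C j)" for j
      by (rule fixed_part_lin_map[OF Pmod Pmod dlin g(1)])
    show "\<delta> (Suc k) ?y \<in> smult_span R (set (take (length xs) xs)) (C k)" using \<delta>y by simp
  qed (use Cmod DD exC xs regular_on_C k yC in auto)
  then obtain v v' where v: "v \<in> smult_span R ?S (C (Suc k))" and v': "v' \<in> carrier (C (Suc (Suc k)))"
    and y_eq: "?y = v \<oplus>\<^bsub>P (Suc k)\<^esub> \<delta> (Suc (Suc k)) v'" by auto
  have vP: "v \<in> carrier (P (Suc k))" using submodule_in_carrier[OF sub1 v] by simp
  let ?v = "\<delta> (Suc (Suc k)) v'"
  have v'P: "?v \<in> carrier (P (Suc k))" using v' by (intro lin_maps_closed[OF dlin]) simp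
  have v's: "?v \<in> smult_span R (ideal_pow R \<mm> s) (restrict_scalars A (P (Suc k)))"
    using small[OF k(2)] v' by auto
  let ?\<phi> = "\<lambda>y. g \<otimes>\<^bsub>A\<^esub> f y \<otimes>\<^bsub>A\<^esub> g"
  note \<phi> = sandwich_lin[OF f]
  have \<phi>B: "?\<phi> y \<in> carrier B" if "y \<in> carrier (P (Suc k))" for y
    by (rule sandwich_B[OF form_closed[OF f that]])
  have \<phi>v: "?\<phi> v \<in> Q.J" by (rule lin_maps_smult_span[OF Cmod Q.left_module_R \<phi>(2) xs v])
  have \<phi>v': "?\<phi> ?v \<in> Q.K s"
    by (rule lin_maps_smult_span[OF left_module_restrict_scalars[OF Pmod] Q.left_module_R \<phi>(1) ideal_pow_subset v's])
  have fp: "f p \<in> carrier A" by (rule form_closed[OF f p])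
  let ?a = "u \<otimes>\<^bsub>A\<^esub> f p \<otimes>\<^bsub>A\<^esub> g"
  have "g \<otimes>\<^bsub>A\<^esub> (u \<otimes>\<^bsub>A\<^esub> f p) = u \<otimes>\<^bsub>A\<^esub> f p" using gu(1) g(1) u1(1) fp by (simp flip: A.m_assoc)
  then have aB: "?a \<in> carrier B" using sandwich_B[of "u \<otimes>\<^bsub>A\<^esub> f p"] u1(1) fp by simp
  have "\<beta> \<otimes>\<^bsub>B\<^esub> ?a = (g \<otimes>\<^bsub>A\<^esub> ?c) \<otimes>\<^bsub>A\<^esub> f p \<otimes>\<^bsub>A\<^esub> g"
    unfolding c(2) using \<beta>D(1) u1(1) fp g(1) by (simp add: A.m_assoc)
  also have "\<dots> = ?\<phi> ?y" using form_smult[OF f c(1) p] c(1) g(1) fp by (simp add: A.m_assoc)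
  also have "\<dots> = ?\<phi> v \<oplus>\<^bsub>A\<^esub> ?\<phi> ?v"
    unfolding y_eq using lin_maps_add[OF \<phi>(1), of v ?v] vP v'P by simp
  finally have "?a \<odot>\<^bsub>Q.V\<^esub> w = Q.\<pi> (?\<phi> v \<oplus>\<^bsub>B\<^esub> ?\<phi> ?v)"
    unfolding \<beta>(2) using Q.V_simps(4)[OF aB \<beta>(1)] by simp
  also have "\<dots> = Q.\<pi> (?\<phi> v) \<oplus>\<^bsub>Q.V\<^esub> Q.\<pi> (?\<phi> ?v)"
    by (rule Q.V_simps(3)[symmetric]) (use \<phi>B vP v'P in auto)
  also have "\<dots> = Q.\<pi> (?\<phi> ?v)"
    using Q.pi_zero[OF \<phi>v] Q.pi_in_V[OF \<phi>B[OF v'P]] by simp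
  also have "\<dots> \<in> Q.W s" by (rule Q.pi_W[OF \<phi>v'])
  finally show ?thesis .
qed

text \<open>If t inverts u f(p) u in the corner of u, then replacing p by u t u p normalises the
  value to u. Multiplying w by it yields w u in V \<mm>^s, against the choice of w.\<close>

lemma not_left_invertible:
  assumes k: "a + length xs \<le> k" "Suc k \<le> b" and p: "p \<in> carrier (P (Suc k))"
    and f: "f \<in> lin_maps A (P (Suc k)) (reg_module A)"
    and t: "t \<in> carrier A" "t \<otimes>\<^bsub>A\<^esub> (u \<otimes>\<^bsub>A\<^esub> f p \<otimes>\<^bsub>A\<^esub> u) = u"
  shows False
proof -
  interpret P1: left_module A "P (Suc k)" by (rule Pmod)
  have fp: "f p \<in> carrier A" by (rule form_closed[OF f p])
  let ?c = "u \<otimes>\<^bsub>A\<^esub> t \<otimes>\<^bsub>A\<^esub> u"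
  let ?p = "?c \<odot>\<^bsub>P (Suc k)\<^esub> p"
  have c: "?c \<in> carrier A" using t(1) u1 by simp
  have pP: "?p \<in> carrier (P (Suc k))" using c p by simp
  have fp': "f ?p = ?c \<otimes>\<^bsub>A\<^esub> f p" by (rule form_smult[OF f c p])
  let ?a = "u \<otimes>\<^bsub>A\<^esub> f ?p \<otimes>\<^bsub>A\<^esub> g"
  have fpc: "f ?p \<in> carrier A" by (rule form_closed[OF f pP])
  have "g \<otimes>\<^bsub>A\<^esub> (u \<otimes>\<^bsub>A\<^esub> f ?p) = u \<otimes>\<^bsub>A\<^esub> f ?p" using gu(1) g(1) u1(1) fpc by (simp flip: A.m_assoc)
  then have aB: "?a \<in> carrier B" using sandwich_B[of "u \<otimes>\<^bsub>A\<^esub> f ?p"] u1(1) fpc by simp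
  have wV: "w \<in> carrier Q.V" by (rule submodule_in_carrier[OF Q.V.submodule_socle w])
  have "u \<odot>\<^bsub>Q.V\<^esub> (?a \<odot>\<^bsub>Q.V\<^esub> w) \<in> Q.W s"
    by (rule Q.W_smult[OF uB socle_times_form[OF k pP f]])
  moreover have "u \<odot>\<^bsub>Q.V\<^esub> (?a \<odot>\<^bsub>Q.V\<^esub> w) = (?a \<otimes>\<^bsub>B\<^esub> u) \<odot>\<^bsub>Q.V\<^esub> w"
    by (rule Q.V.smult_assoc[OF uB aB wV])
  moreover have "?a \<otimes>\<^bsub>B\<^esub> u = u"
  proof -
    have "?a \<otimes>\<^bsub>A\<^esub> u = (u \<otimes>\<^bsub>A\<^esub> u) \<otimes>\<^bsub>A\<^esub> (t \<otimes>\<^bsub>A\<^esub> (u \<otimes>\<^bsub>A\<^esub> f p \<otimes>\<^bsub>A\<^esub> (g \<otimes>\<^bsub>A\<^esub> u)))"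
      unfolding fp' using u1(1) t(1) fp g(1) by (simp add: A.m_assoc)
    also have "\<dots> = u" unfolding gu(1) t(2) using u1 by simp
    finally show ?thesis by simp
  qed
  ultimately show False using uw by simp
qed

text \<open>The argument of Nakayama's lemma inside the local ring u \<Lambda> u. A maximal proper
  submodule L containing g' P contains all (u f(y) u) v with v in u P, hence u P by the dual basis,
  and so g P, which generates P.\<close>

theorem gen_by_complement:
  assumes j: "a + length xs + 1 \<le> j" "j \<le> b"
  shows "gen_by A (P j) g'"
proof -
  obtain k where jk: "j = Suc k" using j(1) by (cases j) auto
  have k: "a + length xs \<le> k" "Suc k \<le> b" using j jk by auto
  interpret P: left_module A "P j" by (rule Pmod)
  have noeth: "noetherian_module A (P j)" by (rule noetherian_if_fin_gen_algebra[OF Pmod fg])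
  let ?Y = "{z \<in> carrier (P j). g' \<odot>\<^bsub>P j\<^esub> z = z}"
  let ?N = "mod_span A (P j) ?Y"
  have N: "submodule ?N A (P j)" by (rule P.mod_span_submodule) blast
  have nli: False if "p \<in> carrier (P j)" "f \<in> lin_maps A (P j) (reg_module A)"
      "t \<in> carrier A" "t \<otimes>\<^bsub>A\<^esub> (u \<otimes>\<^bsub>A\<^esub> f p \<otimes>\<^bsub>A\<^esub> u) = u" for p f t
    using not_left_invertible[OF k] that unfolding jk by blast
  have gj: "gen_by A (P j) g" by (rule gen) (use j in auto)
  have "?N = carrier (P j)"
  proof (rule ccontr)
    assume neq: "?N \<noteq> carrier (P j)"
    let ?F = "{L. submodule L A (P j) \<and> ?N \<subseteq> L \<and> L \<noteq> carrier (P j)}"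
    have "?N \<in> ?F" using N neq by simp
    then obtain L where L: "L \<in> ?F" "\<And>L'. \<lbrakk>L' \<in> ?F; L \<subseteq> L'\<rbrakk> \<Longrightarrow> L' = L"
      using noetherian_module_maximal[OF noeth, of ?F] by blast
    then have subL: "submodule L A (P j)" and NL: "?N \<subseteq> L" and Lneq: "L \<noteq> carrier (P j)" by auto
    have YL: "z \<in> L" if "z \<in> carrier (P j)" "g' \<odot>\<^bsub>P j\<^esub> z = z" for z
      using NL mod_span_superset[of ?Y A "P j"] that by blast
    have g'L: "g' \<odot>\<^bsub>P j\<^esub> y \<in> L" if "y \<in> carrier (P j)" for y
      using that g' by (intro YL) (simp_all flip: P.smult_assoc)
    have split: "g \<odot>\<^bsub>P j\<^esub> y = g' \<odot>\<^bsub>P j\<^esub> y \<oplus>\<^bsub>P j\<^esub> u \<odot>\<^bsub>P j\<^esub> y" if "y \<in> carrier (P j)" for y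
      unfolding orth(3) by (rule P.smult_l_distr[OF g'(1) u1(1) that])
    \<comment> \<open>If c v with c = u f(y) u were outside L, then v = n + d c v with n in L.
      Multiplying by u gives v = u n + a v, where a = u d c is again such a value, taken by f at u d
      u y.\<close>
    have nonunit: "(u \<otimes>\<^bsub>A\<^esub> f y \<otimes>\<^bsub>A\<^esub> u) \<odot>\<^bsub>P j\<^esub> v \<in> L"
      if y: "y \<in> carrier (P j)" and f: "f \<in> lin_maps A (P j) (reg_module A)"
        and v: "v \<in> carrier (P j)" "u \<odot>\<^bsub>P j\<^esub> v = v" for y f v
    proof (rule ccontr)
      let ?c = "u \<otimes>\<^bsub>A\<^esub> f y \<otimes>\<^bsub>A\<^esub> u"
      assume not: "?c \<odot>\<^bsub>P j\<^esub> v \<notin> L"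
      have fy: "f y \<in> carrier A" by (rule form_closed[OF f y])
      have c: "?c \<in> carrier A" using u1 fy by simp
      let ?D = "{d \<odot>\<^bsub>P j\<^esub> (?c \<odot>\<^bsub>P j\<^esub> v) | d. d \<in> carrier A}"
      have D: "submodule ?D A (P j)" by (rule P.cyclic_submodule) (use c v in simp)
      have "?c \<odot>\<^bsub>P j\<^esub> v = \<one>\<^bsub>A\<^esub> \<odot>\<^bsub>P j\<^esub> (?c \<odot>\<^bsub>P j\<^esub> v)" using c v by simp
      then have "?c \<odot>\<^bsub>P j\<^esub> v \<in> ?D" using A.one_closed by blast
      then have "L <+>\<^bsub>P j\<^esub> ?D \<noteq> L" using P.subset_set_add(2)[OF subL D] not by blast
      then have "L <+>\<^bsub>P j\<^esub> ?D = carrier (P j)"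
        using L(2)[of "L <+>\<^bsub>P j\<^esub> ?D"] P.submodule_set_add[OF subL D] P.subset_set_add(1)[OF subL D] NL by blast
      then have "v \<in> L <+>\<^bsub>P j\<^esub> ?D" using v(1) by simp
      then obtain n d where nd: "n \<in> L" "d \<in> carrier A" "v = n \<oplus>\<^bsub>P j\<^esub> d \<odot>\<^bsub>P j\<^esub> (?c \<odot>\<^bsub>P j\<^esub> v)"
        by (auto elim!: P.set_add_memE)
      have nP: "n \<in> carrier (P j)" by (rule submodule_in_carrier[OF subL nd(1)])
      let ?e = "u \<otimes>\<^bsub>A\<^esub> d \<otimes>\<^bsub>A\<^esub> u"
      have e: "?e \<in> carrier A" using nd(2) u1 by simp
      let ?y = "?e \<odot>\<^bsub>P j\<^esub> y"
      have yP: "?y \<in> carrier (P j)" using e y by simp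
      let ?a = "u \<otimes>\<^bsub>A\<^esub> f ?y \<otimes>\<^bsub>A\<^esub> u"
      have fy': "f ?y \<in> carrier A" by (rule form_closed[OF f yP])
      have aA: "?a \<in> carrier A" using u1 fy' by simp
      have a_eq: "?a = u \<otimes>\<^bsub>A\<^esub> d \<otimes>\<^bsub>A\<^esub> ?c"
      proof -
        have "?a = (u \<otimes>\<^bsub>A\<^esub> u) \<otimes>\<^bsub>A\<^esub> (d \<otimes>\<^bsub>A\<^esub> (u \<otimes>\<^bsub>A\<^esub> (f y \<otimes>\<^bsub>A\<^esub> u)))"
          unfolding form_smult[OF f e y] using u1(1) nd(2) fy by (simp add: A.m_assoc)
        then show ?thesis using u1 nd(2) fy by (simp add: A.m_assoc)
      qed
      have ua: "u \<otimes>\<^bsub>A\<^esub> ?a = ?a" "?a \<otimes>\<^bsub>A\<^esub> u = ?a"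
      proof -
        have "u \<otimes>\<^bsub>A\<^esub> ?a = (u \<otimes>\<^bsub>A\<^esub> u) \<otimes>\<^bsub>A\<^esub> f ?y \<otimes>\<^bsub>A\<^esub> u" using u1(1) fy' by (simp add: A.m_assoc)
        then show "u \<otimes>\<^bsub>A\<^esub> ?a = ?a" using u1 by simp
        show "?a \<otimes>\<^bsub>A\<^esub> u = ?a" using u1 fy' by (simp add: A.m_assoc)
      qed
      obtain t where t: "t \<in> carrier A" "t \<otimes>\<^bsub>A\<^esub> ?a = u \<or> t \<otimes>\<^bsub>A\<^esub> (u \<ominus>\<^bsub>A\<^esub> ?a) = u"
        using primitive_idempotent_local[OF u aA ua] by blast
      then have t': "t \<otimes>\<^bsub>A\<^esub> (u \<ominus>\<^bsub>A\<^esub> ?a) = u" using nli[OF yP f] by blast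
      have av: "?a \<odot>\<^bsub>P j\<^esub> v = (u \<otimes>\<^bsub>A\<^esub> d) \<odot>\<^bsub>P j\<^esub> (?c \<odot>\<^bsub>P j\<^esub> v)"
        unfolding a_eq by (rule P.smult_assoc) (use u1 nd(2) c v in auto)
      have cv: "?c \<odot>\<^bsub>P j\<^esub> v \<in> carrier (P j)" using c v(1) by simp
      have "v = u \<odot>\<^bsub>P j\<^esub> (n \<oplus>\<^bsub>P j\<^esub> d \<odot>\<^bsub>P j\<^esub> (?c \<odot>\<^bsub>P j\<^esub> v))" using v(2) nd(3) by simp
      also have "\<dots> = u \<odot>\<^bsub>P j\<^esub> n \<oplus>\<^bsub>P j\<^esub> ?a \<odot>\<^bsub>P j\<^esub> v"
        unfolding av using u1(1) nP nd(2) cv by (simp add: P.smult_r_distr P.smult_assoc)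
      finally have v_eq: "v = u \<odot>\<^bsub>P j\<^esub> n \<oplus>\<^bsub>P j\<^esub> ?a \<odot>\<^bsub>P j\<^esub> v" .
      have "(u \<ominus>\<^bsub>A\<^esub> ?a) \<odot>\<^bsub>P j\<^esub> v = v \<ominus>\<^bsub>P j\<^esub> ?a \<odot>\<^bsub>P j\<^esub> v"
        using u1(1) aA v by (simp add: P.smult_l_diff)
      also have "\<dots> = (u \<odot>\<^bsub>P j\<^esub> n \<oplus>\<^bsub>P j\<^esub> ?a \<odot>\<^bsub>P j\<^esub> v) \<ominus>\<^bsub>P j\<^esub> ?a \<odot>\<^bsub>P j\<^esub> v"
        using v_eq by simp
      also have "\<dots> = u \<odot>\<^bsub>P j\<^esub> n"
        using u1(1) nP aA v(1) by (simp add: P.M.minus_eq P.M.a_assoc P.M.r_neg)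
      finally have "t \<odot>\<^bsub>P j\<^esub> ((u \<ominus>\<^bsub>A\<^esub> ?a) \<odot>\<^bsub>P j\<^esub> v) \<in> L"
        using submodule_smult[OF subL t(1) submodule_smult[OF subL u1(1) nd(1)]] by simp
      moreover have "t \<odot>\<^bsub>P j\<^esub> ((u \<ominus>\<^bsub>A\<^esub> ?a) \<odot>\<^bsub>P j\<^esub> v) = v"
        using P.smult_assoc[OF t(1) _ v(1), of "u \<ominus>\<^bsub>A\<^esub> ?a"] t' u1(1) aA v(2) by simp
      ultimately have "v \<in> L" by simp
      then show False using not submodule_smult[OF subL c] by blast
    qed
    \<comment> \<open>Splitting z = g' z + u z in a dual basis term gives u f(y) z = u f(y) (g' z) +
      (u f(y) u) (u z). The summands lie in L by the choice of L and by
      \<open>nonunit\<close>.\<close>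
    have uL: "u \<odot>\<^bsub>P j\<^esub> y \<in> L" if y: "y \<in> carrier (P j)" for y
    proof -
      have "y \<in> {v \<in> carrier (P j). u \<odot>\<^bsub>P j\<^esub> v \<in> L}"
      proof (rule dual_basis_gen_by[OF proj gj y])
        show "\<zero>\<^bsub>P j\<^esub> \<in> {v \<in> carrier (P j). u \<odot>\<^bsub>P j\<^esub> v \<in> L}" using u1 submodule_zero[OF subL] by simp
        show "v \<oplus>\<^bsub>P j\<^esub> v' \<in> {v \<in> carrier (P j). u \<odot>\<^bsub>P j\<^esub> v \<in> L}"
          if "v \<in> {v \<in> carrier (P j). u \<odot>\<^bsub>P j\<^esub> v \<in> L}" "v' \<in> {v \<in> carrier (P j). u \<odot>\<^bsub>P j\<^esub> v \<in> L}" for v v'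
          using that u1(1) submodule_add[OF subL, of "u \<odot>\<^bsub>P j\<^esub> v" "u \<odot>\<^bsub>P j\<^esub> v'"] by (simp add: P.smult_r_distr)
        fix f z assume f: "f \<in> lin_maps A (P j) (reg_module A)" and z: "z \<in> carrier (P j)" "g \<odot>\<^bsub>P j\<^esub> z = z"
        have fy: "f y \<in> carrier A" by (rule form_closed[OF f y])
        have z_eq: "z = g' \<odot>\<^bsub>P j\<^esub> z \<oplus>\<^bsub>P j\<^esub> u \<odot>\<^bsub>P j\<^esub> z" using split[OF z(1)] z(2) by simp
        have uz: "u \<odot>\<^bsub>P j\<^esub> z \<in> carrier (P j)" "u \<odot>\<^bsub>P j\<^esub> (u \<odot>\<^bsub>P j\<^esub> z) = u \<odot>\<^bsub>P j\<^esub> z"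
          using u1 z(1) by (simp_all flip: P.smult_assoc)
        have g'z: "g' \<odot>\<^bsub>P j\<^esub> z \<in> carrier (P j)" using g' z(1) by simp
        let ?c = "u \<otimes>\<^bsub>A\<^esub> f y"
        have c: "?c \<in> carrier A" using u1 fy by simp
        have "u \<odot>\<^bsub>P j\<^esub> (f y \<odot>\<^bsub>P j\<^esub> z) = ?c \<odot>\<^bsub>P j\<^esub> z" using P.smult_assoc[OF u1(1) fy z(1)] by simp
        also have "\<dots> = ?c \<odot>\<^bsub>P j\<^esub> (g' \<odot>\<^bsub>P j\<^esub> z \<oplus>\<^bsub>P j\<^esub> u \<odot>\<^bsub>P j\<^esub> z)" using z_eq by simp
        also have "\<dots> = ?c \<odot>\<^bsub>P j\<^esub> (g' \<odot>\<^bsub>P j\<^esub> z) \<oplus>\<^bsub>P j\<^esub> ?c \<odot>\<^bsub>P j\<^esub> (u \<odot>\<^bsub>P j\<^esub> z)"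
          by (rule P.smult_r_distr[OF c g'z uz(1)])
        also have "?c \<odot>\<^bsub>P j\<^esub> (u \<odot>\<^bsub>P j\<^esub> z) = (?c \<otimes>\<^bsub>A\<^esub> u) \<odot>\<^bsub>P j\<^esub> (u \<odot>\<^bsub>P j\<^esub> z)"
          using P.smult_assoc[OF c u1(1) uz(1)] uz(2) by simp
        finally have "u \<odot>\<^bsub>P j\<^esub> (f y \<odot>\<^bsub>P j\<^esub> z) \<in> L"
          using submodule_add[OF subL submodule_smult[OF subL c g'L[OF z(1)]] nonunit[OF y f uz]] by simp
        then show "f y \<odot>\<^bsub>P j\<^esub> z \<in> {v \<in> carrier (P j). u \<odot>\<^bsub>P j\<^esub> v \<in> L}" using fy z(1) by simp
      qed auto
      then show ?thesis by simp
    qed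
    obtain Z where Z: "finite Z" "Z \<subseteq> carrier (P j)" "mod_span A (P j) Z = carrier (P j)"
        "\<And>z. z \<in> Z \<Longrightarrow> g \<odot>\<^bsub>P j\<^esub> z = z"
      by (rule gen_byE[OF gj]) blast
    have "Z \<subseteq> L"
    proof
      fix z assume z: "z \<in> Z"
      then have zP: "z \<in> carrier (P j)" using Z(2) by blast
      have "g \<odot>\<^bsub>P j\<^esub> z \<in> L"
        unfolding split[OF zP] by (rule submodule_add[OF subL g'L[OF zP] uL[OF zP]])
      then show "z \<in> L" using Z(4)[OF z] by simp
    qed
    then have "carrier (P j) \<subseteq> L" using mod_span_minimal[OF subL] Z(3) by blast
    then show False using Lneq submodule_subset[OF subL] by blast
  qed
  moreover obtain Z where "finite Z" "Z \<subseteq> ?Y" "mod_span A (P j) Z = ?N"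
    by (rule noetherian_finite_span[OF noeth, of ?Y]) auto
  ultimately show ?thesis unfolding gen_by_def by auto
qed

end

section \<open>Minimal resolutions\<close>

context plain_algebra
begin

lemma finsum_orthogonal:
  assumes e: "\<And>i. i \<in> T \<Longrightarrow> e i \<in> carrier A" "\<And>i. i \<in> T \<Longrightarrow> e i \<otimes>\<^bsub>A\<^esub> e i = e i"
      "\<And>i j. \<lbrakk>i \<in> T; j \<in> T; i \<noteq> j\<rbrakk> \<Longrightarrow> e i \<otimes>\<^bsub>A\<^esub> e j = \<zero>\<^bsub>A\<^esub>"
    and I: "finite I" "I \<subseteq> T" and j: "j \<in> T"
  shows "finsum A e I \<otimes>\<^bsub>A\<^esub> e j = (if j \<in> I then e j else \<zero>\<^bsub>A\<^esub>)"
    "e j \<otimes>\<^bsub>A\<^esub> finsum A e I = (if j \<in> I then e j else \<zero>\<^bsub>A\<^esub>)"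
proof -
  have "finsum A e I \<otimes>\<^bsub>A\<^esub> e j = (if j \<in> I then e j else \<zero>\<^bsub>A\<^esub>) \<and>
      e j \<otimes>\<^bsub>A\<^esub> finsum A e I = (if j \<in> I then e j else \<zero>\<^bsub>A\<^esub>)"
    using I
  proof (induction I)
    case empty
    show ?case using e(1)[OF j] by simp
  next
    case (insert i I)
    have i: "i \<in> T" "e i \<in> carrier A" and c: "e \<in> I \<rightarrow> carrier A" using insert.prems e(1) by auto
    have "finsum A e (insert i I) = e i \<oplus>\<^bsub>A\<^esub> finsum A e I" using insert.hyps i c by simp
    then show ?case
      using i c e(1)[OF j] insert.IH insert.prems e(2)[OF j] e(3)[OF i(1) j] e(3)[OF j i(1)] insert.hyps
      by (auto simp: l_distr r_distr)
  qed
  then show "finsum A e I \<otimes>\<^bsub>A\<^esub> e j = (if j \<in> I then e j else \<zero>\<^bsub>A\<^esub>)"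
    "e j \<otimes>\<^bsub>A\<^esub> finsum A e I = (if j \<in> I then e j else \<zero>\<^bsub>A\<^esub>)" by auto
qed

lemma finsum_idempotent:
  assumes e: "\<And>i. i \<in> T \<Longrightarrow> e i \<in> carrier A" "\<And>i. i \<in> T \<Longrightarrow> e i \<otimes>\<^bsub>A\<^esub> e i = e i"
      "\<And>i j. \<lbrakk>i \<in> T; j \<in> T; i \<noteq> j\<rbrakk> \<Longrightarrow> e i \<otimes>\<^bsub>A\<^esub> e j = \<zero>\<^bsub>A\<^esub>"
    and I: "finite I" "I \<subseteq> T"
  shows "finsum A e I \<in> carrier A" "finsum A e I \<otimes>\<^bsub>A\<^esub> finsum A e I = finsum A e I"
proof -
  show c: "finsum A e I \<in> carrier A" using I(2) e(1) by (intro finsum_closed) auto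
  have "finsum A e I' \<otimes>\<^bsub>A\<^esub> finsum A e I = finsum A e I'" if "I' \<subseteq> I" for I'
    using finite_subset[OF that I(1)] that
  proof (induction I')
    case (insert i I')
    have i: "i \<in> T" "i \<in> I" "e i \<in> carrier A" and c': "e \<in> I' \<rightarrow> carrier A" using insert.prems I(2) e(1) by auto
    have "e i \<otimes>\<^bsub>A\<^esub> finsum A e I = e i" using finsum_orthogonal(2)[OF e I i(1)] i(2) by simp
    then show ?case using insert i c' c by (simp add: l_distr)
  qed (use c in simp)
  then show "finsum A e I \<otimes>\<^bsub>A\<^esub> finsum A e I = finsum A e I" by blast
qed

end

lemma minimal_resolution_superfluous:
  assumes "minimal_projective_resolution A U P \<delta> \<epsilon>"
  shows "superfluous A (P j) (\<delta> (Suc j) ` carrier (P (Suc j)))"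
  using assms unfolding minimal_projective_resolution_def projective_resolution_def by (cases j) auto

context finite_algebra
begin

text \<open>Finite generation of the terms is a consequence of minimality: each is a projective
  cover of a submodule of a Noetherian module, and of U in degree 0.\<close>

lemma resolution_fin_gen:
  assumes U: "left_module A U" "fin_gen A U" and P: "minimal_projective_resolution A U P \<delta> \<epsilon>"
  shows "fin_gen A (P j)"
proof -
  have res: "projective A (P j)" "\<delta> (Suc j) \<in> lin_maps A (P (Suc j)) (P j)"
    "\<epsilon> \<in> lin_maps A (P 0) U" "\<epsilon> ` carrier (P 0) = carrier U"
    "superfluous A (P 0) (a_kernel (P 0) U \<epsilon>)"
    "superfluous A (P (Suc j)) (a_kernel (P (Suc j)) (P j) (\<delta> (Suc j)))" for j
    using P unfolding minimal_projective_resolution_def projective_resolution_def by auto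
  have mod: "left_module A (P j)" for j using res(1) unfolding projective_def by blast
  show ?thesis
  proof (induction j)
    case 0
    obtain Y where "finite Y" "mod_span A U Y = carrier U" using U(2) unfolding fin_gen_def by blast
    then show ?case
      using fin_gen_if_superfluous_kernel[OF mod U(1) res(3,5)] res(4) by simp
  next
    case (Suc j)
    have "noetherian_module A (P j)" by (rule noetherian_if_fin_gen_algebra[OF mod Suc])
    then obtain Y where "finite Y" "mod_span A (P j) Y = \<delta> (Suc j) ` carrier (P (Suc j))"
      using lin_maps_image_submodule[OF mod mod res(2)[of j]] unfolding noetherian_module_def by blast
    then show ?case by (rule fin_gen_if_superfluous_kernel[OF mod mod res(2,6)])
  qed
qed

text \<open>Trades the definition of s_I for a single element of the socle, the form in which the
  removal step uses it.\<close>

lemma s_number_witness: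
  assumes g: "finsum A e I \<in> carrier A" "finsum A e I \<otimes>\<^bsub>A\<^esub> finsum A e I = finsum A e I"
    and u: "e i \<in> carrier (corner_at A e I)" "e i \<otimes>\<^bsub>A\<^esub> e i = e i"
    and xs: "set xs \<subseteq> carrier R"
    and adm: "admissible_index R A e I xs i" and s: "s_number R \<mm> A e I xs i \<le> s"
  shows "\<exists>w\<in>socle (corner_at A e I) (quot_right_module R (corner_at A e I) xs).
    e i \<odot>\<^bsub>quot_right_module R (corner_at A e I) xs\<^esub> w \<notin>
      smult_span R (ideal_pow R \<mm> s) (restrict_scalars (corner_at A e I) (quot_right_module R (corner_at A e I) xs))"
proof -
  interpret Q: quotient_module R \<mm> "corner_at A e I" xs
    unfolding corner_at_def
    by (intro quotient_module.intro quotient_module_axioms.intro corner_finite_algebra g xs)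
  show ?thesis
  proof (rule Q.socle_witness[OF u(1)])
    show "e i \<otimes>\<^bsub>corner_at A e I\<^esub> e i = e i" using u(2) by (simp add: corner_at_def)
  qed (use adm s in \<open>simp_all add: admissible_index_def s_number_def Let_def\<close>)
qed

text \<open>The start of the induction on the index sets. The sum g of a basic set need not be 1,
  since each isomorphism type is listed only once, but 1 is a sum of products a e_i b and hence M =
  \<Lambda> g M.\<close>

lemma gen_by_basic_idempotents:
  fixes M :: "('a, 'p) module"
  assumes basic: "basic_idempotents A l e" and M: "left_module A M" "fin_gen A M"
    and g: "finsum A e {1..l} \<in> carrier A"
    and ge: "\<And>i. i \<in> {1..l} \<Longrightarrow> e i \<in> carrier A \<and> finsum A e {1..l} \<otimes>\<^bsub>A\<^esub> e i = e i"
  shows "gen_by A M (finsum A e {1..l})"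
proof -
  interpret M: left_module A M by fact
  let ?g = "finsum A e {1..l}"
  let ?Y = "{z \<in> carrier M. ?g \<odot>\<^bsub>M\<^esub> z = z}"
  let ?N = "mod_span A M ?Y"
  have N: "submodule ?N A M" by (rule M.mod_span_submodule) blast
  let ?T = "{a \<in> carrier A. \<forall>x\<in>carrier M. a \<odot>\<^bsub>M\<^esub> x \<in> ?N}"
  have "\<one>\<^bsub>A\<^esub> \<in> ?T"
  proof (rule one_in_trace_of_basic_idempotents[OF basic])
    show "\<zero>\<^bsub>A\<^esub> \<in> ?T" using submodule_zero[OF N] by simp
    show "x \<oplus>\<^bsub>A\<^esub> y \<in> ?T" if "x \<in> ?T" "y \<in> ?T" for x y
      using that submodule_add[OF N] by (auto simp: M.smult_l_distr)
    fix a b i assume ab: "a \<in> carrier A" "b \<in> carrier A" and i: "i \<in> {1..l}"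
    have ei: "e i \<in> carrier A" "?g \<otimes>\<^bsub>A\<^esub> e i = e i" using ge[OF i] by auto
    have "(a \<otimes>\<^bsub>A\<^esub> e i \<otimes>\<^bsub>A\<^esub> b) \<odot>\<^bsub>M\<^esub> x \<in> ?N" if x: "x \<in> carrier M" for x
    proof -
      have bx: "b \<odot>\<^bsub>M\<^esub> x \<in> carrier M" using ab x by simp
      have "e i \<odot>\<^bsub>M\<^esub> (b \<odot>\<^bsub>M\<^esub> x) \<in> ?Y"
        using M.smult_assoc[OF g ei(1) bx] ei bx by simp
      then have "e i \<odot>\<^bsub>M\<^esub> (b \<odot>\<^bsub>M\<^esub> x) \<in> ?N" by (rule subsetD[OF mod_span_superset])
      then have "a \<odot>\<^bsub>M\<^esub> (e i \<odot>\<^bsub>M\<^esub> (b \<odot>\<^bsub>M\<^esub> x)) \<in> ?N" by (rule submodule_smult[OF N ab(1)])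
      then show ?thesis using ab ei(1) x by (simp add: M.smult_assoc A.m_assoc)
    qed
    then show "a \<otimes>\<^bsub>A\<^esub> e i \<otimes>\<^bsub>A\<^esub> b \<in> ?T" using ab ei(1) by simp
  qed
  then have "\<one>\<^bsub>A\<^esub> \<odot>\<^bsub>M\<^esub> x \<in> ?N" if "x \<in> carrier M" for x using that by blast
  then have "?N = carrier M" using submodule_subset[OF N] by auto
  moreover obtain Z where "finite Z" "Z \<subseteq> ?Y" "mod_span A M Z = ?N"
    by (rule noetherian_finite_span[OF noetherian_if_fin_gen_algebra[OF M], of ?Y]) auto
  ultimately show ?thesis unfolding gen_by_def by auto
qed

theorem minimal_resolution_term_zero:
  fixes P :: "nat \<Rightarrow> ('a, 'p) module"
  assumes dim: "krull_dim R = enat d" and basic: "basic_idempotents A l e"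
    and x: "\<And>I. \<lbrakk>I \<noteq> {}; I \<subseteq> {1..l}\<rbrakk> \<Longrightarrow> set (x I) \<subseteq> \<mm> \<and> regular_seq R (corner_at A e I) (x I)"
    and adm: "\<And>I. \<lbrakk>I \<noteq> {}; I \<subseteq> {1..l}\<rbrakk> \<Longrightarrow> admissible_index R A e I (x I) (\<iota> I)"
    and s: "\<And>I. \<lbrakk>I \<noteq> {}; I \<subseteq> {1..l}\<rbrakk> \<Longrightarrow> s_number R \<mm> A e I (x I) (\<iota> I) \<le> s"
    and U: "left_module A U" "fin_gen A U" and P: "minimal_projective_resolution A U P \<delta> \<epsilon>"
    and small: "\<And>j. j \<le> l * (d + 1) \<Longrightarrow> \<delta> (Suc j) ` carrier (P (Suc j))
      \<subseteq> smult_span R (ideal_pow R \<mm> s) (restrict_scalars A (P j))"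
  shows "carrier (P (l * (d + 1))) = {\<zero>\<^bsub>P (l * (d + 1))\<^esub>}"
proof -
  have e: "e i \<in> carrier A" "e i \<otimes>\<^bsub>A\<^esub> e i = e i" "primitive_idempotent A (e i)" if "i \<in> {1..l}" for i
    using basic that unfolding basic_idempotents_def primitive_idempotent_def by blast+
  have orth: "e i \<otimes>\<^bsub>A\<^esub> e j = \<zero>\<^bsub>A\<^esub>" if "i \<in> {1..l}" "j \<in> {1..l}" "i \<noteq> j" for i j
    using basic that unfolding basic_idempotents_def by blast
  have sum: "finsum A e I \<otimes>\<^bsub>A\<^esub> e j = (if j \<in> I then e j else \<zero>\<^bsub>A\<^esub>)"
    "e j \<otimes>\<^bsub>A\<^esub> finsum A e I = (if j \<in> I then e j else \<zero>\<^bsub>A\<^esub>)"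
    if "finite I" "I \<subseteq> {1..l}" "j \<in> {1..l}" for I j
    by (rule A.finsum_orthogonal[where T = "{1..l}"]; use that e orth in simp)+
  have idem: "finsum A e I \<in> carrier A" "finsum A e I \<otimes>\<^bsub>A\<^esub> finsum A e I = finsum A e I"
    if "finite I" "I \<subseteq> {1..l}" for I
    by (rule A.finsum_idempotent[where T = "{1..l}"]; use that e orth in simp)+
  have res: "projective A (P j)" "\<delta> (Suc j) \<in> lin_maps A (P (Suc j)) (P j)"
    "\<delta> (Suc (Suc j)) ` carrier (P (Suc (Suc j))) = a_kernel (P (Suc j)) (P j) (\<delta> (Suc j))" for j
    using P unfolding minimal_projective_resolution_def projective_resolution_def by auto
  have mod: "left_module A (P j)" for j using res(1) unfolding projective_def by blast
  note fg = resolution_fin_gen[OF U P]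
  let ?L = "l * (d + 1)"
  \<comment> \<open>The removed indices are prescribed by \<iota>, so only the size of I after k
    steps is asserted. The upper end of the range of degrees stays fixed because smallness of the
    differentials is known up to there.\<close>
  have "\<exists>I\<subseteq>{1..l}. card I = l - k \<and> (\<forall>j. k * (d + 1) \<le> j \<and> j \<le> ?L \<longrightarrow> gen_by A (P j) (finsum A e I))"
    if "k \<le> l" for k
    using that
  proof (induction k)
    case 0
    have "gen_by A (P j) (finsum A e {1..l})" for j
      using sum(1)[of "{1..l}"] idem[of "{1..l}"] e(1)
      by (intro gen_by_basic_idempotents[OF basic mod fg]) auto
    then show ?case by (intro exI[of _ "{1..l}"]) simp
  next
    case (Suc k)
    then obtain I where I: "I \<subseteq> {1..l}" "card I = l - k"
      and gen: "\<And>j. \<lbrakk>k * (d + 1) \<le> j; j \<le> ?L\<rbrakk> \<Longrightarrow> gen_by A (P j) (finsum A e I)"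
      by auto
    have finI: "finite I" by (rule finite_subset[OF I(1)]) simp
    have I0: "I \<noteq> {}" using I(2) Suc.prems by auto
    define i where "i = \<iota> I"
    have i: "i \<in> I" using adm[OF I0 I(1)] unfolding admissible_index_def i_def by blast
    then have il: "i \<in> {1..l}" using I(1) by blast
    let ?g = "finsum A e I" and ?g' = "finsum A e (I - {i})"
    have I': "finite (I - {i})" "I - {i} \<subseteq> {1..l}" using finI I(1) by auto
    note g = idem[OF finI I(1)] and g' = idem[OF I']
    have gi: "?g \<otimes>\<^bsub>A\<^esub> e i = e i" "e i \<otimes>\<^bsub>A\<^esub> ?g = e i" using sum[OF finI I(1) il] i by auto
    have split: "?g = ?g' \<oplus>\<^bsub>A\<^esub> e i"
    proof -
      have "e \<in> I - {i} \<rightarrow> carrier A" using I(1) e(1) by blast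
      then have "finsum A e (insert i (I - {i})) = e i \<oplus>\<^bsub>A\<^esub> ?g'"
        using I' e(1)[OF il] by (intro A.finsum_insert) auto
      then show ?thesis using i g'(1) e(1)[OF il] by (simp add: insert_absorb A.a_comm)
    qed
    have xs: "set (x I) \<subseteq> carrier R" using x[OF I0 I(1)] mm_subset by blast
    have reg: "regular_seq R (corner A ?g) (x I)" using x[OF I0 I(1)] by (simp add: corner_at_def)
    interpret B: finite_algebra R \<mm> "corner A ?g" by (rule corner_finite_algebra[OF g])
    have len: "length (x I) \<le> d"
      using length_regular_seq_le_krull_dim[OF B.left_module_R xs reg] dim by simp
    have eB: "e i \<in> carrier (corner A ?g)" by (rule A.corner_memI[OF g gi e(1)[OF il]])
    obtain w where w: "w \<in> socle (corner A ?g) (quot_right_module R (corner A ?g) (x I))"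
      "e i \<odot>\<^bsub>quot_right_module R (corner A ?g) (x I)\<^esub> w \<notin>
        smult_span R (ideal_pow R \<mm> s) (restrict_scalars (corner A ?g) (quot_right_module R (corner A ?g) (x I)))"
      using s_number_witness[OF g _ e(2)[OF il] xs] eB adm[OF I0 I(1)] s[OF I0 I(1)]
      unfolding corner_at_def i_def by blast
    interpret S: summand_step R \<mm> A P \<delta> ?g ?g' "e i" "x I" w s "k * (d + 1)" ?L
    proof (unfold_locales, goal_cases)
      case (5 j)
      show ?case by (rule minimal_resolution_superfluous[OF P])
    qed (use res fg g g' e(3)[OF il] sum[OF I' il] split gen xs reg small w in auto)
    \<comment> \<open>The step starts in degree k (d + 1) and uses length + 1 further degrees, at
      most d + 1 by the bound on regular sequences.\<close>
    have "gen_by A (P j) ?g'" if "Suc k * (d + 1) \<le> j" "j \<le> ?L" for j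
      by (rule S.gen_by_complement) (use that len in auto)
    moreover have "card (I - {i}) = l - Suc k" using I(2) i finI by simp
    ultimately show ?case using I'(2) by blast
  qed
  from this[of l] obtain I where I: "I \<subseteq> {1..l}" "card I = 0" "gen_by A (P ?L) (finsum A e I)" by auto
  have "I = {}" using I(1,2) finite_subset by (metis card_0_eq finite_atLeastAtMost)
  \<comment> \<open>With no index left the idempotent is 0, and all generators are fixed by
    0.\<close>
  then have "gen_by A (P ?L) \<zero>\<^bsub>A\<^esub>" using I(3) by simp
  then obtain Z where Z: "Z \<subseteq> carrier (P ?L)" "mod_span A (P ?L) Z = carrier (P ?L)"
      "\<And>z. z \<in> Z \<Longrightarrow> \<zero>\<^bsub>A\<^esub> \<odot>\<^bsub>P ?L\<^esub> z = z"
    by (rule gen_byE) blast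
  interpret PL: left_module A "P ?L" by (rule mod)
  have "z = \<zero>\<^bsub>P ?L\<^esub>" if "z \<in> Z" for z
    using Z(3)[OF that] PL.smult_l_null[OF subsetD[OF Z(1) that]] by simp
  then have "mod_span A (P ?L) Z \<subseteq> {\<zero>\<^bsub>P ?L\<^esub>}" by (intro mod_span_minimal[OF PL.submodule_trivial]) blast
  then show ?thesis using Z(2) PL.M.zero_closed by blast
qed

end

section \<open>Vanishing of the later terms and the projective dimension\<close>

lemma superfluous_carrier_zero:
  assumes P: "left_module A P" and K: "superfluous A P (carrier P)"
  shows "carrier P = {\<zero>\<^bsub>P\<^esub>}"
proof -
  interpret left_module A P by fact
  have "carrier P <+>\<^bsub>P\<^esub> {\<zero>\<^bsub>P\<^esub>} = carrier P"
    using subset_set_add(1)[OF submodule_carrier submodule_trivial]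
      submodule_subset[OF submodule_set_add[OF submodule_carrier submodule_trivial]] by blast
  then show ?thesis using K submodule_trivial unfolding superfluous_def by blast
qed

lemma minimal_resolution_terms_zero:
  assumes P: "minimal_projective_resolution A U P \<delta> \<epsilon>" and L: "carrier (P n) = {\<zero>\<^bsub>P n\<^esub>}"
    and j: "n \<le> j"
  shows "carrier (P j) = {\<zero>\<^bsub>P j\<^esub>}"
  using j
proof (induction j rule: dec_induct)
  case (step j)
  have res: "projective A (P j)" "\<delta> (Suc j) \<in> lin_maps A (P (Suc j)) (P j)"
    "superfluous A (P (Suc j)) (a_kernel (P (Suc j)) (P j) (\<delta> (Suc j)))" for j
    using P unfolding minimal_projective_resolution_def projective_resolution_def by auto
  have mod: "left_module A (P j)" for j using res(1) unfolding projective_def by blast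
  have "a_kernel (P (Suc j)) (P j) (\<delta> (Suc j)) = carrier (P (Suc j))"
    using lin_maps_closed[OF res(2)[of j]] step.IH by (auto intro: a_kernel_memI dest: a_kernel_memD)
  then show ?case using superfluous_carrier_zero[OF mod] res(3)[of j] by simp
qed (rule L)

theorem theorem5p2:
  fixes R :: "('r, 'k) ring_scheme" and \<mm> :: "'r set" and d :: nat
    and \<Lambda> :: "('r, 'a) module" and l :: nat and e :: "nat \<Rightarrow> 'a"
    and x :: "nat set \<Rightarrow> 'r list" and \<iota> :: "nat set \<Rightarrow> nat" and s :: nat
    and U :: "('a, 'u) module"
    and P :: "nat \<Rightarrow> ('a, 'p) module" and \<delta> :: "nat \<Rightarrow> 'p \<Rightarrow> 'p" and \<epsilon> :: "'p \<Rightarrow> 'u"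
  assumes "noetherian_domain R"
    and "local_ring_with R \<mm>"
    and "adic_complete R \<mm>"
    and "krull_dim R = enat d"
    and "assoc_algebra R \<Lambda>"
    and "fin_gen R \<Lambda>"
    and "torsion_free R \<Lambda>"
    and "basic_idempotents \<Lambda> l e"
    and "\<And>I. \<lbrakk>I \<noteq> {}; I \<subseteq> {1..l}\<rbrakk> \<Longrightarrow> maximal_regular_seq R \<mm> (corner_at \<Lambda> e I) (x I)"
    and "\<And>I. \<lbrakk>I \<noteq> {}; I \<subseteq> {1..l}\<rbrakk> \<Longrightarrow> admissible_index R \<Lambda> e I (x I) (\<iota> I)"
    and "s = Max {s_number R \<mm> \<Lambda> e I (x I) (\<iota> I) | I. I \<noteq> {} \<and> I \<subseteq> {1..l}}"
    and "left_module \<Lambda> U"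
    and "fin_gen \<Lambda> U"
    and "minimal_projective_resolution \<Lambda> U P \<delta> \<epsilon>"
    and "\<And>j. j \<le> l * (d + 1) \<Longrightarrow>
           \<delta> (Suc j) ` carrier (P (Suc j))
             \<subseteq> smult_span R (ideal_pow R \<mm> s) (restrict_scalars \<Lambda> (P j))"
  shows "carrier (P (l * (d + 1))) = {\<zero>\<^bsub>P (l * (d + 1))\<^esub>} \<and>
         proj_dim TYPE('p) \<Lambda> U < ereal (real (l * (d + 1)))"
proof -
  interpret R: noetherian_domain R by (rule assms(1))
  interpret \<Lambda>: finite_algebra R \<mm> \<Lambda>
    by (intro finite_algebra.intro finite_algebra_axioms.intro noetherian_local.intro
        noetherian_local_axioms.intro plain_algebra.intro R.is_cring R.noetherian_ring_axioms assms(2,3,5,6))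
  have s: "s_number R \<mm> \<Lambda> e I (x I) (\<iota> I) \<le> s" if "I \<noteq> {}" "I \<subseteq> {1..l}" for I
  proof -
    have "{s_number R \<mm> \<Lambda> e I (x I) (\<iota> I) | I. I \<noteq> {} \<and> I \<subseteq> {1..l}}
        \<subseteq> (\<lambda>I. s_number R \<mm> \<Lambda> e I (x I) (\<iota> I)) ` Pow {1..l}" by blast
    then have "finite {s_number R \<mm> \<Lambda> e I (x I) (\<iota> I) | I. I \<noteq> {} \<and> I \<subseteq> {1..l}}"
      by (rule finite_subset) simp
    then show ?thesis unfolding assms(11) by (rule Max_ge) (use that in blast)
  qed
  let ?L = "l * (d + 1)"
  have zero: "carrier (P ?L) = {\<zero>\<^bsub>P ?L\<^esub>}"
    by (rule \<Lambda>.minimal_resolution_term_zero[OF assms(4,8) _ assms(10) s assms(12-15)])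
      (use assms(9) in \<open>auto simp: maximal_regular_seq_def\<close>)
  have zeros: "carrier (P j) = {\<zero>\<^bsub>P j\<^esub>}" if "?L \<le> j" for j
    by (rule minimal_resolution_terms_zero[OF assms(14) zero that])
  have res: "projective_resolution \<Lambda> U P \<delta> \<epsilon>"
    using assms(14) unfolding minimal_projective_resolution_def by blast
  have "proj_dim TYPE('p) \<Lambda> U < ereal (real ?L)"
  proof (cases "carrier U = {\<zero>\<^bsub>U\<^esub>}")
    case True
    then show ?thesis by (simp add: proj_dim_def)
  next
    case False
    \<comment> \<open>The strict bound needs a resolution of length ?L - 1. For ?L = 0 the vanishing
      of P_0 would already force U = 0, the case treated separately.\<close>
    have "?L \<noteq> 0"
    proof
      assume "?L = 0"
      then have P0: "carrier (P 0) = {\<zero>\<^bsub>P 0\<^esub>}" using zero by simp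
      have eps: "\<epsilon> \<in> lin_maps \<Lambda> (P 0) U" "\<epsilon> ` carrier (P 0) = carrier U" "left_module \<Lambda> (P 0)"
        using res unfolding projective_resolution_def projective_def by auto
      have "\<epsilon> \<zero>\<^bsub>P 0\<^esub> = \<zero>\<^bsub>U\<^esub>" by (rule lin_maps_zero[OF eps(3) assms(12) eps(1)])
      then show False using False eps(2) P0 by simp
    qed
    then obtain n where n: "?L = Suc n" using not0_implies_Suc by blast
    have "\<exists>(P :: nat \<Rightarrow> ('a, 'p) module) \<delta> \<epsilon>.
        projective_resolution \<Lambda> U P \<delta> \<epsilon> \<and> (\<forall>j>n. carrier (P j) = {\<zero>\<^bsub>P j\<^esub>})"
      using res zeros n by (intro exI[of _ P] exI[of _ \<delta>] exI[of _ \<epsilon>]) auto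
    then have "proj_dim TYPE('p) \<Lambda> U \<le> ereal (real n)"
      unfolding proj_dim_def if_not_P[OF False] by (intro Inf_lower) blast
    also have "ereal (real n) < ereal (real ?L)" unfolding n by simp
    finally show ?thesis .
  qed
  then show ?thesis using zero by blast
qed

end
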